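(* For every real $q$ with $2\le q<\infty$ and every $\varphi\in\dot H^1(\mathbb{S}^2)$, $$\|\varphi\|_{L^q(\mathbb{S}^2)}\le\left(\frac1{4\pi}\right)^{\frac{q-2}{2q}}\left(\frac q2\right)^{1/2}\|\varphi\|^{2/q}\,\|\nabla\varphi\|^{1-2/q}.$$
   Context: $\mathbb{S}^2$ is the unit two-dimensional sphere with its standard round metric and the natural (non-normalized) surface measure $d\sigma$, of total mass $4\pi$; all $L^q$-norms are with respect to $d\sigma$, and $\nabla$ is the gradient with respect to the round metric. Functions are real-valued. $\|\cdot\|$ denotes the $L^2(\mathbb{S}^2)$-norm of functions or of tangent vector fields. $\dot H^1(\mathbb{S}^2)$ is the space of $\varphi\in H^1(\mathbb{S}^2)$ with $\int_{\mathbb{S}^2}\varphi\,d\sigma=0$. For $q=2$ the factor $\|\nabla\varphi\|^{1-2/q}$ is understood as $1$. *)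

theory Defs
  imports "HOL-Analysis.Analysis"
begin

abbreviation S2 :: "(real^3) set"
  where "S2 \<equiv> sphere 0 1"

text \<open>
  The round surface measure, as the cone measure: the area of a Borel set \<open>A \<subseteq> S2\<close> is
  three times the volume of \<open>{t *\<^sub>R x | t x. 0 < t \<and> t < 1 \<and> x \<in> A}\<close>
  (polar coordinates).  It is not normalised, see \<open>emeasure_sphere_measure_S2\<close>.
\<close>

definition sphere_measure :: "(real^3) measure"
  where "sphere_measure =
    scale_measure 3
      (distr (restrict_space lborel (ball 0 1 - {0})) (restrict_space borel S2)
        (\<lambda>x. x /\<^sub>R norm x))"

lemma space_sphere_measure: "space sphere_measure = S2"
  by (simp add: sphere_measure_def space_scale_measure space_restrict_space)

lemma sets_sphere_measure: "sets sphere_measure = sets (restrict_space borel S2)"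
  by (simp add: sphere_measure_def)

lemma measurable_radial_projection:
  "(\<lambda>x::real^3. x /\<^sub>R norm x) \<in>
     measurable (restrict_space lborel (ball 0 1 - {0})) (restrict_space borel S2)"
  by (rule measurable_restrict_space3) auto

lemma emeasure_sphere_measure_S2: "emeasure sphere_measure S2 = ennreal (4 * pi)"
proof -
  have S2: "S2 \<in> sets (restrict_space borel S2)"
    using sets.top[of "restrict_space borel S2"] by (simp add: space_restrict_space)
  have vimage: "(\<lambda>x. x /\<^sub>R norm x) -` S2 \<inter> (ball (0::real^3) 1 - {0}) = ball 0 1 - {0}"
    by auto
  have "emeasure (distr (restrict_space lborel (ball 0 1 - {0})) (restrict_space borel S2)
          (\<lambda>x::real^3. x /\<^sub>R norm x)) S2 =
        emeasure (restrict_space lborel (ball (0::real^3) 1 - {0})) (ball 0 1 - {0})"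
    using emeasure_distr[OF measurable_radial_projection S2] vimage
    by (simp add: space_restrict_space)
  also have "\<dots> = emeasure lborel (ball (0::real^3) 1 - {0})"
    by (rule emeasure_restrict_space) simp_all
  also have "\<dots> = emeasure lborel (ball (0::real^3) 1)"
    by (rule emeasure_Diff_null_set) (simp_all add: null_sets_def)
  also have "\<dots> = ennreal (4 / 3 * pi)"
    by (simp add: emeasure_ball unit_ball_vol_3)
  finally have "emeasure sphere_measure S2 = ennreal 3 * ennreal (4 / 3 * pi)"
    by (simp add: sphere_measure_def)
  also have "\<dots> = ennreal (3 * (4 / 3 * pi))"
    by (rule ennreal_mult[symmetric]) simp_all
  finally show ?thesis
    by simp
qed

text \<open>Functions and vector fields on the sphere are represented by functions on the ambient
  space, of which only the values on \<open>S2\<close> matter.\<close>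

definition L2_sphere :: "(real^3 \<Rightarrow> 'b::euclidean_space) set"
  where "L2_sphere =
    {f. f \<in> borel_measurable sphere_measure \<and> integrable sphere_measure (\<lambda>x. (norm (f x))\<^sup>2)}"

text \<open>\<open>Lnorm q f\<close> is the \<open>L\<^sup>q\<close> norm only if \<open>norm (f x) powr q\<close> is integrable; otherwise it is \<open>0\<close>.\<close>

definition Lnorm :: "real \<Rightarrow> (real^3 \<Rightarrow> 'b::euclidean_space) \<Rightarrow> real"
  where "Lnorm q f = (\<integral>x. norm (f x) powr q \<partial>sphere_measure) powr (1 / q)"

primrec Ck_on :: "nat \<Rightarrow> (real^3) set \<Rightarrow> (real^3 \<Rightarrow> real) \<Rightarrow> bool"
  where
    "Ck_on 0 U f \<longleftrightarrow> continuous_on U f"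
  | "Ck_on (Suc k) U f \<longleftrightarrow>
      (\<exists>g. (\<forall>x\<in>U. GDERIV f x :> g x) \<and> (\<forall>i. Ck_on k U (\<lambda>x. g x $ i)))"

definition smooth_on_S2 :: "(real^3 \<Rightarrow> real) \<Rightarrow> bool"
  where "smooth_on_S2 f \<longleftrightarrow>
    (\<exists>U F. open U \<and> S2 \<subseteq> U \<and> (\<forall>k. Ck_on k U F) \<and> (\<forall>x\<in>S2. f x = F x))"

text \<open>
  The Riemannian gradient: since \<open>S2\<close> carries the metric induced by the inner product of the
  ambient space, it is the vector tangent to \<open>S2\<close> at \<open>x\<close> that represents the derivative
  of \<open>f\<close> along \<open>S2\<close>.  The derivative \<open>at x within S2\<close> alone determines it only up to
  multiples of the normal \<open>x\<close>; tangency makes it unique.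
\<close>

definition has_surface_gradient :: "(real^3 \<Rightarrow> real) \<Rightarrow> real^3 \<Rightarrow> real^3 \<Rightarrow> bool"
  where "has_surface_gradient f v x \<longleftrightarrow>
    v \<bullet> x = 0 \<and> (f has_derivative (\<lambda>h. v \<bullet> h)) (at x within S2)"

lemma smooth_on_S2_has_surface_gradient:
  assumes "smooth_on_S2 f" "x \<in> S2"
  shows "\<exists>v. has_surface_gradient f v x"
proof -
  from assms(1) obtain U F where U: "S2 \<subseteq> U" "\<forall>k. Ck_on k U F" and fF: "\<forall>y\<in>S2. f y = F y"
    unfolding smooth_on_S2_def by blast
  have "Ck_on (Suc 0) U F"
    using U(2) ..
  then obtain g where "GDERIV F x :> g"
    using assms(2) U(1) unfolding Ck_on.simps(2) by blast
  then have F: "(F has_derivative (\<lambda>h. h \<bullet> g)) (at x within S2)"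
    unfolding gderiv_def by (rule has_derivative_at_withinI)
  have xx: "x \<bullet> x = 1"
    using assms(2) by (simp add: dot_square_norm)
  have "((\<lambda>y. 1 - (y - x) \<bullet> (y - x) / 2) has_derivative (\<lambda>h. 0)) (at x within S2)"
    by (auto intro!: derivative_eq_intros)
  then have normal: "((\<lambda>y. x \<bullet> y) has_derivative (\<lambda>h. 0)) (at x within S2)"
  proof (rule has_derivative_transform[rotated 2])
    fix y assume "y \<in> S2"
    then have "y \<bullet> y = 1"
      by (simp add: dot_square_norm)
    then show "x \<bullet> y = 1 - (y - x) \<bullet> (y - x) / 2"
      using xx by (simp add: inner_diff_left inner_diff_right inner_commute[of y x] field_simps)
  qed (use assms(2) in simp)
  have "((\<lambda>y. F y - (g \<bullet> x) * (x \<bullet> y) + (g \<bullet> x) * (x \<bullet> y)) has_derivative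
          (\<lambda>h. h \<bullet> g - (g \<bullet> x) * (x \<bullet> h) + (g \<bullet> x) * 0)) (at x within S2)"
    by (intro has_derivative_add has_derivative_diff F has_derivative_mult_right normal
        has_derivative_inner_right has_derivative_ident)
  then have "(F has_derivative (\<lambda>h. (g - (g \<bullet> x) *\<^sub>R x) \<bullet> h)) (at x within S2)"
    by (simp add: inner_diff_left inner_diff_right inner_commute)
  then have "(f has_derivative (\<lambda>h. (g - (g \<bullet> x) *\<^sub>R x) \<bullet> h)) (at x within S2)"
    by (rule has_derivative_transform[rotated 2]) (use assms(2) fF in simp_all)
  moreover have "(g - (g \<bullet> x) *\<^sub>R x) \<bullet> x = 0"
    by (simp add: inner_diff_left xx)
  ultimately show ?thesis
    unfolding has_surface_gradient_def by blast
qed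

lemma has_surface_gradient_unique:
  assumes "has_surface_gradient f v x" "has_surface_gradient f w x" "x \<in> S2"
  shows "v = w"
proof (rule ccontr)
  assume "v \<noteq> w"
  define d where "d = v - w"
  define u where "u = d /\<^sub>R norm d"
  define c where "c = (\<lambda>t::real. cos t *\<^sub>R x + sin t *\<^sub>R u)"
  have d: "d \<noteq> 0" "d \<bullet> x = 0"
    using \<open>v \<noteq> w\<close> assms by (auto simp: d_def has_surface_gradient_def inner_diff_left)
  then have u: "u \<bullet> u = 1" "u \<bullet> x = 0" "x \<bullet> u = 0" "x \<bullet> x = 1"
    using assms(3) by (auto simp: u_def inner_commute dot_square_norm power2_eq_square)
  have c0: "c 0 = x"
    by (simp add: c_def)
  have "norm (c t) = 1" for t
    unfolding norm_eq_1 using sin_cos_squared_add[of t]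
    by (simp add: c_def inner_add u power2_eq_square)
  then have cS: "range c \<subseteq> S2"
    by auto
  have "((\<lambda>y. f y - f y) has_derivative (\<lambda>h. v \<bullet> h - w \<bullet> h)) (at x within S2)"
    using assms(1,2) unfolding has_surface_gradient_def by (intro has_derivative_diff) auto
  then have "((\<lambda>y. 0) has_derivative (\<lambda>h. d \<bullet> h)) (at (c 0) within range c)"
    using has_derivative_subset[OF _ cS] by (simp add: c0 d_def inner_diff_left)
  moreover have "(c has_derivative (\<lambda>t. t *\<^sub>R u)) (at 0)"
    unfolding c_def by (auto intro!: derivative_eq_intros)
  ultimately have "((\<lambda>t. 0) has_derivative (\<lambda>t. d \<bullet> (t *\<^sub>R u))) (at (0::real))"
    using has_derivative_in_compose[of c _ 0 UNIV] by fastforce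
  then have "(\<lambda>t::real. d \<bullet> (t *\<^sub>R u)) = (\<lambda>t. 0)"
    by (rule has_derivative_unique) (rule has_derivative_const)
  then have "d \<bullet> u = 0"
    by (metis scaleR_one)
  then show False
    using d by (simp add: u_def)
qed

text \<open>
  \<open>H1_S2\<close> is the completion of the smooth functions in the \<open>H\<^sup>1\<close> norm, realised inside
  \<open>L\<^sup>2\<close>; the gradient of \<open>\<phi>\<close> is the \<open>L\<^sup>2\<close> limit of the gradients of
  the approximating smooth functions.  It is determined almost everywhere, so the choice in
  \<open>grad_S2\<close> is immaterial for its norm.
\<close>

definition has_H1_gradient :: "(real^3 \<Rightarrow> real) \<Rightarrow> (real^3 \<Rightarrow> real^3) \<Rightarrow> bool"
  where "has_H1_gradient \<phi> G \<longleftrightarrow>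
    \<phi> \<in> L2_sphere \<and> G \<in> L2_sphere \<and>
    (\<exists>f g. (\<forall>n. smooth_on_S2 (f n) \<and> (\<forall>x\<in>S2. has_surface_gradient (f n) (g n x) x)) \<and>
      (\<lambda>n::nat. Lnorm 2 (\<lambda>x. f n x - \<phi> x)) \<longlonglongrightarrow> 0 \<and>
      (\<lambda>n. Lnorm 2 (\<lambda>x. g n x - G x)) \<longlonglongrightarrow> 0)"

definition H1_S2 :: "(real^3 \<Rightarrow> real) set"
  where "H1_S2 = {\<phi>. \<exists>G. has_H1_gradient \<phi> G}"

definition H1dot_S2 :: "(real^3 \<Rightarrow> real) set"
  where "H1dot_S2 = {\<phi> \<in> H1_S2. (\<integral>x. \<phi> x \<partial>sphere_measure) = 0}"

definition grad_S2 :: "(real^3 \<Rightarrow> real) \<Rightarrow> real^3 \<Rightarrow> real^3"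
  where "grad_S2 \<phi> = (SOME G. has_H1_gradient \<phi> G)"

end

theory Submission
  imports Defs "HOL-Library.Discrete_Functions"
begin

text \<open>
  Fix \<open>q > 2\<close>, put \<open>s = q / (q - 2)\<close> and \<open>A = a - \<Delta>\<close> on functions of mean zero.  Summing the
  reproducing kernels of the spaces of spherical harmonics gives
  \<open>\<parallel>u\<parallel>\<^sub>\<infinity>\<^sup>2 \<le> D \<langle>A\<^sup>s u, u\<rangle>\<close> with \<open>4\<pi> D = \<Sum>\<^sub>l (2 l + 1) (a + l (l + 1))\<^sup>-\<^sup>s \<le> a\<^sup>1\<^sup>-\<^sup>s / (s - 1)\<close>,
  hence \<open>W \<le> (D \<integral>W) A\<^sup>s\<close> as quadratic forms for every weight \<open>W \<ge> 0\<close>.  Since \<open>x powr (1 / s)\<close> is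
  operator monotone, \<open>W powr (1 / s) \<le> (D \<integral>W) powr (1 / s) A\<close>.  With \<open>W = \<bar>\<phi>\<bar> powr q\<close> (truncated, as
  \<open>\<integral>W\<close> is not known to be finite), testing with \<open>\<phi>\<close> bounds the \<open>L\<^sup>q\<close> norm by
  \<open>a \<parallel>\<phi>\<parallel>\<^sup>2 + \<parallel>\<nabla>\<phi>\<parallel>\<^sup>2\<close>, and the optimal \<open>a\<close> gives the constant.
\<close>

section \<open>Rotation invariance of the surface measure\<close>

lemma distr_lborel_orthogonal:
  fixes R :: "(real, 'n::{finite,wellorder}) vec \<Rightarrow> (real, 'n) vec"
  assumes "orthogonal_transformation R"
  shows "distr lborel borel R = lborel"
proof (rule sym, rule lborel_eqI)
  have lin: "linear R"
    using assms orthogonal_transformation_linear by blast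
  have meas: "R \<in> borel_measurable borel"
    by (intro borel_measurable_continuous_onI linear_continuous_on linear_conv_bounded_linear[THEN iffD1] lin)
  fix l u :: "(real, 'n) vec"
  assume lu: "\<And>b. b \<in> Basis \<Longrightarrow> l \<bullet> b \<le> u \<bullet> b"
  obtain R' where R': "orthogonal_transformation R'" "R' = inv R"
    using assms orthogonal_transformation_inv by blast
  have bij: "bij R"
    using assms orthogonal_transformation_bij by blast
  have vim: "R -` box l u = R' ` box l u"
    using bij R'(2) by (simp add: bij_vimage_eq_inv_image)
  have fin: "box l u \<in> lmeasurable"
    by simp
  have "emeasure (distr lborel borel R) (box l u) = emeasure lborel (R -` box l u)"
    using meas by (subst emeasure_distr) auto
  also have "\<dots> = emeasure lebesgue (R' ` box l u)"
    using measurable_sets[OF meas, of "box l u"] vim by simp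
  also have "\<dots> = measure lebesgue (R' ` box l u)"
    using measurable_orthogonal_image[OF R'(1) fin] by (simp add: emeasure_eq_measure2 fmeasurableD2)
  also have "\<dots> = measure lebesgue (box l u)"
    by (simp add: measure_orthogonal_image[OF R'(1) fin])
  also have "\<dots> = (\<Prod>b\<in>Basis. (u - l) \<bullet> b)"
    using lu by (simp add: measure_lborel_box_eq)
  finally show "emeasure (distr lborel borel R) (box l u) = (\<Prod>b\<in>Basis. (u - l) \<bullet> b)" .
qed simp

lemma finite_measure_sphere_measure: "finite_measure sphere_measure"
  by (rule finite_measureI) (simp add: space_sphere_measure emeasure_sphere_measure_S2)

interpretation sphere: finite_measure sphere_measure
  by (rule finite_measure_sphere_measure)

lemma measure_sphere_measure_S2: "measure sphere_measure S2 = 4 * pi"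
  by (simp add: measure_def emeasure_sphere_measure_S2)

lemma borel_measurable_sphere_measure:
  fixes f :: "real^3 \<Rightarrow> 'b::euclidean_space"
  assumes "continuous_on S2 f"
  shows "f \<in> borel_measurable sphere_measure"
  using borel_measurable_continuous_on_restrict[OF assms]
  by (simp cong: measurable_cong_sets add: sets_sphere_measure)

lemma integrable_sphere_measure:
  fixes f :: "real^3 \<Rightarrow> 'b::euclidean_space"
  assumes "continuous_on S2 f"
  shows "integrable sphere_measure f"
proof -
  have "compact (f ` S2)"
    by (intro compact_continuous_image assms) simp
  then obtain B where "\<And>x. x \<in> S2 \<Longrightarrow> norm (f x) \<le> B"
    by (metis bounded_iff compact_imp_bounded image_eqI)
  then show ?thesis
    by (intro sphere.integrable_const_bound[where B=B] AE_I2 borel_measurable_sphere_measure assms)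
      (auto simp: space_sphere_measure)
qed

lemma orthogonal_transformation_S2:
  assumes "orthogonal_transformation R" "x \<in> S2"
  shows "R x \<in> S2"
  using assms by (simp add: orthogonal_transformation)

lemma orthogonal_transformation_continuous:
  fixes R :: "real^'n \<Rightarrow> real^'n"
  shows "orthogonal_transformation R \<Longrightarrow> continuous_on S R"
  by (intro linear_continuous_on linear_conv_bounded_linear[THEN iffD1] orthogonal_transformation_linear)

lemma orthogonal_measurable_sphere:
  assumes "orthogonal_transformation R"
  shows "R \<in> measurable sphere_measure sphere_measure"
proof -
  have "R \<in> measurable (restrict_space borel S2) (restrict_space borel S2)"
  proof (rule measurable_restrict_space3)
    show "R \<in> borel_measurable borel"
      by (intro borel_measurable_continuous_onI orthogonal_transformation_continuous assms)
  qed (use assms orthogonal_transformation_S2 in auto)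
  then show ?thesis
    by (simp cong: measurable_cong_sets add: sets_sphere_measure)
qed

lemma emeasure_sphere_measure:
  assumes "A \<in> sets sphere_measure"
  shows "emeasure sphere_measure A = 3 * emeasure lborel {x \<in> ball 0 1 - {0}. x /\<^sub>R norm x \<in> A}"
proof -
  have A: "A \<in> sets (restrict_space borel S2)"
    using assms by (simp add: sets_sphere_measure)
  have "emeasure (distr (restrict_space lborel (ball 0 1 - {0})) (restrict_space borel S2)
          (\<lambda>x::real^3. x /\<^sub>R norm x)) A =
        emeasure (restrict_space lborel (ball (0::real^3) 1 - {0})) ((\<lambda>x. x /\<^sub>R norm x) -` A \<inter> (ball 0 1 - {0}))"
    using emeasure_distr[OF measurable_radial_projection A]
    by (simp add: space_restrict_space)
  also have "\<dots> = emeasure lborel ((\<lambda>x. x /\<^sub>R norm x) -` A \<inter> (ball 0 1 - {0}))"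
    by (rule emeasure_restrict_space) simp_all
  also have "(\<lambda>x. x /\<^sub>R norm x) -` A \<inter> (ball 0 1 - {0}) = {x \<in> ball 0 1 - {0}. x /\<^sub>R norm x \<in> A}"
    by blast
  finally show ?thesis
    by (simp add: sphere_measure_def)
qed

lemma sets_radial_cone:
  assumes "A \<in> sets sphere_measure"
  shows "{x \<in> ball 0 1 - {0}. x /\<^sub>R norm x \<in> A} \<in> sets lborel"
proof -
  have "(\<lambda>x. x /\<^sub>R norm x) -` A \<inter> space (restrict_space lborel (ball (0::real^3) 1 - {0}))
      \<in> sets (restrict_space lborel (ball 0 1 - {0}))"
    by (rule measurable_sets[OF measurable_radial_projection]) (use assms in \<open>simp add: sets_sphere_measure\<close>)
  moreover have "(\<lambda>x. x /\<^sub>R norm x) -` A \<inter> space (restrict_space lborel (ball (0::real^3) 1 - {0}))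
      = {x \<in> ball 0 1 - {0}. x /\<^sub>R norm x \<in> A}"
    by (auto simp: space_restrict_space)
  ultimately show ?thesis
    by (simp add: sets_restrict_space_iff)
qed

lemma distr_sphere_measure_orthogonal:
  assumes R: "orthogonal_transformation R"
  shows "distr sphere_measure sphere_measure R = sphere_measure"
proof (rule measure_eqI)
  fix A assume "A \<in> sets (distr sphere_measure sphere_measure R)"
  then have A: "A \<in> sets sphere_measure" by simp
  have R_meas: "R \<in> borel_measurable borel"
    by (intro borel_measurable_continuous_onI orthogonal_transformation_continuous R)
  have lin: "linear R" and nrm: "\<And>x. norm (R x) = norm x"
    using R by (auto simp: orthogonal_transformation)
  have R0: "R x = 0 \<longleftrightarrow> x = 0" for x
    by (metis nrm norm_eq_zero)
  have "A \<subseteq> S2"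
    using sets.sets_into_space[OF A] by (simp add: space_sphere_measure)
  let ?C = "\<lambda>A. {x \<in> ball 0 1 - {0}. x /\<^sub>R norm x \<in> A} :: (real^3) set"
  have RA: "R -` A \<inter> S2 \<in> sets sphere_measure"
    using measurable_sets[OF orthogonal_measurable_sphere[OF R] A] by (simp add: space_sphere_measure)
  have "emeasure (distr sphere_measure sphere_measure R) A = emeasure sphere_measure (R -` A \<inter> S2)"
    using orthogonal_measurable_sphere[OF R] A by (simp add: emeasure_distr space_sphere_measure)
  also have "\<dots> = 3 * emeasure lborel (?C (R -` A \<inter> S2))"
    by (rule emeasure_sphere_measure[OF RA])
  also have "?C (R -` A \<inter> S2) = R -` ?C A"
  proof (intro set_eqI iffI)
    fix x assume "x \<in> ?C (R -` A \<inter> S2)"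
    then show "x \<in> R -` ?C A"
      by (simp add: nrm R0 linear_scale[OF lin])
  next
    fix x assume "x \<in> R -` ?C A"
    then show "x \<in> ?C (R -` A \<inter> S2)"
      by (simp add: nrm R0 linear_scale[OF lin])
  qed
  also have "emeasure lborel (R -` ?C A) = emeasure (distr lborel borel R) (?C A)"
    using R_meas sets_radial_cone[OF A] by (subst emeasure_distr) simp_all
  also have "\<dots> = emeasure lborel (?C A)"
    by (simp add: distr_lborel_orthogonal[OF R])
  also have "3 * \<dots> = emeasure sphere_measure A"
    by (rule emeasure_sphere_measure[OF A, symmetric])
  finally show "emeasure (distr sphere_measure sphere_measure R) A = emeasure sphere_measure A" .
qed simp

lemma integral_sphere_orthogonal:
  fixes f :: "real^3 \<Rightarrow> real"
  assumes "orthogonal_transformation R" "f \<in> borel_measurable sphere_measure"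
  shows "(\<integral>x. f (R x) \<partial>sphere_measure) = (\<integral>x. f x \<partial>sphere_measure)"
  using integral_distr[OF orthogonal_measurable_sphere[OF assms(1)] assms(2)]
  by (simp add: distr_sphere_measure_orthogonal[OF assms(1)])

lemma continuous_null_on_S2:
  fixes f :: "real^3 \<Rightarrow> real"
  assumes f: "continuous_on S2 f" and null: "(\<integral>x. (f x)\<^sup>2 \<partial>sphere_measure) = 0" and x: "x \<in> S2"
  shows "f x = 0"
proof (rule ccontr)
  assume nz: "f x \<noteq> 0"
  have "AE y in sphere_measure. (f y)\<^sup>2 = 0"
    using null by (subst (asm) integral_nonneg_eq_0_iff_AE)
      (auto intro!: integrable_sphere_measure continuous_intros f)
  then have ae: "AE y in sphere_measure. f y = 0"
    by simp
  have N: "{y \<in> S2. f y \<noteq> 0} \<in> sets sphere_measure"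
  proof -
    have "{y \<in> S2. f y \<noteq> 0} = f -` (- {0}) \<inter> space sphere_measure"
      by (auto simp: space_sphere_measure)
    then show ?thesis
      using measurable_sets[OF borel_measurable_sphere_measure[OF f], of "- {0}"] by simp
  qed
  have "emeasure sphere_measure {y \<in> S2. f y \<noteq> 0} = 0"
    using ae N by (subst (asm) AE_iff_measurable[OF N]) (auto simp: space_sphere_measure)
  then have null0: "emeasure lborel {y \<in> ball 0 1 - {0}. y /\<^sub>R norm y \<in> {y \<in> S2. f y \<noteq> 0}} = 0"
    using emeasure_sphere_measure[OF N] by simp
  let ?U = "{y \<in> ball 0 1 - {0}. f (y /\<^sub>R norm y) \<noteq> 0}"
  have eq: "{y \<in> ball 0 1 - {0}. y /\<^sub>R norm y \<in> {y \<in> S2. f y \<noteq> 0}} = ?U"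
    by auto
  have cont: "continuous_on (ball 0 1 - {0}) (\<lambda>y. f (y /\<^sub>R norm y))"
    by (intro continuous_on_compose2[OF f] continuous_intros) (auto simp: field_simps split: if_splits)
  have op: "open (ball (0::real^3) 1 - {0})"
    by auto
  have "open ((\<lambda>y. f (y /\<^sub>R norm y)) -` (- {0}) \<inter> (ball 0 1 - {0}))"
    using iffD1[OF continuous_on_open_vimage[OF op] cont, rule_format, of "- {0}"] by (simp add: open_Compl)
  also have "(\<lambda>y. f (y /\<^sub>R norm y)) -` (- {0}) \<inter> (ball 0 1 - {0}) = ?U"
    by auto
  finally have "open ?U" .
  moreover have "(1/2) *\<^sub>R x \<in> ?U"
    using x nz by (auto simp: dist_norm)
  ultimately have "\<not> negligible ?U"
    using open_not_negligible[of ?U] by blast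
  moreover have "?U \<in> null_sets lborel"
    using null0 sets_radial_cone[OF N] unfolding eq by (simp add: null_sets_def)
  ultimately show False
    by (simp add: negligible_iff_null_sets null_sets_completionI)
qed

section \<open>Derivatives along rotations\<close>

definition rot :: "3 \<Rightarrow> real \<Rightarrow> real^3 \<Rightarrow> real^3"
  where "rot k t x = (x $ k) *\<^sub>R axis k 1 + cos t *\<^sub>R (x - (x $ k) *\<^sub>R axis k 1) + sin t *\<^sub>R cross3 (axis k 1) x"

definition rot_deriv :: "3 \<Rightarrow> (real^3 \<Rightarrow> real) \<Rightarrow> real^3 \<Rightarrow> real"
  where "rot_deriv k f x = deriv (\<lambda>t. f (rot k t x)) 0"

definition C1_sphere :: "(real^3 \<Rightarrow> real) \<Rightarrow> bool"
  where "C1_sphere f \<longleftrightarrow> continuous_on S2 f \<and>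
    (\<forall>k. continuous_on S2 (rot_deriv k f) \<and>
      (\<forall>x\<in>S2. (\<lambda>t. f (rot k t x)) field_differentiable (at 0)))"

lemma rot_0 [simp]: "rot k 0 x = x"
  by (simp add: rot_def)

lemma rot_add: "rot k (s + t) x = rot k s (rot k t x)"
  using exhaust_3[of k]
  by (auto simp: rot_def vec_eq_iff forall_3 cross3_def axis_def cos_add sin_add algebra_simps)

lemma linear_rot: "linear (rot k t)"
  unfolding rot_def
  by (rule linearI) (simp_all add: cross_add_right cross_mult_right algebra_simps)

lemma orthogonal_rot: "orthogonal_transformation (rot k t)"
proof -
  have cs: "sin t * sin t = 1 - cos t * cos t"
    using sin_cos_squared_add[of t] by (simp add: power2_eq_square)
  have "rot k t x \<bullet> rot k t x = x \<bullet> x" for x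
  proof -
    have *: "(c * a - s * b) * (c * a - s * b) + (c * b + s * a) * (c * b + s * a) = (c * c + s * s) * (a * a + b * b)" for a b c s :: real
      by algebra
    show ?thesis
      using exhaust_3[of k] *[of "cos t" "x$2" "sin t" "x$3"] *[of "cos t" "x$3" "sin t" "x$1"] *[of "cos t" "x$1" "sin t" "x$2"]
      by (auto simp: rot_def inner_vec_def sum_3 cross3_def axis_def cs)
  qed
  then show ?thesis
    by (simp add: orthogonal_transformation linear_rot norm_eq)
qed

lemma rot_S2: "x \<in> S2 \<Longrightarrow> rot k t x \<in> S2"
  by (rule orthogonal_transformation_S2[OF orthogonal_rot])

lemma has_derivative_rot: "((\<lambda>t. rot k t x) has_derivative (\<lambda>t. t *\<^sub>R cross3 (axis k 1) x)) (at 0)"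
  unfolding rot_def by (auto intro!: derivative_eq_intros)

lemma rot_deriv_cong:
  assumes "\<And>y. y \<in> S2 \<Longrightarrow> f y = g y" "x \<in> S2"
  shows "rot_deriv k f x = rot_deriv k g x"
  unfolding rot_deriv_def using assms rot_S2 by presburger

lemma C1_sphere_cong:
  assumes "C1_sphere f" "\<And>y. y \<in> S2 \<Longrightarrow> f y = g y"
  shows "C1_sphere g"
proof -
  have "(\<lambda>t. f (rot k t x)) = (\<lambda>t. g (rot k t x))" if "x \<in> S2" for x k
    using assms(2) rot_S2 that by presburger
  moreover have "continuous_on S2 g" if "continuous_on S2 f"
    by (rule continuous_on_eq[OF that assms(2)])
  moreover have "continuous_on S2 (rot_deriv k g)" if "continuous_on S2 (rot_deriv k f)" for k
    by (rule continuous_on_eq[OF that rot_deriv_cong[OF assms(2)]])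
  ultimately show ?thesis
    using assms(1) by (simp add: C1_sphere_def)
qed

lemma C1_sphereD:
  assumes "C1_sphere f"
  shows "continuous_on S2 f" "continuous_on S2 (rot_deriv k f)"
    "x \<in> S2 \<Longrightarrow> ((\<lambda>t. f (rot k t x)) has_real_derivative rot_deriv k f x) (at 0)"
  using assms by (auto simp: C1_sphere_def rot_deriv_def field_differentiable_derivI)

lemma C1_sphereI:
  assumes "continuous_on S2 f" "\<And>k. continuous_on S2 (h k)"
    "\<And>k x. x \<in> S2 \<Longrightarrow> ((\<lambda>t. f (rot k t x)) has_real_derivative h k x) (at 0)"
  shows "C1_sphere f" "x \<in> S2 \<Longrightarrow> rot_deriv k f x = h k x"
proof -
  have eq: "rot_deriv k f x = h k x" if "x \<in> S2" for k x
    unfolding rot_deriv_def using assms(3)[OF that] by (rule DERIV_imp_deriv)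
  then show "x \<in> S2 \<Longrightarrow> rot_deriv k f x = h k x" .
  have "continuous_on S2 (rot_deriv k f)" for k
    by (rule continuous_on_eq[OF assms(2)]) (use eq in auto)
  then show "C1_sphere f"
    using assms(1,3) unfolding C1_sphere_def field_differentiable_def by blast
qed

lemma has_derivative_along_rot:
  assumes "C1_sphere f" "x \<in> S2"
  shows "((\<lambda>s. f (rot k s x)) has_real_derivative rot_deriv k f (rot k t x)) (at t)"
proof -
  have "((\<lambda>s. f (rot k s (rot k t x))) has_real_derivative rot_deriv k f (rot k t x)) (at (t - t))"
    using C1_sphereD(3)[OF assms(1) rot_S2[OF assms(2)]] by simp
  then have "((\<lambda>s. f (rot k (s - t) (rot k t x))) has_real_derivative rot_deriv k f (rot k t x)) (at t)"
    using DERIV_shift[of "\<lambda>s. f (rot k s (rot k t x))" "rot_deriv k f (rot k t x)" t "- t"] by simp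
  then show ?thesis
    by (simp add: rot_add[symmetric])
qed

lemma C1_sphere_const: "C1_sphere (\<lambda>x. c)" and rot_deriv_const: "rot_deriv k (\<lambda>x. c) = (\<lambda>x. 0)"
proof -
  show 1: "rot_deriv k (\<lambda>x. c) = (\<lambda>x. 0)" for k
    by (rule ext) (simp add: rot_deriv_def)
  show "C1_sphere (\<lambda>x. c)"
    by (simp add: C1_sphere_def 1)
qed

lemma linear_cross3: "linear (\<lambda>x. cross3 a x)"
  by (rule linearI) (simp_all add: cross_add_right cross_mult_right)

lemma continuous_on_cross3: "continuous_on S (\<lambda>x. cross3 a x)"
  by (intro linear_continuous_on linear_conv_bounded_linear[THEN iffD1] linear_cross3)

lemma
  fixes h :: "real^3 \<Rightarrow> real"
  assumes "linear h"
  shows C1_sphere_linear: "C1_sphere h"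
    and rot_deriv_linear: "x \<in> S2 \<Longrightarrow> rot_deriv k h x = h (cross3 (axis k 1) x)"
proof -
  have bl: "bounded_linear h"
    using assms by (simp add: linear_conv_bounded_linear)
  have d: "((\<lambda>t. h (rot k t x)) has_real_derivative h (cross3 (axis k 1) x)) (at 0)" for x k
    using bounded_linear.has_derivative[OF bl has_derivative_rot, of k x]
    by (simp add: has_field_derivative_def linear_scale[OF assms] mult.commute[of _ "h _"])
  have c: "continuous_on S2 h" "continuous_on S2 (\<lambda>x. h (cross3 (axis k 1) x))" for k
    by (intro linear_continuous_on bl bounded_linear_compose[OF bl, of "cross3 (axis k 1)"]
        linear_conv_bounded_linear[THEN iffD1] linear_cross3)+
  show "C1_sphere h" "x \<in> S2 \<Longrightarrow> rot_deriv k h x = h (cross3 (axis k 1) x)"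
    by (rule C1_sphereI[OF c d]; assumption)+
qed

lemma C1_sphere_add:
  assumes "C1_sphere f" "C1_sphere g"
  shows "C1_sphere (\<lambda>x. f x + g x)"
    and "x \<in> S2 \<Longrightarrow> rot_deriv k (\<lambda>x. f x + g x) x = rot_deriv k f x + rot_deriv k g x"
proof -
  have *: "((\<lambda>t. f (rot k t x) + g (rot k t x)) has_real_derivative
      rot_deriv k f x + rot_deriv k g x) (at 0)" if "x \<in> S2" for k x
    by (intro DERIV_add C1_sphereD assms that)
  have c: "continuous_on S2 (\<lambda>x. f x + g x)"
    "continuous_on S2 (\<lambda>x. rot_deriv k f x + rot_deriv k g x)" for k
    by (intro continuous_intros C1_sphereD assms)+
  show "C1_sphere (\<lambda>x. f x + g x)"
    "x \<in> S2 \<Longrightarrow> rot_deriv k (\<lambda>x. f x + g x) x = rot_deriv k f x + rot_deriv k g x"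
    by (rule C1_sphereI[OF c *]; assumption)+
qed

lemma C1_sphere_mult:
  assumes "C1_sphere f" "C1_sphere g"
  shows "C1_sphere (\<lambda>x. f x * g x)"
    and "x \<in> S2 \<Longrightarrow> rot_deriv k (\<lambda>x. f x * g x) x = rot_deriv k f x * g x + f x * rot_deriv k g x"
proof -
  have *: "((\<lambda>t. f (rot k t x) * g (rot k t x)) has_real_derivative
      rot_deriv k f x * g x + f x * rot_deriv k g x) (at 0)" if "x \<in> S2" for k x
    using DERIV_mult[OF C1_sphereD(3)[OF assms(1) that, of k] C1_sphereD(3)[OF assms(2) that, of k]]
    by (simp add: algebra_simps)
  have c: "continuous_on S2 (\<lambda>x. f x * g x)"
    "continuous_on S2 (\<lambda>x. rot_deriv k f x * g x + f x * rot_deriv k g x)" for k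
    by (intro continuous_intros C1_sphereD assms)+
  show "C1_sphere (\<lambda>x. f x * g x)"
    "x \<in> S2 \<Longrightarrow> rot_deriv k (\<lambda>x. f x * g x) x = rot_deriv k f x * g x + f x * rot_deriv k g x"
    by (rule C1_sphereI[OF c *]; assumption)+
qed

lemma integral_rot_deriv:
  assumes "C1_sphere f"
  shows "(\<integral>x. rot_deriv k f x \<partial>sphere_measure) = 0"
proof -
  define d where "d n x = (f (rot k (inverse (real (Suc n))) x) - f x) * real (Suc n)" for n x
  have controt: "continuous_on S2 (\<lambda>x. f (rot k t x))" for t
    by (intro continuous_on_compose2[OF C1_sphereD(1)[OF assms]] orthogonal_transformation_continuous orthogonal_rot)
      (use rot_S2 in auto)
  have "compact (rot_deriv k f ` S2)"
    by (intro compact_continuous_image C1_sphereD assms) simp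
  then obtain B where B: "\<And>x. x \<in> S2 \<Longrightarrow> \<bar>rot_deriv k f x\<bar> \<le> B"
    by (metis bounded_iff compact_imp_bounded image_eqI real_norm_def)
  have "(\<lambda>n. \<integral>x. d n x \<partial>sphere_measure) \<longlonglongrightarrow> (\<integral>x. rot_deriv k f x \<partial>sphere_measure)"
  proof (rule integral_dominated_convergence[where w="\<lambda>_. B"])
    show "rot_deriv k f \<in> borel_measurable sphere_measure"
      by (intro borel_measurable_sphere_measure C1_sphereD assms)
    show "d n \<in> borel_measurable sphere_measure" for n
      unfolding d_def by (intro borel_measurable_sphere_measure continuous_intros controt C1_sphereD(1)[OF assms])
    show "AE x in sphere_measure. (\<lambda>n. d n x) \<longlonglongrightarrow> rot_deriv k f x"
    proof (rule AE_I2)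
      fix x assume "x \<in> space sphere_measure"
      then have x: "x \<in> S2" by (simp add: space_sphere_measure)
      have "((\<lambda>h. (f (rot k (0 + h) x) - f (rot k 0 x)) / h) \<longlongrightarrow> rot_deriv k f x) (at 0)"
        using C1_sphereD(3)[OF assms x, of k] unfolding DERIV_def .
      moreover have "filterlim (\<lambda>n. inverse (real (Suc n))) (at 0) sequentially"
        unfolding filterlim_at using LIMSEQ_inverse_real_of_nat by auto
      ultimately have "(\<lambda>n. (f (rot k (0 + inverse (real (Suc n))) x) - f (rot k 0 x)) / inverse (real (Suc n))) \<longlonglongrightarrow> rot_deriv k f x"
        by (rule filterlim_compose)
      then show "(\<lambda>n. d n x) \<longlonglongrightarrow> rot_deriv k f x"
        by (simp add: d_def divide_inverse)
    qed
    show "AE x in sphere_measure. norm (d n x) \<le> B" for n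
    proof (rule AE_I2)
      fix x assume "x \<in> space sphere_measure"
      then have x: "x \<in> S2" by (simp add: space_sphere_measure)
      obtain z where z: "f (rot k (inverse (real (Suc n))) x) - f (rot k 0 x)
          = (inverse (real (Suc n)) - 0) * rot_deriv k f (rot k z x)"
        using MVT2[of 0 "inverse (real (Suc n))" "\<lambda>s. f (rot k s x)" "\<lambda>s. rot_deriv k f (rot k s x)"]
          has_derivative_along_rot[OF assms x] by auto
      have "d n x = rot_deriv k f (rot k z x)"
        unfolding d_def using z by (simp add: field_simps)
      then show "norm (d n x) \<le> B"
        using B[OF rot_S2[OF x]] by simp
    qed
  qed simp
  moreover have "(\<integral>x. d n x \<partial>sphere_measure) = 0" for n
    unfolding d_def
    by (simp add: integral_sphere_orthogonal[OF orthogonal_rot] borel_measurable_sphere_measure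
        integrable_sphere_measure controt C1_sphereD(1)[OF assms])
  ultimately show ?thesis
    by (simp add: LIMSEQ_const_iff)
qed

definition ip :: "(real^3 \<Rightarrow> real) \<Rightarrow> (real^3 \<Rightarrow> real) \<Rightarrow> real"
  where "ip f g = (\<integral>x. f x * g x \<partial>sphere_measure)"

lemma ip_rot_deriv:
  assumes "C1_sphere f" "C1_sphere g"
  shows "ip (rot_deriv k f) g = - ip f (rot_deriv k g)"
proof -
  have "0 = (\<integral>x. rot_deriv k (\<lambda>x. f x * g x) x \<partial>sphere_measure)"
    by (rule integral_rot_deriv[symmetric, OF C1_sphere_mult(1)[OF assms]])
  also have "\<dots> = (\<integral>x. rot_deriv k f x * g x + f x * rot_deriv k g x \<partial>sphere_measure)"
    by (rule Bochner_Integration.integral_cong) (simp_all add: space_sphere_measure C1_sphere_mult(2)[OF assms])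
  also have "\<dots> = ip (rot_deriv k f) g + ip f (rot_deriv k g)"
    unfolding ip_def
    by (intro Bochner_Integration.integral_add integrable_sphere_measure continuous_intros C1_sphereD assms)
  finally show ?thesis by simp
qed

lemma rot_deriv_surface_gradient:
  assumes "has_surface_gradient f v x" "x \<in> S2"
  shows "((\<lambda>t. f (rot k t x)) has_real_derivative v \<bullet> cross3 (axis k 1) x) (at 0)"
proof -
  have "(f has_derivative (\<lambda>h. v \<bullet> h)) (at (rot k 0 x) within S2)"
    using assms(1) by (simp add: has_surface_gradient_def)
  then have "(f has_derivative (\<lambda>h. v \<bullet> h)) (at (rot k 0 x) within range (\<lambda>t. rot k t x))"
    by (rule has_derivative_subset) (use assms(2) rot_S2 in blast)
  from has_derivative_in_compose[OF has_derivative_rot this]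
  show ?thesis
    by (simp add: has_field_derivative_def mult.commute[of _ "v \<bullet> _"])
qed

lemma smooth_on_S2_C1_sphere:
  assumes "smooth_on_S2 f" "\<And>x. x \<in> S2 \<Longrightarrow> has_surface_gradient f (g x) x"
  shows "C1_sphere f" "x \<in> S2 \<Longrightarrow> rot_deriv k f x = g x \<bullet> cross3 (axis k 1) x"
proof -
  from assms(1) obtain U F where U: "open U" "S2 \<subseteq> U" "\<forall>k. Ck_on k U F" and fF: "\<forall>y\<in>S2. f y = F y"
    unfolding smooth_on_S2_def by blast
  have "Ck_on 0 U F" and "Ck_on (Suc 0) U F"
    using U(3) by blast+
  then have cF: "continuous_on U F" and "\<exists>G. (\<forall>x\<in>U. GDERIV F x :> G x) \<and> (\<forall>i. continuous_on U (\<lambda>x. G x $ i))"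
    by simp_all
  then obtain G where G: "\<And>x. x \<in> U \<Longrightarrow> GDERIV F x :> G x" "\<And>i. continuous_on U (\<lambda>x. G x $ i)"
    by blast
  have cf: "continuous_on S2 f"
    by (rule continuous_on_eq[OF continuous_on_subset[OF cF U(2)]]) (use fF in simp)
  have cG: "continuous_on S2 (\<lambda>x. G x $ i)" for i
    by (rule continuous_on_subset[OF G(2) U(2)])
  have eq: "g x \<bullet> cross3 (axis k 1) x = G x \<bullet> cross3 (axis k 1) x" if x: "x \<in> S2" for x k
  proof -
    have "(F has_derivative (\<lambda>h. h \<bullet> G x)) (at (rot k 0 x))"
      using G(1) U(2) x by (auto simp: gderiv_def)
    from has_derivative_compose[OF has_derivative_rot this]
    have "((\<lambda>t. F (rot k t x)) has_real_derivative G x \<bullet> cross3 (axis k 1) x) (at 0)"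
      by (simp add: has_field_derivative_def inner_commute mult.commute[of _ "G x \<bullet> _"])
    moreover have "(\<lambda>t. F (rot k t x)) = (\<lambda>t. f (rot k t x))"
      using fF rot_S2[OF x] by simp
    ultimately show ?thesis
      using DERIV_unique[OF rot_deriv_surface_gradient[OF assms(2)[OF x] x]] by simp
  qed
  have "continuous_on S2 (\<lambda>x. G x \<bullet> cross3 (axis k 1) x)" for k
    unfolding inner_vec_def by (intro continuous_intros cG continuous_on_cross3)
  then have c: "continuous_on S2 (\<lambda>x. g x \<bullet> cross3 (axis k 1) x)" for k
    by (rule continuous_on_eq) (use eq in simp)
  show "C1_sphere f" "x \<in> S2 \<Longrightarrow> rot_deriv k f x = g x \<bullet> cross3 (axis k 1) x"
    by (rule C1_sphereI[OF cf c rot_deriv_surface_gradient[OF assms(2)]]; assumption)+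
qed

section \<open>Polynomials on the sphere\<close>

lemma ip_cong:
  assumes "\<And>x. x \<in> S2 \<Longrightarrow> f x = f' x" "\<And>x. x \<in> S2 \<Longrightarrow> g x = g' x"
  shows "ip f g = ip f' g'"
  unfolding ip_def
  by (rule Bochner_Integration.integral_cong) (use assms in \<open>auto simp: space_sphere_measure\<close>)

lemma ip_commute: "ip f g = ip g f"
  by (simp add: ip_def mult.commute)

lemma ip_add_left:
  assumes "continuous_on S2 f" "continuous_on S2 g" "continuous_on S2 h"
  shows "ip (\<lambda>x. f x + g x) h = ip f h + ip g h"
  unfolding ip_def distrib_right
  by (intro Bochner_Integration.integral_add integrable_sphere_measure continuous_intros assms)

lemma ip_diff_left:
  assumes "continuous_on S2 f" "continuous_on S2 g" "continuous_on S2 h"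
  shows "ip (\<lambda>x. f x - g x) h = ip f h - ip g h"
  unfolding ip_def left_diff_distrib
  by (intro Bochner_Integration.integral_diff integrable_sphere_measure continuous_intros assms)

lemma ip_scale_left: "ip (\<lambda>x. c * f x) g = c * ip f g"
  by (simp add: ip_def mult.assoc)

lemma ip_sum_left:
  assumes "\<And>i. i \<in> I \<Longrightarrow> continuous_on S2 (f i)" "continuous_on S2 g"
  shows "ip (\<lambda>x. \<Sum>i\<in>I. f i x) g = (\<Sum>i\<in>I. ip (f i) g)"
  unfolding ip_def sum_distrib_right
  by (intro Bochner_Integration.integral_sum integrable_sphere_measure continuous_intros assms)

lemma ip_nonneg: "0 \<le> ip f f"
  by (simp add: ip_def)

lemma ip_self_eq_0:
  assumes "continuous_on S2 f" "ip f f = 0" "x \<in> S2"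
  shows "f x = 0"
  by (rule continuous_null_on_S2[OF assms(1) _ assms(3)]) (use assms(2) in \<open>simp add: ip_def power2_eq_square\<close>)

lemma ip_eq_0_left:
  assumes "continuous_on S2 f" "ip f f = 0"
  shows "ip f g = 0"
proof -
  have "ip f g = ip (\<lambda>x. 0) g"
    by (rule ip_cong) (use ip_self_eq_0[OF assms] in auto)
  then show ?thesis by (simp add: ip_def)
qed

text \<open>\<open>spoly n\<close>: equal on the sphere to a polynomial of degree less than \<open>n\<close>.\<close>

inductive spoly :: "nat \<Rightarrow> (real^3 \<Rightarrow> real) \<Rightarrow> bool"
  where
    zero: "spoly n (\<lambda>x. 0)"
  | const: "spoly (Suc n) (\<lambda>x. c)"
  | coord: "spoly n f \<Longrightarrow> spoly (Suc n) (\<lambda>x. x $ i * f x)"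
  | add: "spoly n f \<Longrightarrow> spoly n g \<Longrightarrow> spoly n (\<lambda>x. f x + g x)"
  | cong: "spoly n f \<Longrightarrow> (\<And>x. x \<in> S2 \<Longrightarrow> f x = g x) \<Longrightarrow> spoly n g"

lemma linear_nth: "linear (\<lambda>x::real^3. x $ i)"
  by (rule linearI) simp_all

lemma spoly_0: "spoly n f \<Longrightarrow> n = 0 \<Longrightarrow> x \<in> S2 \<Longrightarrow> f x = 0"
  by (induction rule: spoly.induct) auto

lemma spoly_C1: "spoly n f \<Longrightarrow> C1_sphere f"
proof (induction rule: spoly.induct)
  case (cong n f g)
  then show ?case using C1_sphere_cong by blast
next
  case (coord n f i)
  show ?case
    by (rule C1_sphere_mult(1)[OF C1_sphere_linear[OF linear_nth] coord.IH])
qed (auto intro: C1_sphere_const C1_sphere_add)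

lemma spoly_continuous: "spoly n f \<Longrightarrow> continuous_on S2 f"
  using spoly_C1 C1_sphereD(1) by blast

lemma spoly_Suc: "spoly n f \<Longrightarrow> spoly (Suc n) f"
  by (induction rule: spoly.induct) (blast intro: spoly.intros)+

lemma spoly_mono: "spoly n f \<Longrightarrow> n \<le> m \<Longrightarrow> spoly m f"
  by (induction m) (auto intro: spoly_Suc simp: le_Suc_eq)

lemma spoly_scale: "spoly n f \<Longrightarrow> spoly n (\<lambda>x. c * f x)"
proof (induction rule: spoly.induct)
  case (coord n f i)
  then have "spoly (Suc n) (\<lambda>x. x $ i * (c * f x))"
    by (intro spoly.coord)
  then show ?case
    by (simp add: mult.left_commute)
next
  case (cong n f g)
  then show ?case
    by (auto intro: spoly.cong[of n "\<lambda>x. c * f x"])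
qed (auto simp: distrib_left intro: spoly.intros)

lemma spoly_sum: "(\<And>i. i \<in> I \<Longrightarrow> spoly n (f i)) \<Longrightarrow> spoly n (\<lambda>x. \<Sum>i\<in>I. f i x)"
  by (induction I rule: infinite_finite_induct) (auto intro: spoly.intros)

lemma linear_eq_sum_nth:
  assumes "linear (h :: real^3 \<Rightarrow> real)"
  shows "h x = (\<Sum>j\<in>UNIV. h (axis j 1) * x $ j)"
proof -
  have "h x = h (\<Sum>j\<in>UNIV. x $ j *\<^sub>R axis j 1)"
    using basis_expansion[of x] by (simp add: scalar_mult_eq_scaleR)
  then show ?thesis
    by (simp add: linear_sum[OF assms] linear_scale[OF assms] mult.commute)
qed

lemma spoly_linear:
  assumes "linear (h :: real^3 \<Rightarrow> real)" "spoly n f"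
  shows "spoly (Suc n) (\<lambda>x. h x * f x)"
proof -
  have "spoly (Suc n) (\<lambda>x. \<Sum>j\<in>UNIV. h (axis j 1) * (x $ j * f x))"
    by (intro spoly_sum spoly_scale spoly.coord assms)
  then show ?thesis
    by (subst linear_eq_sum_nth[OF assms(1)]) (simp add: sum_distrib_right mult.assoc)
qed

lemma spoly_compose_orthogonal:
  assumes "orthogonal_transformation R" "spoly n f"
  shows "spoly n (\<lambda>x. f (R x))"
  using assms(2)
proof (induction rule: spoly.induct)
  case (coord n f i)
  have "linear (\<lambda>x. R x $ i)"
    using linear_compose[OF orthogonal_transformation_linear[OF assms(1)] linear_nth] by (simp add: o_def)
  then show ?case
    by (rule spoly_linear[OF _ coord.IH])
next
  case (cong n f g)
  then show ?case
    using orthogonal_transformation_S2[OF assms(1)] by (auto intro: spoly.cong[of n "\<lambda>x. f (R x)"])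
qed (auto intro: spoly.intros)

lemma spoly_mult:
  assumes "spoly (Suc m) f" "spoly n g"
  shows "spoly (m + n) (\<lambda>x. f x * g x)"
  using assms(1)
proof (induction "Suc m" f arbitrary: m rule: spoly.induct)
  case (zero m)
  then show ?case by (simp add: spoly.zero)
next
  case (const m c)
  then show ?case
    by (auto intro: spoly_mono[OF spoly_scale[OF assms(2)]])
next
  case (coord m f i)
  show ?case
  proof (cases m)
    case 0
    then show ?thesis
      using spoly_0[OF coord(1)] by (auto intro: spoly.cong[OF spoly.zero])
  next
    case (Suc k)
    then show ?thesis
      using spoly.coord[OF coord(2)[OF Suc], of i] by (simp add: mult.assoc)
  qed
next
  case (add f g')
  then show ?case
    by (simp add: distrib_right spoly.add)
next
  case (cong f g')
  then show ?case
    by (auto intro: spoly.cong[of _ "\<lambda>x. f x * g x"])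
qed

lemma linear_cross3_nth: "linear (\<lambda>x. cross3 a x $ i)"
  using linear_compose[OF linear_cross3 linear_nth] by (simp add: o_def)

lemma rot_deriv_coord_mult:
  assumes "C1_sphere f" "x \<in> S2"
  shows "rot_deriv k (\<lambda>x. x $ i * f x) x = cross3 (axis k 1) x $ i * f x + x $ i * rot_deriv k f x"
  using C1_sphere_mult(2)[OF C1_sphere_linear[OF linear_nth] assms] rot_deriv_linear[OF linear_nth assms(2)]
  by simp

lemma spoly_rot_deriv: "spoly n f \<Longrightarrow> spoly n (rot_deriv k f)"
proof (induction rule: spoly.induct)
  case (coord n f i)
  have "spoly (Suc n) (\<lambda>x. cross3 (axis k 1) x $ i * f x + x $ i * rot_deriv k f x)"
    by (intro spoly.add spoly.coord coord.IH spoly_linear linear_cross3_nth coord.hyps)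
  then show ?case
    by (rule spoly.cong) (simp add: rot_deriv_coord_mult[OF spoly_C1[OF coord.hyps]])
next
  case (add n f g)
  have "spoly n (\<lambda>x. rot_deriv k f x + rot_deriv k g x)"
    by (intro spoly.add add.IH)
  then show ?case
    by (rule spoly.cong) (simp add: C1_sphere_add(2)[OF spoly_C1[OF add.hyps(1)] spoly_C1[OF add.hyps(2)]])
next
  case (cong n f g)
  show ?case
    by (rule spoly.cong[OF cong.IH]) (rule rot_deriv_cong[OF cong.hyps(2)])
qed (simp_all add: rot_deriv_const spoly.zero)

definition sphere_laplacian :: "(real^3 \<Rightarrow> real) \<Rightarrow> real^3 \<Rightarrow> real"
  where "sphere_laplacian f x = (\<Sum>k\<in>UNIV. rot_deriv k (rot_deriv k f) x)"

lemma sum_cross3_axis_nth: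
  assumes "x \<in> S2"
  shows "(\<Sum>k\<in>UNIV. cross3 (axis k 1) x $ i * cross3 (axis k 1) x $ j) = (if i = j then 1 else 0) - x $ i * x $ j"
proof -
  have "x$1 * x$1 + x$2 * x$2 + x$3 * x$3 = 1"
    using assms by (simp add: norm_eq_1 inner_vec_def sum_3)
  then show ?thesis
    using exhaust_3[of i] exhaust_3[of j]
    by (auto simp: sum_3 cross3_def axis_def algebra_simps)
qed

lemma sum_cross3_cross3_axis: "(\<Sum>k\<in>UNIV. cross3 (axis k 1) (cross3 (axis k 1) x) $ i) = - 2 * x $ i"
  using exhaust_3[of i] by (auto simp: sum_3 cross3_def axis_def)

text \<open>Euler's relation for homogeneous polynomials: on the sphere the left-hand side is
  \<open>\<partial>\<^sub>i f - x\<^sub>i (x \<bullet> \<nabla>f)\<close>.\<close>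

lemma spoly_sum_cross3_rot_deriv:
  "spoly n f \<Longrightarrow> \<exists>h. spoly n h \<and> (\<forall>x\<in>S2. (\<Sum>k\<in>UNIV. cross3 (axis k 1) x $ i * rot_deriv k f x)
     = - (real n - 1) * (x $ i * f x) + h x)"
proof (induction rule: spoly.induct)
  case (zero n)
  show ?case
    by (rule exI[of _ "\<lambda>x. 0"]) (simp add: rot_deriv_const spoly.zero)
next
  case (const n c)
  have "spoly (Suc n) (\<lambda>x. real n * (x $ i * c))"
  proof (cases n)
    case (Suc m)
    have "spoly (Suc n) (\<lambda>x. x $ i * c)"
      unfolding Suc by (intro spoly.coord spoly.const)
    then show ?thesis
      by (rule spoly_scale)
  qed (simp add: spoly.zero)
  then show ?case
    by (intro exI[of _ "\<lambda>x. real n * (x $ i * c)"]) (simp add: rot_deriv_const)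
next
  case (coord n f j)
  then obtain h where h: "spoly n h"
    "\<And>x. x \<in> S2 \<Longrightarrow> (\<Sum>k\<in>UNIV. cross3 (axis k 1) x $ i * rot_deriv k f x) = - (real n - 1) * (x $ i * f x) + h x"
    by blast
  have "spoly (Suc n) (\<lambda>x. (if i = j then 1 else 0) * f x + x $ j * h x)"
    by (intro spoly.add spoly_scale spoly.coord h spoly_Suc coord.hyps)
  moreover have "(\<Sum>k\<in>UNIV. cross3 (axis k 1) x $ i * rot_deriv k (\<lambda>x. x $ j * f x) x)
     = - (real (Suc n) - 1) * (x $ i * (x $ j * f x)) + ((if i = j then 1 else 0) * f x + x $ j * h x)"
    if x: "x \<in> S2" for x
  proof -
    have "(\<Sum>k\<in>UNIV. cross3 (axis k 1) x $ i * rot_deriv k (\<lambda>x. x $ j * f x) x)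
      = (\<Sum>k\<in>UNIV. cross3 (axis k 1) x $ i * cross3 (axis k 1) x $ j) * f x
        + x $ j * (\<Sum>k\<in>UNIV. cross3 (axis k 1) x $ i * rot_deriv k f x)"
      by (simp only: rot_deriv_coord_mult[OF spoly_C1[OF coord.hyps] x])
        (simp add: sum_distrib_left sum_distrib_right sum.distrib algebra_simps)
    also have "\<dots> = ((if i = j then 1 else 0) - x $ i * x $ j) * f x + x $ j * (- (real n - 1) * (x $ i * f x) + h x)"
      by (simp only: sum_cross3_axis_nth[OF x] h(2)[OF x])
    finally show ?thesis
      by (simp add: algebra_simps)
  qed
  ultimately show ?case by blast
next
  case (add n f g)
  then obtain h h' where h: "spoly n h" "spoly n h'"
    "\<And>x. x \<in> S2 \<Longrightarrow> (\<Sum>k\<in>UNIV. cross3 (axis k 1) x $ i * rot_deriv k f x) = - (real n - 1) * (x $ i * f x) + h x"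
    "\<And>x. x \<in> S2 \<Longrightarrow> (\<Sum>k\<in>UNIV. cross3 (axis k 1) x $ i * rot_deriv k g x) = - (real n - 1) * (x $ i * g x) + h' x"
    by blast
  have "(\<Sum>k\<in>UNIV. cross3 (axis k 1) x $ i * rot_deriv k (\<lambda>x. f x + g x) x)
     = - (real n - 1) * (x $ i * (f x + g x)) + (h x + h' x)" if x: "x \<in> S2" for x
  proof -
    have "(\<Sum>k\<in>UNIV. cross3 (axis k 1) x $ i * rot_deriv k (\<lambda>x. f x + g x) x) =
      (\<Sum>k\<in>UNIV. cross3 (axis k 1) x $ i * rot_deriv k f x) + (\<Sum>k\<in>UNIV. cross3 (axis k 1) x $ i * rot_deriv k g x)"
      by (simp add: C1_sphere_add(2)[OF spoly_C1[OF add.hyps(1)] spoly_C1[OF add.hyps(2)] x] distrib_left sum.distrib)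
    also have "\<dots> = - (real n - 1) * (x $ i * f x) + h x + (- (real n - 1) * (x $ i * g x) + h' x)"
      by (simp only: h(3,4)[OF x])
    finally show ?thesis
      by (simp add: algebra_simps)
  qed
  then show ?case
    using spoly.add[OF h(1,2)] by blast
next
  case (cong n f g)
  then show ?case
    using rot_deriv_cong[of f g] by auto
qed

lemma spoly_laplacian:
  "spoly n f \<Longrightarrow> \<exists>h. spoly (n - 1) h \<and>
     (\<forall>x\<in>S2. sphere_laplacian f x = - ((real n - 1) * real n) * f x + h x)"
proof (induction rule: spoly.induct)
  case (zero n)
  show ?case
    by (rule exI[of _ "\<lambda>x. 0"]) (simp add: sphere_laplacian_def rot_deriv_const spoly.zero)
next
  case (const n c)
  have "spoly n (\<lambda>x. real n * real (Suc n) * c)"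
    by (cases n) (auto intro: spoly.zero spoly.const)
  then show ?case
    by (intro exI[of _ "\<lambda>x. real n * real (Suc n) * c"]) (simp add: sphere_laplacian_def rot_deriv_const)
next
  case (coord n f i)
  then obtain h where h: "spoly (n - 1) h"
    "\<And>x. x \<in> S2 \<Longrightarrow> sphere_laplacian f x = - ((real n - 1) * real n) * f x + h x"
    by blast
  obtain h' where h': "spoly n h'"
    "\<And>x. x \<in> S2 \<Longrightarrow> (\<Sum>k\<in>UNIV. cross3 (axis k 1) x $ i * rot_deriv k f x) = - (real n - 1) * (x $ i * f x) + h' x"
    using spoly_sum_cross3_rot_deriv[OF coord.hyps] by blast
  have "spoly n (\<lambda>x. x $ i * h x)"
  proof (cases n)
    case 0
    then have "h x = 0" if "x \<in> S2" for x
      using spoly_0[OF h(1)] that by simp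
    then show ?thesis
      by (auto intro: spoly.cong[OF spoly.zero])
  next
    case (Suc m)
    then show ?thesis
      using spoly.coord[OF h(1)] by simp
  qed
  then have "spoly n (\<lambda>x. 2 * h' x + x $ i * h x)"
    by (intro spoly.add spoly_scale h')
  moreover have "sphere_laplacian (\<lambda>x. x $ i * f x) x =
      - ((real (Suc n) - 1) * real (Suc n)) * (x $ i * f x) + (2 * h' x + x $ i * h x)" if x: "x \<in> S2" for x
  proof -
    note f = spoly_C1[OF coord.hyps] spoly_C1[OF spoly_rot_deriv[OF coord.hyps]]
    have "rot_deriv k (rot_deriv k (\<lambda>x. x $ i * f x)) x =
        cross3 (axis k 1) (cross3 (axis k 1) x) $ i * f x + 2 * (cross3 (axis k 1) x $ i * rot_deriv k f x)
        + x $ i * rot_deriv k (rot_deriv k f) x" for k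
    proof -
      have "rot_deriv k (rot_deriv k (\<lambda>x. x $ i * f x)) x =
          rot_deriv k (\<lambda>x. cross3 (axis k 1) x $ i * f x + x $ i * rot_deriv k f x) x"
        by (rule rot_deriv_cong[OF rot_deriv_coord_mult[OF f(1)] x])
      also have "\<dots> = rot_deriv k (\<lambda>x. cross3 (axis k 1) x $ i * f x) x + rot_deriv k (\<lambda>x. x $ i * rot_deriv k f x) x"
        by (intro C1_sphere_add C1_sphere_mult C1_sphere_linear linear_nth linear_cross3_nth f x)
      also have "rot_deriv k (\<lambda>x. cross3 (axis k 1) x $ i * f x) x =
          cross3 (axis k 1) (cross3 (axis k 1) x) $ i * f x + cross3 (axis k 1) x $ i * rot_deriv k f x"
        by (simp add: C1_sphere_mult(2)[OF C1_sphere_linear[OF linear_cross3_nth] f(1) x]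
            rot_deriv_linear[OF linear_cross3_nth x])
      also have "rot_deriv k (\<lambda>x. x $ i * rot_deriv k f x) x =
          cross3 (axis k 1) x $ i * rot_deriv k f x + x $ i * rot_deriv k (rot_deriv k f) x"
        by (rule rot_deriv_coord_mult[OF f(2) x])
      finally show ?thesis by simp
    qed
    then have "sphere_laplacian (\<lambda>x. x $ i * f x) x =
        (\<Sum>k\<in>UNIV. cross3 (axis k 1) (cross3 (axis k 1) x) $ i) * f x
        + 2 * (\<Sum>k\<in>UNIV. cross3 (axis k 1) x $ i * rot_deriv k f x) + x $ i * sphere_laplacian f x"
      by (simp add: sphere_laplacian_def sum.distrib sum_distrib_left sum_distrib_right)
    then show ?thesis
      by (simp only: sum_cross3_cross3_axis h(2)[OF x] h'(2)[OF x]) (simp add: algebra_simps)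
  qed
  ultimately show ?case by auto
next
  case (add n f g)
  then obtain h h' where h: "spoly (n - 1) h" "spoly (n - 1) h'"
    "\<And>x. x \<in> S2 \<Longrightarrow> sphere_laplacian f x = - ((real n - 1) * real n) * f x + h x"
    "\<And>x. x \<in> S2 \<Longrightarrow> sphere_laplacian g x = - ((real n - 1) * real n) * g x + h' x"
    by blast
  note C = spoly_C1[OF add.hyps(1)] spoly_C1[OF add.hyps(2)]
    spoly_C1[OF spoly_rot_deriv[OF add.hyps(1)]] spoly_C1[OF spoly_rot_deriv[OF add.hyps(2)]]
  have "sphere_laplacian (\<lambda>x. f x + g x) x = - ((real n - 1) * real n) * (f x + g x) + (h x + h' x)"
    if x: "x \<in> S2" for x
  proof -
    have "rot_deriv k (rot_deriv k (\<lambda>x. f x + g x)) x = rot_deriv k (rot_deriv k f) x + rot_deriv k (rot_deriv k g) x" for k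
      using rot_deriv_cong[OF C1_sphere_add(2)[OF C(1,2)] x] C1_sphere_add(2)[OF C(3,4) x] by simp
    then have "sphere_laplacian (\<lambda>x. f x + g x) x = sphere_laplacian f x + sphere_laplacian g x"
      by (simp add: sphere_laplacian_def sum.distrib)
    then show ?thesis
      by (simp add: h(3,4)[OF x] algebra_simps)
  qed
  then show ?case
    using spoly.add[OF h(1,2)] by blast
next
  case (cong n f g)
  have "sphere_laplacian f x = sphere_laplacian g x" if "x \<in> S2" for x
    using rot_deriv_cong[OF rot_deriv_cong[OF cong.hyps(2)] that] by (simp add: sphere_laplacian_def)
  then show ?case
    using cong by auto
qed

lemma spoly_laplacian_mono: "spoly n f \<Longrightarrow> spoly n (sphere_laplacian f)"
  unfolding sphere_laplacian_def[abs_def] by (intro spoly_sum spoly_rot_deriv)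

lemma ip_laplacian:
  assumes "C1_sphere f" "spoly n g"
  shows "(\<Sum>k\<in>UNIV. ip (rot_deriv k f) (rot_deriv k g)) = - ip f (sphere_laplacian g)"
proof -
  have "ip f (sphere_laplacian g) = ip (sphere_laplacian g) f" by (rule ip_commute)
  also have "\<dots> = (\<Sum>k\<in>UNIV. ip (rot_deriv k (rot_deriv k g)) f)"
    unfolding sphere_laplacian_def[abs_def]
    by (intro ip_sum_left spoly_continuous[OF spoly_rot_deriv[OF spoly_rot_deriv[OF assms(2)]]]
        C1_sphereD(1)[OF assms(1)])
  also have "\<dots> = (\<Sum>k\<in>UNIV. - ip (rot_deriv k f) (rot_deriv k g))"
    using ip_rot_deriv[OF spoly_C1[OF spoly_rot_deriv[OF assms(2)]] assms(1)]
    by (intro sum.cong refl) (metis ip_commute)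
  finally show ?thesis
    by (simp add: sum_negf)
qed

section \<open>Gram--Schmidt orthogonalisation of monomials\<close>

fun gram_schmidt :: "(nat \<Rightarrow> real^3 \<Rightarrow> real) \<Rightarrow> nat \<Rightarrow> real^3 \<Rightarrow> real"
  where "gram_schmidt b n =
    (let r = (\<lambda>x. b n x - (\<Sum>j<n. ip (b n) (gram_schmidt b j) * gram_schmidt b j x))
     in (\<lambda>x. r x / sqrt (ip r r)))"

declare gram_schmidt.simps [simp del]

definition gs_residue :: "(nat \<Rightarrow> real^3 \<Rightarrow> real) \<Rightarrow> nat \<Rightarrow> real^3 \<Rightarrow> real"
  where "gs_residue b n x = b n x - (\<Sum>j<n. ip (b n) (gram_schmidt b j) * gram_schmidt b j x)"

lemma gram_schmidt_residue:
  "gram_schmidt b n x = (1 / sqrt (ip (gs_residue b n) (gs_residue b n))) * gs_residue b n x"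
  by (subst gram_schmidt.simps) (simp add: Let_def gs_residue_def[abs_def])

lemma continuous_on_gram_schmidt:
  assumes "\<And>n. continuous_on S2 (b n)"
  shows "continuous_on S2 (gram_schmidt b n)" "continuous_on S2 (gs_residue b n)"
proof -
  have *: "continuous_on S2 (gs_residue b n) \<and> continuous_on S2 (gram_schmidt b n)" for n
  proof (induction n rule: less_induct)
    case (less n)
    then have 1: "continuous_on S2 (gs_residue b n)"
      unfolding gs_residue_def[abs_def] by (auto intro!: continuous_intros assms)
    then show ?case
      unfolding gram_schmidt_residue[abs_def] by (intro conjI continuous_on_mult continuous_on_const)
  qed
  show "continuous_on S2 (gram_schmidt b n)" "continuous_on S2 (gs_residue b n)"
    using * by auto
qed

lemma ip_gram_schmidt_self:
  shows "ip (gram_schmidt b n) (gram_schmidt b n) \<in> {0, 1}"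
proof -
  let ?r = "gs_residue b n"
  define c where "c = 1 / sqrt (ip ?r ?r)"
  have "ip (gram_schmidt b n) (gram_schmidt b n) = ip (\<lambda>x. c * ?r x) (\<lambda>x. c * ?r x)"
    by (simp add: gram_schmidt_residue[abs_def] c_def)
  also have "\<dots> = c * (c * ip ?r ?r)"
    by (simp add: ip_scale_left ip_commute[of _ "\<lambda>x. c * ?r x"])
  also have "\<dots> \<in> {0, 1}"
    using ip_nonneg[of ?r] by (auto simp: c_def field_simps)
  finally show ?thesis .
qed

lemma ip_gram_schmidt:
  assumes cont: "\<And>n. continuous_on S2 (b n)" and "i \<noteq> j"
  shows "ip (gram_schmidt b i) (gram_schmidt b j) = 0"
proof -
  note c = continuous_on_gram_schmidt[of b, OF cont]
  have *: "\<forall>j<n. ip (gram_schmidt b n) (gram_schmidt b j) = 0" for n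
  proof (induction n rule: less_induct)
    case (less n)
    show ?case
    proof (intro allI impI)
      fix j assume j: "j < n"
      have "ip (gs_residue b n) (gram_schmidt b j) =
          ip (b n) (gram_schmidt b j) - (\<Sum>i<n. ip (b n) (gram_schmidt b i) * ip (gram_schmidt b i) (gram_schmidt b j))"
      proof -
        have "ip (\<lambda>x. \<Sum>i<n. ip (b n) (gram_schmidt b i) * gram_schmidt b i x) (gram_schmidt b j) =
            (\<Sum>i<n. ip (\<lambda>x. ip (b n) (gram_schmidt b i) * gram_schmidt b i x) (gram_schmidt b j))"
          by (intro ip_sum_left continuous_intros c)
        then show ?thesis
          unfolding gs_residue_def[abs_def]
          by (subst ip_diff_left) (auto intro!: continuous_intros cont c simp: ip_scale_left)
      qed
      also have "(\<Sum>i<n. ip (b n) (gram_schmidt b i) * ip (gram_schmidt b i) (gram_schmidt b j))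
          = (\<Sum>i<n. if i = j then ip (b n) (gram_schmidt b j) * ip (gram_schmidt b j) (gram_schmidt b j) else 0)"
      proof (rule sum.cong)
        fix i assume i: "i \<in> {..<n}"
        have "ip (gram_schmidt b i) (gram_schmidt b j) = 0" if "i \<noteq> j"
          using less[of i] less[of j] i j that ip_commute[of "gram_schmidt b i" "gram_schmidt b j"]
          by (cases "i < j") auto
        then show "ip (b n) (gram_schmidt b i) * ip (gram_schmidt b i) (gram_schmidt b j)
          = (if i = j then ip (b n) (gram_schmidt b j) * ip (gram_schmidt b j) (gram_schmidt b j) else 0)"
          by simp
      qed simp
      also have "\<dots> = ip (b n) (gram_schmidt b j) * ip (gram_schmidt b j) (gram_schmidt b j)"
        using j by simp
      also have "\<dots> = ip (b n) (gram_schmidt b j)"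
      proof (cases "ip (gram_schmidt b j) (gram_schmidt b j) = 0")
        case True
        then show ?thesis
          by (metis c(1) ip_commute ip_eq_0_left mult_zero_right)
      next
        case False
        then show ?thesis
          using ip_gram_schmidt_self[of b j] by simp
      qed
      finally have "ip (gs_residue b n) (gram_schmidt b j) = 0" by simp
      then show "ip (gram_schmidt b n) (gram_schmidt b j) = 0"
        unfolding gram_schmidt_residue[of b n, abs_def] ip_scale_left by simp
    qed
  qed
  show ?thesis
    using *[of i] *[of j] assms(2) ip_commute[of "gram_schmidt b i" "gram_schmidt b j"]
    by (cases "i < j") auto
qed

lemma gram_schmidt_span:
  assumes cont: "\<And>n. continuous_on S2 (b n)"
  shows "\<exists>c. \<forall>x\<in>S2. b n x = (\<Sum>j<Suc n. c j * gram_schmidt b j x)"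
proof -
  let ?r = "gs_residue b n"
  have r: "?r x = sqrt (ip ?r ?r) * gram_schmidt b n x" if "x \<in> S2" for x
    using ip_self_eq_0[OF continuous_on_gram_schmidt(2)[of b, OF cont] _ that, of n]
    by (cases "ip ?r ?r = 0") (auto simp: gram_schmidt_residue[of b n])
  have "b n x = (\<Sum>j<Suc n. (if j = n then sqrt (ip ?r ?r) else ip (b n) (gram_schmidt b j)) * gram_schmidt b j x)"
    if "x \<in> S2" for x
    using r[OF that] by (simp add: gs_residue_def)
  then show ?thesis
    by (intro exI ballI)
qed

lemma sum_span_trans:
  fixes b e :: "nat \<Rightarrow> 'a \<Rightarrow> real"
  assumes "\<And>n. n < N \<Longrightarrow> \<exists>c. \<forall>x\<in>X. b n x = (\<Sum>j<Suc n. c j * e j x)"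
  shows "\<exists>c. \<forall>x\<in>X. (\<Sum>n<N. a n * b n x) = (\<Sum>j<N. c j * e j x)"
proof -
  obtain c where c: "\<And>n x. n < N \<Longrightarrow> x \<in> X \<Longrightarrow> b n x = (\<Sum>j<Suc n. c n j * e j x)"
    using assms by metis
  have "(\<Sum>n<N. a n * b n x) = (\<Sum>j<N. (\<Sum>n<N. if j < Suc n then a n * c n j else 0) * e j x)" if "x \<in> X" for x
  proof -
    have "(\<Sum>n<N. a n * b n x) = (\<Sum>n<N. \<Sum>j<N. (if j < Suc n then a n * c n j else 0) * e j x)"
    proof (rule sum.cong)
      fix n assume n: "n \<in> {..<N}"
      have "a n * b n x = (\<Sum>j<Suc n. a n * c n j * e j x)"
        using c[of n x] n that by (simp add: sum_distrib_left mult.assoc distrib_left)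
      also have "\<dots> = (\<Sum>j<N. if j < Suc n then a n * c n j * e j x else 0)"
        using n by (intro sum.mono_neutral_cong_left) auto
      also have "\<dots> = (\<Sum>j<N. (if j < Suc n then a n * c n j else 0) * e j x)"
        by (intro sum.cong) auto
      finally show "a n * b n x = (\<Sum>j<N. (if j < Suc n then a n * c n j else 0) * e j x)" .
    qed simp
    also have "\<dots> = (\<Sum>j<N. \<Sum>n<N. (if j < Suc n then a n * c n j else 0) * e j x)"
      by (rule sum.swap)
    finally show ?thesis
      by (simp only: sum_distrib_right)
  qed
  then show ?thesis
    by (intro exI ballI)
qed

text \<open>The exponents of \<open>x\<^sub>3\<close> are at most 1, as \<open>x\<^sub>3\<^sup>2 = 1 - x\<^sub>1\<^sup>2 - x\<^sub>2\<^sup>2\<close>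
  on the sphere; this leaves \<open>2 l + 1\<close> monomials of degree \<open>l\<close>, with indices from \<open>l\<^sup>2\<close>
  to \<open>l\<^sup>2 + 2 l\<close>.\<close>

definition sphere_monomial :: "nat \<Rightarrow> real^3 \<Rightarrow> real"
  where "sphere_monomial j x =
    (let l = floor_sqrt j; i = j - l\<^sup>2
     in if i \<le> l then (x $ 1) ^ i * (x $ 2) ^ (l - i) else (x $ 1) ^ (i - l - 1) * (x $ 2) ^ (2 * l - i) * x $ 3)"

lemma floor_sqrt_add: "i \<le> 2 * l \<Longrightarrow> floor_sqrt (l\<^sup>2 + i) = l"
  by (rule floor_sqrt_unique) (auto simp: power2_eq_square)

lemma sphere_monomial_0: "sphere_monomial ((a + b)\<^sup>2 + a) x = (x $ 1) ^ a * (x $ 2) ^ b"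
  by (simp add: sphere_monomial_def floor_sqrt_add)

lemma sphere_monomial_1:
  "sphere_monomial ((a + b + 1)\<^sup>2 + (a + b + 1 + a + 1)) x = (x $ 1) ^ a * (x $ 2) ^ b * x $ 3"
proof -
  have "floor_sqrt ((a + b + 1)\<^sup>2 + (a + b + 1 + a + 1)) = a + b + 1"
    by (rule floor_sqrt_add) simp
  then show ?thesis
    by (simp add: sphere_monomial_def add.assoc)
qed

lemma spoly_monomial: "a + b < n \<Longrightarrow> spoly n (\<lambda>x. (x $ 1) ^ a * (x $ 2) ^ b)"
proof (induction a arbitrary: n)
  case 0
  then show ?case
  proof (induction b arbitrary: n)
    case 0
    then show ?case by (cases n) (auto intro: spoly.const)
  next
    case (Suc b)
    obtain m where m: "n = Suc m" "0 + b < m" using Suc.prems by (cases n) auto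
    from spoly.coord[OF Suc.IH[OF m(2)], of 2] show ?case
      by (simp add: m(1))
  qed
next
  case (Suc a)
  obtain m where m: "n = Suc m" "a + b < m" using Suc.prems by (cases n) auto
  from spoly.coord[OF Suc.IH[OF m(2)], of 1] show ?case
    by (simp add: m(1) mult.assoc)
qed

lemma spoly_sphere_monomial:
  assumes "j < n\<^sup>2"
  shows "spoly n (sphere_monomial j)"
proof -
  define l where "l = floor_sqrt j"
  have l: "l\<^sup>2 \<le> j" "j < (Suc l)\<^sup>2"
    unfolding l_def by (rule floor_sqrt_power2_le, rule Suc_floor_sqrt_power2_gt)
  then have "l < n"
    using assms power2_less_imp_less[of l n] by linarith
  define i where "i = j - l\<^sup>2"
  have i: "i \<le> 2 * l"
    using l by (simp add: i_def power2_eq_square)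
  show ?thesis
  proof (cases "i \<le> l")
    case True
    then have "spoly n (\<lambda>x. (x $ 1) ^ i * (x $ 2) ^ (l - i))"
      using \<open>l < n\<close> by (intro spoly_monomial) simp
    then show ?thesis
      by (rule spoly.cong) (use True in \<open>simp add: sphere_monomial_def Let_def i_def[symmetric] l_def[symmetric]\<close>)
  next
    case False
    obtain m where m: "n = Suc m" using \<open>l < n\<close> by (cases n) auto
    have "spoly m (\<lambda>x. (x $ 1) ^ (i - l - 1) * (x $ 2) ^ (2 * l - i))"
      using \<open>l < n\<close> False i m by (intro spoly_monomial) simp
    then have "spoly n (\<lambda>x. x $ 3 * ((x $ 1) ^ (i - l - 1) * (x $ 2) ^ (2 * l - i)))"
      unfolding m by (rule spoly.coord)
    then show ?thesis
      by (rule spoly.cong) (use False in \<open>simp add: sphere_monomial_def Let_def i_def[symmetric] l_def[symmetric]\<close>)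
  qed
qed

definition monomial_span :: "nat \<Rightarrow> (real^3 \<Rightarrow> real) \<Rightarrow> bool"
  where "monomial_span n f \<longleftrightarrow> (\<exists>c. \<forall>x\<in>S2. f x = (\<Sum>j<n\<^sup>2. c j * sphere_monomial j x))"

lemma monomial_span_cong:
  "monomial_span n f \<Longrightarrow> (\<And>x. x \<in> S2 \<Longrightarrow> f x = g x) \<Longrightarrow> monomial_span n g"
  by (simp add: monomial_span_def)

lemma monomial_span_add:
  assumes "monomial_span n f" "monomial_span n g"
  shows "monomial_span n (\<lambda>x. f x + g x)"
proof -
  obtain c d where "\<And>x. x \<in> S2 \<Longrightarrow> f x = (\<Sum>j<n\<^sup>2. c j * sphere_monomial j x)"
    "\<And>x. x \<in> S2 \<Longrightarrow> g x = (\<Sum>j<n\<^sup>2. d j * sphere_monomial j x)"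
    using assms unfolding monomial_span_def by blast
  then show ?thesis
    unfolding monomial_span_def
    by (intro exI[of _ "\<lambda>j. c j + d j"]) (simp add: distrib_right sum.distrib)
qed

lemma monomial_span_scale:
  assumes "monomial_span n f"
  shows "monomial_span n (\<lambda>x. a * f x)"
proof -
  obtain c where "\<And>x. x \<in> S2 \<Longrightarrow> f x = (\<Sum>j<n\<^sup>2. c j * sphere_monomial j x)"
    using assms unfolding monomial_span_def by blast
  then show ?thesis
    unfolding monomial_span_def
    by (intro exI[of _ "\<lambda>j. a * c j"]) (simp add: sum_distrib_left mult.assoc)
qed

lemma monomial_span_zero: "monomial_span n (\<lambda>x. 0)"
  unfolding monomial_span_def by (intro exI[of _ "\<lambda>_. 0"]) simp

lemma monomial_span_sum: "(\<And>i. i \<in> I \<Longrightarrow> monomial_span n (f i)) \<Longrightarrow> monomial_span n (\<lambda>x. \<Sum>i\<in>I. f i x)"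
  by (induction I rule: infinite_finite_induct) (auto intro: monomial_span_zero monomial_span_add)

lemma monomial_span_sphere_monomial: "j < n\<^sup>2 \<Longrightarrow> monomial_span n (sphere_monomial j)"
  unfolding monomial_span_def
  by (intro exI[of _ "\<lambda>i. if i = j then 1 else 0"]) (simp add: if_distrib[of "\<lambda>c. c * _"] cong: if_cong)

lemma square_index_less:
  fixes m n i :: nat
  assumes "m < n" "i \<le> 2 * m"
  shows "m\<^sup>2 + i < n\<^sup>2"
proof -
  have "m\<^sup>2 + i < (Suc m)\<^sup>2"
    using assms(2) by (simp add: power2_eq_square)
  also have "\<dots> \<le> n\<^sup>2"
    using assms(1) by (intro power_mono) auto
  finally show ?thesis .
qed

lemma monomial_span_0: "a + b < n \<Longrightarrow> monomial_span n (\<lambda>x. (x $ 1) ^ a * (x $ 2) ^ b)"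
  using monomial_span_sphere_monomial[OF square_index_less[of "a + b" n a]]
  by (simp add: sphere_monomial_0[abs_def])

lemma monomial_span_1:
  assumes "a + b + 1 < n"
  shows "monomial_span n (\<lambda>x. (x $ 1) ^ a * (x $ 2) ^ b * x $ 3)"
proof -
  have "(a + b + 1)\<^sup>2 + (a + b + 1 + a + 1) < n\<^sup>2"
    by (rule square_index_less[OF assms]) simp
  from monomial_span_sphere_monomial[OF this] show ?thesis
    unfolding sphere_monomial_1[abs_def] .
qed

lemma monomial_span_coord_monomial:
  fixes i :: 3
  assumes "j < n\<^sup>2"
  shows "monomial_span (Suc n) (\<lambda>x. x $ i * sphere_monomial j x)"
proof -
  define l where "l = floor_sqrt j"
  have l: "l\<^sup>2 \<le> j" "j < (Suc l)\<^sup>2"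
    unfolding l_def by (rule floor_sqrt_power2_le, rule Suc_floor_sqrt_power2_gt)
  then have ln: "l < n"
    using assms power2_less_imp_less[of l n] by linarith
  define m where "m = j - l\<^sup>2"
  have m: "m \<le> 2 * l"
    using l by (simp add: m_def power2_eq_square)
  show ?thesis
  proof (cases "m \<le> l")
    case True
    have eq: "sphere_monomial j = (\<lambda>x. (x $ 1) ^ m * (x $ 2) ^ (l - m))"
      using True by (simp add: fun_eq_iff sphere_monomial_def Let_def m_def[symmetric] l_def[symmetric])
    from exhaust_3[of i] show ?thesis
    proof (elim disjE)
      assume "i = 1"
      then show ?thesis
        using monomial_span_0[of "Suc m" "l - m" "Suc n"] True ln by (simp add: eq mult.assoc)
    next
      assume "i = 2"
      then show ?thesis
        using monomial_span_0[of m "Suc (l - m)" "Suc n"] True ln by (simp add: eq mult.left_commute)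
    next
      assume "i = 3"
      then show ?thesis
        using monomial_span_1[of m "l - m" "Suc n"] True ln by (simp add: eq mult.commute)
    qed
  next
    case False
    define a b where "a = m - l - 1" and "b = 2 * l - m"
    have ab: "a + b + 1 = l"
      using False m by (simp add: a_def b_def)
    have eq: "sphere_monomial j = (\<lambda>x. (x $ 1) ^ a * (x $ 2) ^ b * x $ 3)"
      using False by (simp add: fun_eq_iff sphere_monomial_def Let_def m_def[symmetric] l_def[symmetric] a_def b_def)
    from exhaust_3[of i] show ?thesis
    proof (elim disjE)
      assume "i = 1"
      then show ?thesis
        using monomial_span_1[of "Suc a" b "Suc n"] ab ln by (simp add: eq mult.assoc)
    next
      assume "i = 2"
      then show ?thesis
        using monomial_span_1[of a "Suc b" "Suc n"] ab ln by (simp add: eq mult.assoc mult.left_commute)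
    next
      assume i: "i = 3"
      have "monomial_span (Suc n) (\<lambda>x. (x $ 1) ^ a * (x $ 2) ^ b + (-1) * ((x $ 1) ^ (a + 2) * (x $ 2) ^ b)
          + (-1) * ((x $ 1) ^ a * (x $ 2) ^ (b + 2)))"
        using ab ln by (intro monomial_span_add monomial_span_scale monomial_span_0) auto
      then show ?thesis
      proof (rule monomial_span_cong)
        fix x :: "real^3" assume "x \<in> S2"
        then have "x$1 * x$1 + x$2 * x$2 + x$3 * x$3 = 1"
          by (simp add: norm_eq_1 inner_vec_def sum_3)
        then have 3: "x$3 * x$3 = 1 - (x$1)\<^sup>2 - (x$2)\<^sup>2"
          by (simp add: power2_eq_square)
        have "x $ i * sphere_monomial j x = ((x $ 1) ^ a * (x $ 2) ^ b) * (x$3 * x$3)"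
          by (simp add: i eq mult_ac)
        then show "(x $ 1) ^ a * (x $ 2) ^ b + (-1) * ((x $ 1) ^ (a + 2) * (x $ 2) ^ b)
          + (-1) * ((x $ 1) ^ a * (x $ 2) ^ (b + 2)) = x $ i * sphere_monomial j x"
          by (simp add: 3 power_add power2_eq_square algebra_simps)
      qed
    qed
  qed
qed

lemma spoly_monomial_span: "spoly n f \<Longrightarrow> monomial_span n f"
proof (induction rule: spoly.induct)
  case (const n c)
  show ?case
    using monomial_span_scale[OF monomial_span_0[of 0 0 "Suc n"], of c] by simp
next
  case (coord n f i)
  then obtain c where "\<And>x. x \<in> S2 \<Longrightarrow> f x = (\<Sum>j<n\<^sup>2. c j * sphere_monomial j x)"
    unfolding monomial_span_def by blast
  moreover have "monomial_span (Suc n) (\<lambda>x. \<Sum>j<n\<^sup>2. c j * (x $ i * sphere_monomial j x))"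
    by (intro monomial_span_sum monomial_span_scale monomial_span_coord_monomial) simp
  ultimately show ?case
    by (elim monomial_span_cong) (simp add: sum_distrib_left mult.left_commute)
qed (auto intro: monomial_span_zero monomial_span_add monomial_span_cong)

section \<open>The sum over the spectrum\<close>

lemma powr_midpoint_convex:
  fixes x y s :: real
  assumes "0 < x" "0 < y" "0 < s"
  shows "2 * ((x + y) / 2) powr (- s) \<le> x powr (- s) + y powr (- s)"
proof -
  have "convex_on {0<..} (\<lambda>x::real. x powr (- s))"
  proof (rule f''_ge0_imp_convex)
    show "((\<lambda>x. x powr (- s)) has_real_derivative (- s * x powr (- s - 1))) (at x)" if "x \<in> {0<..}" for x
      using that by (auto intro!: derivative_eq_intros)
    show "((\<lambda>x. - s * x powr (- s - 1)) has_real_derivative (- s * ((- s - 1) * x powr (- s - 1 - 1)))) (at x)"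
      if "x \<in> {0<..}" for x
      using that by (auto intro!: derivative_eq_intros)
    show "0 \<le> - s * ((- s - 1) * x powr (- s - 1 - 1))" if "x \<in> {0<..}" for x
      using assms(3) by (simp add: mult_nonneg_nonpos mult_nonpos_nonneg)
  qed simp
  from convex_onD[OF this, of "1/2" x y] assms show ?thesis
    by (simp add: field_simps)
qed

lemma powr_hermite_hadamard:
  fixes c h s :: real
  assumes "1 < s" "0 \<le> h" "h < c"
  shows "2 * h * c powr (- s) \<le> (c - h) powr (1 - s) / (s - 1) - (c + h) powr (1 - s) / (s - 1)"
proof -
  define F where "F u = (c - u) powr (1 - s) - (c + u) powr (1 - s) - (s - 1) * (2 * u * c powr (- s))" for u
  have "F 0 \<le> F h"
  proof (rule DERIV_nonneg_imp_nondecreasing[OF assms(2)])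
    fix u assume u: "0 \<le> u" "u \<le> h"
    have "(F has_real_derivative (s - 1) * ((c - u) powr (- s) + (c + u) powr (- s) - 2 * c powr (- s))) (at u)"
      unfolding F_def[abs_def] using u assms
      by (auto intro!: derivative_eq_intros simp: algebra_simps)
    moreover have "0 \<le> (s - 1) * ((c - u) powr (- s) + (c + u) powr (- s) - 2 * c powr (- s))"
      using powr_midpoint_convex[of "c - u" "c + u" s] u assms by simp
    ultimately show "\<exists>y. (F has_real_derivative y) (at u) \<and> 0 \<le> y"
      by blast
  qed
  then have "(s - 1) * (2 * h * c powr (- s)) \<le> (c - h) powr (1 - s) - (c + h) powr (1 - s)"
    by (simp add: F_def)
  then have "2 * h * c powr (- s) \<le> ((c - h) powr (1 - s) - (c + h) powr (1 - s)) / (s - 1)"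
    using assms(1) by (simp add: pos_le_divide_eq mult.commute)
  then show ?thesis
    by (simp add: diff_divide_distrib)
qed

text \<open>\<open>l (l + 1)\<close> is the midpoint of \<open>[l\<^sup>2 - 1/2, (l + 1)\<^sup>2 - 1/2]\<close>, which has length \<open>2 l + 1\<close>.\<close>

lemma sum_eigenvalue_powr:
  fixes a s :: real
  assumes "1 < s" "0 < a"
  shows "(\<Sum>l=1..n. (2 * real l + 1) * (a + real l * (real l + 1)) powr (- s)) \<le> a powr (1 - s) / (s - 1)"
proof -
  define H where "H l = (a + (real l)\<^sup>2 - 1/2) powr (1 - s) / (s - 1)" for l
  have "(\<Sum>l=1..n. (2 * real l + 1) * (a + real l * (real l + 1)) powr (- s)) \<le> (\<Sum>l=1..n. H l - H (Suc l))"
  proof (rule sum_mono)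
    fix l assume "l \<in> {1..n}"
    then have "1 \<le> real l" by auto
    then have "1 * 1 \<le> real l * real l" by (rule mult_mono) (use \<open>1 \<le> real l\<close> in auto)
    then have "real l + 1/2 < a + real l * (real l + 1)"
      using assms(2) \<open>1 \<le> real l\<close> by (simp add: distrib_left)
    from powr_hermite_hadamard[OF assms(1) _ this]
    show "(2 * real l + 1) * (a + real l * (real l + 1)) powr (- s) \<le> H l - H (Suc l)"
      by (simp add: H_def power2_eq_square algebra_simps)
  qed
  also have "\<dots> = H 1 - H (Suc n)"
    using sum_Suc_diff[of 1 n "\<lambda>l. - H l"] by simp
  also have "\<dots> \<le> H 1"
    using assms(1) by (simp add: H_def)
  also have "\<dots> \<le> a powr (1 - s) / (s - 1)"
  proof -
    have "(a + 1/2) powr (1 - s) \<le> a powr (1 - s)"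
      using assms by (intro powr_mono2') auto
    from divide_right_mono[OF this, of "s - 1"] show ?thesis
      using assms(1) by (simp add: H_def add.commute)
  qed
  finally show ?thesis .
qed

section \<open>Spherical harmonics\<close>

text \<open>Orthonormal up to null functions: if a monomial depends linearly on the previous ones on the
  sphere, division by zero makes the corresponding harmonic \<open>0\<close>.\<close>

definition harmonic :: "nat \<Rightarrow> real^3 \<Rightarrow> real"
  where "harmonic j = gram_schmidt sphere_monomial j"

definition eigenvalue :: "nat \<Rightarrow> real"
  where "eigenvalue j = real (floor_sqrt j) * (real (floor_sqrt j) + 1)"

lemma sphere_monomial_continuous: "continuous_on S2 (sphere_monomial j)"
  by (rule spoly_continuous[OF spoly_sphere_monomial[of _ "Suc j"]]) (simp add: power2_eq_square)

lemma harmonic_continuous: "continuous_on S2 (harmonic j)"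
  unfolding harmonic_def by (rule continuous_on_gram_schmidt(1)) (rule sphere_monomial_continuous)

lemma ip_harmonic: "i \<noteq> j \<Longrightarrow> ip (harmonic i) (harmonic j) = 0"
  unfolding harmonic_def by (rule ip_gram_schmidt) (rule sphere_monomial_continuous)

lemma ip_harmonic_self: "ip (harmonic j) (harmonic j) \<in> {0, 1}"
  unfolding harmonic_def by (rule ip_gram_schmidt_self)

lemma spoly_harmonic: "j < n\<^sup>2 \<Longrightarrow> spoly n (harmonic j)"
proof (induction j rule: less_induct)
  case (less j)
  have "spoly n (\<lambda>x. sphere_monomial j x + (\<Sum>i<j. - ip (sphere_monomial j) (harmonic i) * harmonic i x))"
    using less by (intro spoly.add spoly_sum spoly_scale spoly_sphere_monomial) auto
  then have "spoly n (gs_residue sphere_monomial j)"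
    by (simp add: gs_residue_def[abs_def] harmonic_def sum_negf)
  then show ?case
    unfolding harmonic_def gram_schmidt_residue[of _ j, abs_def] by (rule spoly_scale)
qed

lemma spoly_harmonic_expansion:
  assumes "spoly n f" "x \<in> S2"
  shows "f x = (\<Sum>j<n\<^sup>2. ip f (harmonic j) * harmonic j x)"
proof -
  obtain c where "\<And>x. x \<in> S2 \<Longrightarrow> f x = (\<Sum>j<n\<^sup>2. c j * sphere_monomial j x)"
    using spoly_monomial_span[OF assms(1)] unfolding monomial_span_def by blast
  moreover obtain d where "\<And>x. x \<in> S2 \<Longrightarrow> (\<Sum>j<n\<^sup>2. c j * sphere_monomial j x) = (\<Sum>j<n\<^sup>2. d j * harmonic j x)"
    using sum_span_trans[of "n\<^sup>2" S2 sphere_monomial harmonic c] gram_schmidt_span[of sphere_monomial]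
      sphere_monomial_continuous
    unfolding harmonic_def by blast
  ultimately have d: "\<And>x. x \<in> S2 \<Longrightarrow> f x = (\<Sum>j<n\<^sup>2. d j * harmonic j x)"
    by simp
  have e: "d i * harmonic i x = ip f (harmonic i) * harmonic i x" if "i < n\<^sup>2" for i
  proof -
    have "ip f (harmonic i) = ip (\<lambda>x. \<Sum>j<n\<^sup>2. d j * harmonic j x) (harmonic i)"
      by (rule ip_cong) (use d in auto)
    also have "\<dots> = (\<Sum>j<n\<^sup>2. ip (\<lambda>x. d j * harmonic j x) (harmonic i))"
      by (intro ip_sum_left continuous_intros harmonic_continuous)
    also have "\<dots> = (\<Sum>j<n\<^sup>2. if j = i then d i * ip (harmonic i) (harmonic i) else 0)"
      by (intro sum.cong) (auto simp: ip_scale_left ip_harmonic)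
    also have "\<dots> = d i * ip (harmonic i) (harmonic i)"
      using that by simp
    finally have "ip f (harmonic i) = d i * ip (harmonic i) (harmonic i)" .
    then show ?thesis
      using ip_harmonic_self[of i] ip_self_eq_0[OF harmonic_continuous _ assms(2), of i] by auto
  qed
  show ?thesis
    unfolding d[OF assms(2)] by (intro sum.cong refl) (simp only: lessThan_iff e)
qed

lemma ip_spoly_harmonic:
  assumes "spoly n f" "n\<^sup>2 \<le> i"
  shows "ip f (harmonic i) = 0"
proof -
  have "ip f (harmonic i) = ip (\<lambda>x. \<Sum>j<n\<^sup>2. ip f (harmonic j) * harmonic j x) (harmonic i)"
    by (rule ip_cong) (use spoly_harmonic_expansion[OF assms(1)] in auto)
  also have "\<dots> = (\<Sum>j<n\<^sup>2. ip (\<lambda>x. ip f (harmonic j) * harmonic j x) (harmonic i))"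
    by (intro ip_sum_left continuous_intros harmonic_continuous)
  also have "\<dots> = 0"
    using assms(2) by (intro sum.neutral) (auto simp: ip_scale_left ip_harmonic)
  finally show ?thesis .
qed

lemma spoly_harmonic_degree: "spoly (Suc (floor_sqrt j)) (harmonic j)"
  by (rule spoly_harmonic) (rule Suc_floor_sqrt_power2_gt)

text \<open>\<open>\<Delta>Y + l(l+1)Y\<close> has lower degree, and it is orthogonal to all functions of lower
  degree since \<open>\<Delta>\<close> is symmetric; so it vanishes.\<close>

lemma harmonic_laplacian:
  assumes "x \<in> S2"
  shows "sphere_laplacian (harmonic j) x = - eigenvalue j * harmonic j x"
proof -
  define l where "l = floor_sqrt j"
  let ?Y = "harmonic j"
  have Y: "spoly (Suc l) ?Y"
    unfolding l_def by (rule spoly_harmonic_degree)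
  obtain h where h: "spoly l h" "\<And>x. x \<in> S2 \<Longrightarrow> sphere_laplacian ?Y x = - eigenvalue j * ?Y x + h x"
    using spoly_laplacian[OF Y] unfolding eigenvalue_def l_def[symmetric] by (auto simp: mult.commute add.commute)
  have l: "l\<^sup>2 \<le> j" unfolding l_def by (rule floor_sqrt_power2_le)
  have perp: "ip g ?Y = 0" if "spoly l g" for g
    by (rule ip_spoly_harmonic[OF that l])
  have ch: "continuous_on S2 h" by (rule spoly_continuous[OF h(1)])
  have cL: "continuous_on S2 (sphere_laplacian ?Y)"
    by (rule spoly_continuous[OF spoly_laplacian_mono[OF Y]])
  have "ip h h = ip (\<lambda>x. sphere_laplacian ?Y x + eigenvalue j * ?Y x) h"
    by (rule ip_cong) (use h(2) in auto)
  also have "\<dots> = ip (sphere_laplacian ?Y) h + eigenvalue j * ip ?Y h"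
    by (subst ip_add_left) (auto intro!: continuous_intros ch cL harmonic_continuous simp: ip_scale_left)
  also have "ip ?Y h = 0"
    using perp[OF h(1)] by (simp add: ip_commute)
  also have "ip (sphere_laplacian ?Y) h = - (\<Sum>k\<in>UNIV. ip (rot_deriv k h) (rot_deriv k ?Y))"
    using ip_laplacian[OF spoly_C1[OF h(1)] Y] by (simp add: ip_commute)
  also have "(\<Sum>k\<in>UNIV. ip (rot_deriv k h) (rot_deriv k ?Y)) = (\<Sum>k\<in>UNIV. ip (rot_deriv k ?Y) (rot_deriv k h))"
    by (simp add: ip_commute)
  also have "\<dots> = - ip ?Y (sphere_laplacian h)"
    by (rule ip_laplacian[OF spoly_C1[OF Y] h(1)])
  also have "ip ?Y (sphere_laplacian h) = 0"
    using perp[OF spoly_laplacian_mono[OF h(1)]] by (simp add: ip_commute)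
  finally have "ip h h = 0" by simp
  then show ?thesis
    using ip_self_eq_0[OF ch _ assms] h(2)[OF assms] by simp
qed

lemma ip_rot_deriv_harmonic:
  assumes "C1_sphere f"
  shows "(\<Sum>k\<in>UNIV. ip (rot_deriv k f) (rot_deriv k (harmonic j))) = eigenvalue j * ip f (harmonic j)"
proof -
  have "(\<Sum>k\<in>UNIV. ip (rot_deriv k f) (rot_deriv k (harmonic j))) = - ip f (sphere_laplacian (harmonic j))"
    by (rule ip_laplacian[OF assms spoly_harmonic_degree])
  also have "ip f (sphere_laplacian (harmonic j)) = ip (\<lambda>x. - eigenvalue j * harmonic j x) f"
    by (subst ip_commute, rule ip_cong) (auto simp: harmonic_laplacian)
  also have "\<dots> = - eigenvalue j * ip (harmonic j) f"
    by (rule ip_scale_left)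
  finally show ?thesis
    by (simp add: ip_commute)
qed

lemma floor_sqrt_block: "j \<in> {l\<^sup>2..<(Suc l)\<^sup>2} \<Longrightarrow> floor_sqrt j = l"
  by (rule floor_sqrt_unique) auto

text \<open>Evaluate the rotated reproducing kernel at \<open>y\<close> and apply Cauchy--Schwarz.\<close>

lemma harmonic_kernel_le:
  assumes "x \<in> S2" "y \<in> S2"
  shows "(\<Sum>j\<in>{l\<^sup>2..<(Suc l)\<^sup>2}. (harmonic j x)\<^sup>2) \<le> (\<Sum>j\<in>{l\<^sup>2..<(Suc l)\<^sup>2}. (harmonic j y)\<^sup>2)"
proof -
  let ?B = "{l\<^sup>2..<(Suc l)\<^sup>2}"
  define K where "K x = (\<Sum>j\<in>?B. (harmonic j x)\<^sup>2)" for x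
  obtain R where R: "orthogonal_transformation R" "R y = x"
    using orthogonal_transformation_exists[of y x] assms by auto
  define Z where "Z z = (\<Sum>j\<in>?B. harmonic j x * harmonic j z)" for z
  have Z_spoly: "spoly (Suc l) Z"
    unfolding Z_def[abs_def] by (intro spoly_sum spoly_scale spoly_harmonic) auto
  have ZR_spoly: "spoly (Suc l) (\<lambda>z. Z (R z))"
    by (rule spoly_compose_orthogonal[OF R(1) Z_spoly])
  note cont = spoly_continuous[OF Z_spoly] spoly_continuous[OF ZR_spoly]
  define c where "c j = ip (\<lambda>z. Z (R z)) (harmonic j)" for j
  have ipZ: "ip Z g = (\<Sum>j\<in>?B. harmonic j x * ip (harmonic j) g)" if "continuous_on S2 g" for g
  proof -
    have "ip Z g = (\<Sum>j\<in>?B. ip (\<lambda>z. harmonic j x * harmonic j z) g)"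
      unfolding Z_def[abs_def] by (intro ip_sum_left continuous_intros harmonic_continuous that)
    then show ?thesis by (simp add: ip_scale_left)
  qed
  have c0: "c j = 0" if "j < l\<^sup>2" for j
  proof -
    obtain S where S: "orthogonal_transformation S" "S = inv R"
      using R(1) orthogonal_transformation_inv by blast
    have RS: "R (S z) = z" for z
      using S(2) R(1) orthogonal_transformation_bij bij_inv_eq_iff by metis
    have YS: "spoly l (\<lambda>z. harmonic j (S z))"
      by (rule spoly_compose_orthogonal[OF S(1) spoly_harmonic[OF that]])
    have "c j = (\<integral>z. Z (R (S z)) * harmonic j (S z) \<partial>sphere_measure)"
      unfolding c_def ip_def
      by (rule integral_sphere_orthogonal[OF S(1), symmetric])
        (intro borel_measurable_sphere_measure continuous_intros cont harmonic_continuous)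
    also have "\<dots> = ip Z (\<lambda>z. harmonic j (S z))"
      by (simp add: ip_def RS)
    also have "\<dots> = (\<Sum>i\<in>?B. harmonic i x * ip (harmonic i) (\<lambda>z. harmonic j (S z)))"
      by (rule ipZ[OF spoly_continuous[OF YS]])
    also have "\<dots> = 0"
      using ip_spoly_harmonic[OF YS] by (intro sum.neutral) (auto simp: ip_commute)
    finally show ?thesis .
  qed
  have sub: "?B \<subseteq> {..<(Suc l)\<^sup>2}" by auto
  have ZR: "Z (R z) = (\<Sum>j\<in>?B. c j * harmonic j z)" if "z \<in> S2" for z
  proof -
    have "Z (R z) = (\<Sum>j<(Suc l)\<^sup>2. c j * harmonic j z)"
      unfolding c_def by (rule spoly_harmonic_expansion[OF ZR_spoly that])
    also have "\<dots> = (\<Sum>j\<in>?B. c j * harmonic j z)"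
      using c0 by (intro sum.mono_neutral_right) auto
    finally show ?thesis .
  qed
  have "(\<Sum>j\<in>?B. (c j)\<^sup>2) = ip (\<lambda>z. Z (R z)) (\<lambda>z. Z (R z))"
  proof -
    have "ip (\<lambda>z. Z (R z)) (\<lambda>z. Z (R z)) = ip (\<lambda>z. \<Sum>j\<in>?B. c j * harmonic j z) (\<lambda>z. Z (R z))"
      by (rule ip_cong) (use ZR in auto)
    also have "\<dots> = (\<Sum>j\<in>?B. ip (\<lambda>z. c j * harmonic j z) (\<lambda>z. Z (R z)))"
      by (intro ip_sum_left continuous_intros harmonic_continuous cont)
    finally show ?thesis
      by (simp add: ip_scale_left c_def power2_eq_square ip_commute[of "harmonic _"])
  qed
  also have "\<dots> = ip Z Z"
    unfolding ip_def
    by (rule integral_sphere_orthogonal[OF R(1)]) (intro borel_measurable_sphere_measure continuous_intros cont)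
  also have "\<dots> = K x"
  proof -
    have "ip (harmonic j) Z = harmonic j x" if "j \<in> ?B" for j
    proof -
      have "ip (harmonic j) Z = (\<Sum>i\<in>?B. harmonic i x * ip (harmonic i) (harmonic j))"
        using ipZ[OF harmonic_continuous, of j] by (simp add: ip_commute)
      also have "\<dots> = (\<Sum>i\<in>?B. if i = j then harmonic j x * ip (harmonic j) (harmonic j) else 0)"
        by (intro sum.cong) (auto simp: ip_harmonic)
      also have "\<dots> = harmonic j x * ip (harmonic j) (harmonic j)"
        using that by simp
      also have "\<dots> = harmonic j x"
        using ip_harmonic_self[of j] ip_self_eq_0[OF harmonic_continuous _ assms(1), of j] by auto
      finally show ?thesis .
    qed
    then show ?thesis
      using ipZ[OF cont(1)] by (simp add: K_def power2_eq_square)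
  qed
  finally have norm_c: "(\<Sum>j\<in>?B. (c j)\<^sup>2) = K x" .
  have "K x = Z (R y)"
    by (simp add: R(2) Z_def K_def power2_eq_square)
  also have "\<dots> = (\<Sum>j\<in>?B. c j * harmonic j y)"
    by (rule ZR[OF assms(2)])
  finally have "(K x)\<^sup>2 \<le> K x * K y"
    using Cauchy_Schwarz_ineq_sum[of c "\<lambda>j. harmonic j y" ?B] norm_c by (simp add: K_def)
  moreover have "0 \<le> K x" "0 \<le> K y"
    by (simp_all add: K_def sum_nonneg)
  ultimately have "K x \<le> K y"
    by (cases "K x = 0") (auto simp: power2_eq_square)
  then show ?thesis
    by (simp add: K_def)
qed

lemma harmonic_kernel:
  assumes "x \<in> S2"
  shows "(\<Sum>j\<in>{l\<^sup>2..<(Suc l)\<^sup>2}. (harmonic j x)\<^sup>2) \<le> (2 * real l + 1) / (4 * pi)"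
proof -
  let ?B = "{l\<^sup>2..<(Suc l)\<^sup>2}"
  let ?K = "\<lambda>x. \<Sum>j\<in>?B. (harmonic j x)\<^sup>2"
  have c: "continuous_on S2 ?K"
    by (intro continuous_intros harmonic_continuous)
  have "4 * pi * ?K x = (\<integral>y. ?K x \<partial>sphere_measure)"
    by (simp add: space_sphere_measure measure_sphere_measure_S2)
  also have "\<dots> \<le> (\<integral>y. ?K y \<partial>sphere_measure)"
    by (intro integral_mono integrable_sphere_measure c continuous_on_const harmonic_kernel_le assms)
      (simp add: space_sphere_measure)
  also have "\<dots> = (\<Sum>j\<in>?B. ip (harmonic j) (harmonic j))"
    unfolding ip_def power2_eq_square
    by (intro Bochner_Integration.integral_sum integrable_sphere_measure continuous_intros harmonic_continuous)
  also have "\<dots> \<le> (\<Sum>j\<in>?B. 1)"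
    using ip_harmonic_self by (intro sum_mono) (metis insert_iff order_refl singletonD zero_le_one)
  also have "\<dots> = 2 * real l + 1"
    by (simp add: power2_eq_square)
  finally show ?thesis
    by (simp add: field_simps)
qed

lemma harmonic_0_const: "\<exists>c. \<forall>x\<in>S2. harmonic 0 x = c"
proof -
  have "gs_residue sphere_monomial 0 = (\<lambda>x. 1)"
    by (simp add: gs_residue_def[abs_def] sphere_monomial_def)
  then show ?thesis
    unfolding harmonic_def gram_schmidt_residue[of _ 0] by simp
qed

lemma sum_squares_blocks:
  fixes g :: "nat \<Rightarrow> real"
  shows "(\<Sum>j\<in>{1..<(Suc n)\<^sup>2}. g j) = (\<Sum>l=1..n. \<Sum>j\<in>{l\<^sup>2..<(Suc l)\<^sup>2}. g j)"
proof (induction n)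
  case (Suc n)
  have "(\<Sum>j\<in>{1..<(Suc (Suc n))\<^sup>2}. g j) = (\<Sum>j\<in>{1..<(Suc n)\<^sup>2}. g j) + (\<Sum>j\<in>{(Suc n)\<^sup>2..<(Suc (Suc n))\<^sup>2}. g j)"
    by (rule sum.atLeastLessThan_concat[symmetric]) (auto intro: power_mono)
  then show ?case
    using Suc by simp
qed simp

lemma sum_harmonic_powr:
  assumes "1 < s" "0 < a" "x \<in> S2"
  shows "(\<Sum>j\<in>{1..<N}. (harmonic j x)\<^sup>2 * (a + eigenvalue j) powr (- s)) \<le> a powr (1 - s) / (4 * pi * (s - 1))"
proof -
  have "N \<le> (Suc N)\<^sup>2" by (simp add: power2_eq_square)
  then have "(\<Sum>j\<in>{1..<N}. (harmonic j x)\<^sup>2 * (a + eigenvalue j) powr (- s))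
      \<le> (\<Sum>j\<in>{1..<(Suc N)\<^sup>2}. (harmonic j x)\<^sup>2 * (a + eigenvalue j) powr (- s))"
    by (intro sum_mono2) auto
  also have "\<dots> = (\<Sum>l=1..N. \<Sum>j\<in>{l\<^sup>2..<(Suc l)\<^sup>2}. (harmonic j x)\<^sup>2 * (a + eigenvalue j) powr (- s))"
    by (rule sum_squares_blocks)
  also have "\<dots> = (\<Sum>l=1..N. (\<Sum>j\<in>{l\<^sup>2..<(Suc l)\<^sup>2}. (harmonic j x)\<^sup>2) * (a + real l * (real l + 1)) powr (- s))"
    unfolding sum_distrib_right by (intro sum.cong refl) (simp add: eigenvalue_def floor_sqrt_block)
  also have "\<dots> \<le> (\<Sum>l=1..N. (2 * real l + 1) / (4 * pi) * (a + real l * (real l + 1)) powr (- s))"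
    by (intro sum_mono mult_right_mono harmonic_kernel assms) simp
  also have "\<dots> = (\<Sum>l=1..N. (2 * real l + 1) * (a + real l * (real l + 1)) powr (- s)) / (4 * pi)"
    by (simp add: sum_divide_distrib)
  also have "\<dots> \<le> a powr (1 - s) / (s - 1) / (4 * pi)"
    using sum_eigenvalue_powr[OF assms(1,2)] by (intro divide_right_mono) auto
  finally show ?thesis
    by (simp add: mult.commute)
qed

lemma spoly_dense:
  assumes "continuous_on S2 f" "0 < e"
  shows "\<exists>n g. spoly n g \<and> (\<forall>x\<in>S2. \<bar>f x - g x\<bar> < e)"
proof -
  have "\<exists>g. (\<exists>n. spoly (Suc n) g) \<and> (\<forall>x\<in>S2. \<bar>f x - g x\<bar> < e)"
  proof (rule Stone_Weierstrass_HOL[OF _ _ _ _ _ _ assms])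
    show "\<exists>n. spoly (Suc n) (\<lambda>x. c)" for c
      using spoly.const by blast
    show "continuous_on S2 g" if "\<exists>n. spoly (Suc n) g" for g
      using that spoly_continuous by blast
    show "\<exists>n. spoly (Suc n) (\<lambda>x. g x + h x)" if gh: "(\<exists>n. spoly (Suc n) g) \<and> (\<exists>n. spoly (Suc n) h)" for g h
    proof -
      obtain m n where "spoly (Suc m) g" "spoly (Suc n) h"
        using gh by blast
      then have "spoly (Suc (m + n)) g" "spoly (Suc (m + n)) h"
        by (auto elim: spoly_mono)
      then show ?thesis
        using spoly.add by blast
    qed
    show "\<exists>n. spoly (Suc n) (\<lambda>x. g x * h x)" if gh: "(\<exists>n. spoly (Suc n) g) \<and> (\<exists>n. spoly (Suc n) h)" for g h
      using gh spoly_mult by (metis add_Suc_right)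
    show "\<exists>g. (\<exists>n. spoly (Suc n) g) \<and> g x \<noteq> g y" if xy: "x \<in> S2 \<and> y \<in> S2 \<and> x \<noteq> y" for x y
    proof -
      obtain i where "x $ i \<noteq> y $ i"
        using xy by (auto simp: vec_eq_iff)
      moreover have "spoly (Suc (Suc 0)) (\<lambda>x. x $ i * 1)"
        by (intro spoly.coord spoly.const)
      ultimately show ?thesis by auto
    qed
  qed simp
  then show ?thesis by blast
qed

section \<open>Expansion in spherical harmonics\<close>

lemma L2_sphere_real:
  "f \<in> L2_sphere \<longleftrightarrow> f \<in> borel_measurable sphere_measure \<and> integrable sphere_measure (\<lambda>x. f x * f x)"
  for f :: "real^3 \<Rightarrow> real"
  by (simp add: L2_sphere_def power2_eq_square)

lemma integrable_L2_mult:
  fixes f g :: "real^3 \<Rightarrow> real"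
  assumes "f \<in> L2_sphere" "g \<in> L2_sphere"
  shows "integrable sphere_measure (\<lambda>x. f x * g x)"
proof (rule Bochner_Integration.integrable_bound)
  show "integrable sphere_measure (\<lambda>x. f x * f x + g x * g x)"
    using assms by (simp add: L2_sphere_real)
  show "(\<lambda>x. f x * g x) \<in> borel_measurable sphere_measure"
    using assms by (auto simp: L2_sphere_real)
  have "\<bar>a * b\<bar> \<le> a * a + b * b" for a b :: real
  proof -
    have "2 * (\<bar>a\<bar> * \<bar>b\<bar>) \<le> a * a + b * b"
      using zero_le_power2[of "\<bar>a\<bar> - \<bar>b\<bar>"] by (simp add: power2_eq_square algebra_simps)
    moreover have "0 \<le> \<bar>a\<bar> * \<bar>b\<bar>" by simp
    ultimately show ?thesis unfolding abs_mult by linarith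
  qed
  then show "AE x in sphere_measure. norm (f x * g x) \<le> norm (f x * f x + g x * g x)"
    by simp
qed

lemma continuous_L2_sphere: "continuous_on S2 f \<Longrightarrow> f \<in> L2_sphere"
  by (auto simp: L2_sphere_def intro!: borel_measurable_sphere_measure integrable_sphere_measure continuous_intros)

lemma L2_sphere_add:
  fixes f g :: "real^3 \<Rightarrow> real"
  assumes "f \<in> L2_sphere" "g \<in> L2_sphere"
  shows "(\<lambda>x. f x + g x) \<in> L2_sphere"
proof -
  have "integrable sphere_measure (\<lambda>x. f x * f x + 2 * (f x * g x) + g x * g x)"
    by (intro Bochner_Integration.integrable_add integrable_mult_right integrable_L2_mult assms)
  then have "integrable sphere_measure (\<lambda>x. (f x + g x) * (f x + g x))"
    by (simp add: algebra_simps)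
  then show ?thesis
    using assms by (auto simp: L2_sphere_real)
qed

lemma L2_sphere_scale:
  fixes f :: "real^3 \<Rightarrow> real"
  assumes "f \<in> L2_sphere"
  shows "(\<lambda>x. c * f x) \<in> L2_sphere"
proof -
  have "integrable sphere_measure (\<lambda>x. (c * c) * (f x * f x))"
    by (intro integrable_mult_right integrable_L2_mult assms)
  then have "integrable sphere_measure (\<lambda>x. c * f x * (c * f x))"
    by (simp add: algebra_simps)
  then show ?thesis
    using assms by (auto simp: L2_sphere_real)
qed

lemma L2_sphere_diff:
  fixes f g :: "real^3 \<Rightarrow> real"
  shows "f \<in> L2_sphere \<Longrightarrow> g \<in> L2_sphere \<Longrightarrow> (\<lambda>x. f x - g x) \<in> L2_sphere"
  using L2_sphere_add[OF _ L2_sphere_scale[of g "-1"], of f] by simp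

lemma ip_L2_diff_square:
  assumes "f \<in> L2_sphere" "g \<in> L2_sphere"
  shows "ip (\<lambda>x. f x - g x) (\<lambda>x. f x - g x) = ip f f - 2 * ip f g + ip g g"
proof -
  have "ip (\<lambda>x. f x - g x) (\<lambda>x. f x - g x) = (\<integral>x. f x * f x - 2 * (f x * g x) + g x * g x \<partial>sphere_measure)"
    unfolding ip_def by (simp add: algebra_simps)
  also have "\<dots> = ip f f - 2 * ip f g + ip g g"
    unfolding ip_def using integrable_L2_mult[OF assms] integrable_L2_mult[OF assms(1,1)] integrable_L2_mult[OF assms(2,2)]
    by simp
  finally show ?thesis .
qed

lemma ip_L2_diff_left:
  assumes "f \<in> L2_sphere" "g \<in> L2_sphere" "h \<in> L2_sphere"
  shows "ip (\<lambda>x. f x - g x) h = ip f h - ip g h"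
  unfolding ip_def left_diff_distrib
  by (intro Bochner_Integration.integral_diff integrable_L2_mult assms)

lemma ip_L2_sum_right:
  assumes "g \<in> L2_sphere" "\<And>i. i \<in> I \<Longrightarrow> f i \<in> L2_sphere"
  shows "ip g (\<lambda>x. \<Sum>i\<in>I. c i * f i x) = (\<Sum>i\<in>I. c i * ip g (f i))"
proof -
  have "ip g (\<lambda>x. \<Sum>i\<in>I. c i * f i x) = (\<integral>x. (\<Sum>i\<in>I. c i * (g x * f i x)) \<partial>sphere_measure)"
    unfolding ip_def by (simp add: sum_distrib_left mult.left_commute)
  also have "\<dots> = (\<Sum>i\<in>I. \<integral>x. c i * (g x * f i x) \<partial>sphere_measure)"
    by (intro Bochner_Integration.integral_sum integrable_mult_right integrable_L2_mult assms)
  finally show ?thesis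
    by (simp add: ip_def)
qed

lemma ip_Cauchy_Schwarz:
  assumes f: "f \<in> L2_sphere" and g: "g \<in> L2_sphere"
  shows "(ip f g)\<^sup>2 \<le> ip f f * ip g g"
proof (cases "ip g g = 0")
  case True
  have "0 \<le> ip f f - 2 * (t * ip f g)" for t
    using ip_nonneg[of "\<lambda>x. f x - t * g x"] ip_L2_diff_square[OF f L2_sphere_scale[OF g], of t]
    by (simp add: ip_scale_left ip_commute[of _ "\<lambda>x. t * g x"] True ip_commute[of g f])
  from this[of "ip f f / ip f g"] this[of "(ip f f + 1) / ip f g"] have "ip f g = 0"
    using ip_nonneg[of f] by (cases "ip f g = 0") auto
  then show ?thesis by (simp add: True)
next
  case False
  then have pos: "0 < ip g g"
    using ip_nonneg[of g] by simp
  define t where "t = ip f g / ip g g"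
  have "0 \<le> ip f f - 2 * (t * ip f g) + t * (t * ip g g)"
    using ip_nonneg[of "\<lambda>x. f x - t * g x"] ip_L2_diff_square[OF f L2_sphere_scale[OF g], of t]
    by (simp add: ip_scale_left ip_commute[of _ "\<lambda>x. t * g x"] ip_commute[of g f])
  also have "\<dots> = ip f f - (ip f g)\<^sup>2 / ip g g"
    using pos by (simp add: t_def power2_eq_square)
  finally show ?thesis
    using pos by (simp add: field_simps)
qed

lemma Lnorm_2: "Lnorm 2 f = sqrt (\<integral>x. (norm (f x))\<^sup>2 \<partial>sphere_measure)"
  by (simp add: Lnorm_def powr_half_sqrt)

lemma Lnorm_2_ip: "Lnorm 2 f = sqrt (ip f f)" for f :: "real^3 \<Rightarrow> real"
  by (simp add: Lnorm_2 ip_def power2_eq_square)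

lemma harmonic_L2: "harmonic j \<in> L2_sphere"
  by (rule continuous_L2_sphere[OF harmonic_continuous])

lemma harmonic_coefficient:
  assumes "f \<in> L2_sphere"
  shows "ip f (harmonic j) * ip (harmonic j) (harmonic j) = ip f (harmonic j)"
  using ip_harmonic_self[of j] ip_eq_0_left[OF harmonic_continuous, of j f]
  by (auto simp: ip_commute[of f])

lemma ip_harmonic_sum:
  assumes "finite I" "j \<in> I"
  shows "ip (harmonic j) (\<lambda>x. \<Sum>i\<in>I. b i * harmonic i x) = b j * ip (harmonic j) (harmonic j)"
proof -
  have "ip (harmonic j) (\<lambda>x. \<Sum>i\<in>I. b i * harmonic i x) = (\<Sum>i\<in>I. b i * ip (harmonic j) (harmonic i))"
    by (intro ip_L2_sum_right harmonic_L2)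
  also have "\<dots> = (\<Sum>i\<in>I. if i = j then b j * ip (harmonic j) (harmonic j) else 0)"
    by (intro sum.cong) (auto simp: ip_harmonic)
  finally show ?thesis
    using assms by simp
qed

lemma harmonic_sum_continuous: "continuous_on S2 (\<lambda>x. \<Sum>j\<in>I. b j * harmonic j x)"
  by (intro continuous_intros harmonic_continuous)

lemma ip_diff_harmonic_sum:
  assumes "f \<in> L2_sphere" "finite I"
  shows "ip (\<lambda>x. f x - (\<Sum>j\<in>I. b j * harmonic j x)) (\<lambda>x. f x - (\<Sum>j\<in>I. b j * harmonic j x)) =
    ip f f - 2 * (\<Sum>j\<in>I. b j * ip f (harmonic j)) + (\<Sum>j\<in>I. (b j)\<^sup>2 * ip (harmonic j) (harmonic j))"
proof -
  let ?S = "\<lambda>x. \<Sum>j\<in>I. b j * harmonic j x"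
  have S: "?S \<in> L2_sphere"
    by (rule continuous_L2_sphere[OF harmonic_sum_continuous])
  have "ip ?S ?S = (\<Sum>j\<in>I. b j * ip ?S (harmonic j))"
    by (intro ip_L2_sum_right S harmonic_L2)
  also have "\<dots> = (\<Sum>j\<in>I. (b j)\<^sup>2 * ip (harmonic j) (harmonic j))"
    by (intro sum.cong refl) (simp add: ip_commute[of ?S] ip_harmonic_sum assms power2_eq_square)
  finally show ?thesis
    using ip_L2_diff_square[OF assms(1) S] ip_L2_sum_right[OF assms(1), of I harmonic b] harmonic_L2 by simp
qed

lemma bessel:
  assumes "f \<in> L2_sphere" "finite I"
  shows "(\<Sum>j\<in>I. (ip f (harmonic j))\<^sup>2) \<le> ip f f"
proof -
  have "(\<Sum>j\<in>I. (ip f (harmonic j))\<^sup>2 * ip (harmonic j) (harmonic j)) = (\<Sum>j\<in>I. (ip f (harmonic j))\<^sup>2)"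
    by (intro sum.cong refl) (simp only: power2_eq_square mult.assoc harmonic_coefficient[OF assms(1)])
  then show ?thesis
    using ip_nonneg[of "\<lambda>x. f x - (\<Sum>j\<in>I. ip f (harmonic j) * harmonic j x)"]
      ip_diff_harmonic_sum[OF assms, of "\<lambda>j. ip f (harmonic j)"]
    by (simp add: power2_eq_square)
qed

lemma best_approximation:
  assumes "f \<in> L2_sphere"
  shows "ip f f - (\<Sum>j<N. (ip f (harmonic j))\<^sup>2)
    \<le> ip (\<lambda>x. f x - (\<Sum>j<N. d j * harmonic j x)) (\<lambda>x. f x - (\<Sum>j<N. d j * harmonic j x))"
proof -
  have "2 * (d j * ip f (harmonic j)) - (d j)\<^sup>2 * ip (harmonic j) (harmonic j) \<le> (ip f (harmonic j))\<^sup>2" for j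
  proof -
    have "0 \<le> (d j - ip f (harmonic j))\<^sup>2" by simp
    then show ?thesis
      using ip_harmonic_self[of j] harmonic_coefficient[OF assms, of j]
      by (auto simp: power2_eq_square algebra_simps)
  qed
  then have "(\<Sum>j<N. 2 * (d j * ip f (harmonic j)) - (d j)\<^sup>2 * ip (harmonic j) (harmonic j)) \<le> (\<Sum>j<N. (ip f (harmonic j))\<^sup>2)"
    by (rule sum_mono)
  then show ?thesis
    using ip_diff_harmonic_sum[OF assms, of "{..<N}" d]
    by (simp add: sum_subtractf sum_distrib_left)
qed

lemma parseval:
  assumes f: "f \<in> L2_sphere" and approx: "\<And>e. 0 < e \<Longrightarrow> \<exists>g. continuous_on S2 g \<and> ip (\<lambda>x. f x - g x) (\<lambda>x. f x - g x) < e"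
  shows "(\<lambda>j. (ip f (harmonic j))\<^sup>2) sums ip f f"
  unfolding sums_def LIMSEQ_def
proof (intro allI impI)
  fix e :: real assume e: "0 < e"
  obtain g where g: "continuous_on S2 g" "ip (\<lambda>x. f x - g x) (\<lambda>x. f x - g x) < e / 4"
    using approx[of "e / 4"] e by auto
  define d where "d = sqrt (e / (16 * pi))"
  have d: "0 < d" "d\<^sup>2 = e / (16 * pi)"
    using e by (simp_all add: d_def)
  obtain n p where p: "spoly n p" "\<And>x. x \<in> S2 \<Longrightarrow> \<bar>g x - p x\<bar> < d"
    using spoly_dense[OF g(1) d(1)] by blast
  have cp: "continuous_on S2 p" by (rule spoly_continuous[OF p(1)])
  note L2 = f continuous_L2_sphere[OF g(1)] continuous_L2_sphere[OF cp]
  let ?M = "n\<^sup>2"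
  have "ip f f - (\<Sum>j<?M. (ip f (harmonic j))\<^sup>2)
    \<le> ip (\<lambda>x. f x - (\<Sum>j<?M. ip p (harmonic j) * harmonic j x)) (\<lambda>x. f x - (\<Sum>j<?M. ip p (harmonic j) * harmonic j x))"
    by (rule best_approximation[OF f])
  also have "\<dots> = ip (\<lambda>x. f x - p x) (\<lambda>x. f x - p x)"
    by (rule ip_cong) (simp_all add: spoly_harmonic_expansion[OF p(1), symmetric])
  also have "\<dots> \<le> (\<integral>x. 2 * ((f x - g x) * (f x - g x)) + 2 * d\<^sup>2 \<partial>sphere_measure)"
    unfolding ip_def
  proof (rule integral_mono)
    show "integrable sphere_measure (\<lambda>x. (f x - p x) * (f x - p x))"
      by (intro integrable_L2_mult L2_sphere_diff L2)
    show "integrable sphere_measure (\<lambda>x. 2 * ((f x - g x) * (f x - g x)) + 2 * d\<^sup>2)"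
      by (intro Bochner_Integration.integrable_add integrable_mult_right integrable_L2_mult L2_sphere_diff L2) simp
    fix x assume "x \<in> space sphere_measure"
    then have "\<bar>g x - p x\<bar> < d" using p(2) by (simp add: space_sphere_measure)
    then have 1: "(g x - p x)\<^sup>2 \<le> d\<^sup>2" by (simp add: abs_le_square_iff[symmetric])
    have "(f x - p x)\<^sup>2 \<le> 2 * (f x - g x)\<^sup>2 + 2 * (g x - p x)\<^sup>2"
      using zero_le_power2[of "(f x - g x) - (g x - p x)"] by (simp add: power2_eq_square algebra_simps)
    then show "(f x - p x) * (f x - p x) \<le> 2 * ((f x - g x) * (f x - g x)) + 2 * d\<^sup>2"
      using 1 by (simp add: power2_eq_square)
  qed
  also have "\<dots> = 2 * ip (\<lambda>x. f x - g x) (\<lambda>x. f x - g x) + 2 * d\<^sup>2 * (4 * pi)"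
    unfolding ip_def using integrable_L2_mult[OF L2_sphere_diff L2_sphere_diff, OF L2(1,2) L2(1,2)]
    by (simp add: space_sphere_measure measure_sphere_measure_S2)
  also have "2 * d\<^sup>2 * (4 * pi) = e / 2"
    by (simp add: d(2))
  also have "2 * ip (\<lambda>x. f x - g x) (\<lambda>x. f x - g x) + e / 2 < e"
    using g(2) by simp
  finally have M: "ip f f - (\<Sum>j<?M. (ip f (harmonic j))\<^sup>2) < e" .
  show "\<exists>no. \<forall>N\<ge>no. dist (\<Sum>j<N. (ip f (harmonic j))\<^sup>2) (ip f f) < e"
  proof (intro exI allI impI)
    fix N assume "?M \<le> N"
    then have "(\<Sum>j<?M. (ip f (harmonic j))\<^sup>2) \<le> (\<Sum>j<N. (ip f (harmonic j))\<^sup>2)"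
      by (intro sum_mono2) auto
    then show "dist (\<Sum>j<N. (ip f (harmonic j))\<^sup>2) (ip f f) < e"
      using M bessel[OF f, of "{..<N}"] by (simp add: dist_real_def)
  qed
qed

lemma rot_deriv_sum:
  assumes "\<And>j. C1_sphere (f j)"
  shows "finite I \<Longrightarrow> C1_sphere (\<lambda>x. \<Sum>j\<in>I. c j * f j x) \<and>
    (\<forall>x\<in>S2. rot_deriv k (\<lambda>x. \<Sum>j\<in>I. c j * f j x) x = (\<Sum>j\<in>I. c j * rot_deriv k (f j) x))"
proof (induction I rule: finite_induct)
  case empty
  then show ?case by (simp add: C1_sphere_const rot_deriv_const)
next
  case (insert i I)
  have s: "C1_sphere (\<lambda>x. c i * f i x)" "x \<in> S2 \<Longrightarrow> rot_deriv k (\<lambda>x. c i * f i x) x = c i * rot_deriv k (f i) x" for x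
    using C1_sphere_mult[OF C1_sphere_const[of "c i"] assms[of i]] by (simp_all add: rot_deriv_const)
  show ?case
    using C1_sphere_add[OF s(1) conjunct1[OF insert.IH]] insert.IH insert.hyps s(2) by simp
qed

definition tangential :: "3 \<Rightarrow> (real^3 \<Rightarrow> real^3) \<Rightarrow> real^3 \<Rightarrow> real"
  where "tangential k G x = G x \<bullet> cross3 (axis k 1) x"

lemma sum_inner_cross3:
  assumes "x \<in> S2"
  shows "(\<Sum>k\<in>UNIV. (v \<bullet> cross3 (axis k 1) x)\<^sup>2) = (norm v)\<^sup>2 - (v \<bullet> x)\<^sup>2"
proof -
  have x: "x$1 * x$1 + x$2 * x$2 + x$3 * x$3 = 1"
    using assms by (simp add: norm_eq_1 inner_vec_def sum_3)
  have "(norm v)\<^sup>2 = (v \<bullet> v) * (x$1 * x$1 + x$2 * x$2 + x$3 * x$3)"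
    by (simp add: x power2_norm_eq_inner)
  then show ?thesis
    by (simp add: sum_3 cross3_def axis_def inner_vec_def power2_eq_square algebra_simps)
qed

lemma surface_gradient_eq_sum:
  assumes "x \<in> S2" "v \<bullet> x = 0"
  shows "v = (\<Sum>k\<in>UNIV. (v \<bullet> cross3 (axis k 1) x) *\<^sub>R cross3 (axis k 1) x)"
proof -
  have x: "x$1 * x$1 + x$2 * x$2 + x$3 * x$3 = 1"
    using assms by (simp add: norm_eq_1 inner_vec_def sum_3)
  have v: "v$1 * x$1 + v$2 * x$2 + v$3 * x$3 = 0"
    using assms(2) by (simp add: inner_vec_def sum_3)
  let ?s = "\<Sum>k\<in>UNIV. (v \<bullet> cross3 (axis k 1) x) *\<^sub>R cross3 (axis k 1) x"
  have "?s $ 1 = v$1 * (x$1 * x$1 + x$2 * x$2 + x$3 * x$3) - x$1 * (v$1 * x$1 + v$2 * x$2 + v$3 * x$3)"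
    by (simp add: sum_3 cross3_def axis_def inner_vec_def algebra_simps)
  moreover have "?s $ 2 = v$2 * (x$1 * x$1 + x$2 * x$2 + x$3 * x$3) - x$2 * (v$1 * x$1 + v$2 * x$2 + v$3 * x$3)"
    by (simp add: sum_3 cross3_def axis_def inner_vec_def algebra_simps)
  moreover have "?s $ 3 = v$3 * (x$1 * x$1 + x$2 * x$2 + x$3 * x$3) - x$3 * (v$1 * x$1 + v$2 * x$2 + v$3 * x$3)"
    by (simp add: sum_3 cross3_def axis_def inner_vec_def algebra_simps)
  ultimately show ?thesis
    unfolding vec_eq_iff forall_3 x v by simp
qed

section \<open>Sobolev functions\<close>

lemma tendsto_ip_left:
  assumes "\<And>n. u n \<in> L2_sphere" "v \<in> L2_sphere" "h \<in> L2_sphere"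
    and "(\<lambda>n. ip (\<lambda>x. u n x - v x) (\<lambda>x. u n x - v x)) \<longlonglongrightarrow> 0"
  shows "(\<lambda>n. ip (u n) h) \<longlonglongrightarrow> ip v h"
proof -
  have "(\<lambda>n. (ip (u n) h - ip v h)\<^sup>2) \<longlonglongrightarrow> 0"
  proof (rule tendsto_sandwich[of "\<lambda>_. 0"])
    show "(\<lambda>n. ip (\<lambda>x. u n x - v x) (\<lambda>x. u n x - v x) * ip h h) \<longlonglongrightarrow> 0"
      using tendsto_mult_left_zero[OF assms(4)] .
    show "\<forall>\<^sub>F n in sequentially. (ip (u n) h - ip v h)\<^sup>2 \<le> ip (\<lambda>x. u n x - v x) (\<lambda>x. u n x - v x) * ip h h"
      using ip_Cauchy_Schwarz[OF L2_sphere_diff[OF assms(1,2)] assms(3)]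
      by (simp add: ip_L2_diff_left assms)
  qed simp_all
  then have "(\<lambda>n. ip (u n) h - ip v h) \<longlonglongrightarrow> 0"
    by simp
  then show ?thesis
    by (simp add: LIM_zero_iff)
qed

lemma norm_tangential_le:
  assumes "x \<in> S2"
  shows "(tangential k G x)\<^sup>2 \<le> (norm (G x))\<^sup>2"
proof -
  have "(tangential k G x)\<^sup>2 \<le> (\<Sum>k\<in>UNIV. (G x \<bullet> cross3 (axis k 1) x)\<^sup>2)"
    unfolding tangential_def by (rule member_le_sum) auto
  then show ?thesis
    using sum_inner_cross3[OF assms, of "G x"] zero_le_power2[of "G x \<bullet> x"] by linarith
qed

lemma tangential_L2:
  assumes "G \<in> L2_sphere"
  shows "tangential k G \<in> L2_sphere"
proof -
  have G: "G \<in> borel_measurable sphere_measure" "integrable sphere_measure (\<lambda>x. (norm (G x))\<^sup>2)"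
    using assms by (auto simp: L2_sphere_def)
  have m: "tangential k G \<in> borel_measurable sphere_measure"
    unfolding tangential_def[abs_def]
    by (intro borel_measurable_inner G borel_measurable_sphere_measure continuous_on_cross3)
  have "integrable sphere_measure (\<lambda>x. (norm (tangential k G x))\<^sup>2)"
  proof (rule Bochner_Integration.integrable_bound[OF G(2)])
    show "AE x in sphere_measure. norm ((norm (tangential k G x))\<^sup>2) \<le> norm ((norm (G x))\<^sup>2)"
      by (rule AE_I2) (simp add: space_sphere_measure norm_tangential_le)
  qed (use m in measurable)
  then show ?thesis
    using m by (simp add: L2_sphere_def)
qed

lemma L2_sphere_diff_vector:
  fixes f g :: "real^3 \<Rightarrow> real^3"
  assumes "f \<in> L2_sphere" "g \<in> L2_sphere"
  shows "(\<lambda>x. f x - g x) \<in> L2_sphere"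
proof -
  have m: "f \<in> borel_measurable sphere_measure" "g \<in> borel_measurable sphere_measure"
    using assms by (auto simp: L2_sphere_def)
  have "integrable sphere_measure (\<lambda>x. (norm (f x - g x))\<^sup>2)"
  proof (rule Bochner_Integration.integrable_bound)
    show "integrable sphere_measure (\<lambda>x. 2 * (norm (f x))\<^sup>2 + 2 * (norm (g x))\<^sup>2)"
      using assms by (auto simp: L2_sphere_def)
    have "(norm (a - b))\<^sup>2 \<le> 2 * (norm a)\<^sup>2 + 2 * (norm b)\<^sup>2" for a b :: "real^3"
      using zero_le_power2[of "norm (a + b)"]
      by (simp add: power2_norm_eq_inner inner_diff_left inner_diff_right inner_add_left inner_add_right inner_commute)
    then show "AE x in sphere_measure. norm ((norm (f x - g x))\<^sup>2) \<le> norm (2 * (norm (f x))\<^sup>2 + 2 * (norm (g x))\<^sup>2)"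
      by simp
  qed (use m in measurable)
  then show ?thesis
    using m by (simp add: L2_sphere_def)
qed

lemma continuous_on_surface_gradient:
  assumes "smooth_on_S2 f" "\<And>x. x \<in> S2 \<Longrightarrow> has_surface_gradient f (g x) x"
  shows "continuous_on S2 g"
proof (rule continuous_on_eq)
  show "continuous_on S2 (\<lambda>x. \<Sum>k\<in>UNIV. rot_deriv k f x *\<^sub>R cross3 (axis k 1) x)"
    by (intro continuous_intros continuous_on_cross3 C1_sphereD smooth_on_S2_C1_sphere(1)[OF assms])
  fix x assume x: "x \<in> S2"
  then have "g x \<bullet> x = 0"
    using assms(2) by (simp add: has_surface_gradient_def)
  then show "(\<Sum>k\<in>UNIV. rot_deriv k f x *\<^sub>R cross3 (axis k 1) x) = g x"
    using surface_gradient_eq_sum[OF x] smooth_on_S2_C1_sphere(2)[OF assms x] by simp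
qed

lemma H1_approximation:
  assumes "has_H1_gradient \<phi> G"
  obtains f where "\<And>n. C1_sphere (f n)"
    "(\<lambda>n. ip (\<lambda>x. f n x - \<phi> x) (\<lambda>x. f n x - \<phi> x)) \<longlonglongrightarrow> 0"
    "\<And>k. (\<lambda>n. ip (\<lambda>x. rot_deriv k (f n) x - tangential k G x) (\<lambda>x. rot_deriv k (f n) x - tangential k G x)) \<longlonglongrightarrow> 0"
proof -
  obtain f g where fg: "\<And>n. smooth_on_S2 (f n)" "\<And>n x. x \<in> S2 \<Longrightarrow> has_surface_gradient (f n) (g n x) x"
    and lim: "(\<lambda>n::nat. Lnorm 2 (\<lambda>x. f n x - \<phi> x)) \<longlonglongrightarrow> 0" "(\<lambda>n. Lnorm 2 (\<lambda>x. g n x - G x)) \<longlonglongrightarrow> 0"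
    using assms unfolding has_H1_gradient_def by blast
  have G: "G \<in> L2_sphere"
    using assms by (simp add: has_H1_gradient_def)
  have C1: "C1_sphere (f n)" for n
    by (rule smooth_on_S2_C1_sphere(1)[OF fg])
  have "(\<lambda>n. (Lnorm 2 (\<lambda>x. f n x - \<phi> x))\<^sup>2) \<longlonglongrightarrow> 0\<^sup>2"
    by (intro tendsto_power lim)
  then have 1: "(\<lambda>n. ip (\<lambda>x. f n x - \<phi> x) (\<lambda>x. f n x - \<phi> x)) \<longlonglongrightarrow> 0"
    by (simp add: Lnorm_2_ip ip_nonneg)
  have "(\<lambda>n. (Lnorm 2 (\<lambda>x. g n x - G x))\<^sup>2) \<longlonglongrightarrow> 0\<^sup>2"
    by (intro tendsto_power lim)
  then have 2: "(\<lambda>n. \<integral>x. (norm (g n x - G x))\<^sup>2 \<partial>sphere_measure) \<longlonglongrightarrow> 0"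
    by (simp add: Lnorm_2)
  have gL2: "g n \<in> L2_sphere" for n
    by (rule continuous_L2_sphere[OF continuous_on_surface_gradient[OF fg]])
  have "(\<lambda>n. ip (\<lambda>x. rot_deriv k (f n) x - tangential k G x) (\<lambda>x. rot_deriv k (f n) x - tangential k G x)) \<longlonglongrightarrow> 0" for k
  proof (rule tendsto_sandwich[where f="\<lambda>_. 0", OF _ _ _ 2])
    have "ip (\<lambda>x. rot_deriv k (f n) x - tangential k G x) (\<lambda>x. rot_deriv k (f n) x - tangential k G x)
        \<le> (\<integral>x. (norm (g n x - G x))\<^sup>2 \<partial>sphere_measure)" for n
      unfolding ip_def
    proof (rule integral_mono)
      show "integrable sphere_measure (\<lambda>x. (rot_deriv k (f n) x - tangential k G x) * (rot_deriv k (f n) x - tangential k G x))"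
        by (intro integrable_L2_mult L2_sphere_diff tangential_L2 G continuous_L2_sphere C1_sphereD(2) C1)
      show "integrable sphere_measure (\<lambda>x. (norm (g n x - G x))\<^sup>2)"
        using L2_sphere_diff_vector[OF gL2 G] by (simp add: L2_sphere_def)
      fix x assume "x \<in> space sphere_measure"
      then have x: "x \<in> S2" by (simp add: space_sphere_measure)
      have "rot_deriv k (f n) x - tangential k G x = tangential k (\<lambda>x. g n x - G x) x"
        using smooth_on_S2_C1_sphere(2)[OF fg x] by (simp add: tangential_def inner_diff_left)
      then show "(rot_deriv k (f n) x - tangential k G x) * (rot_deriv k (f n) x - tangential k G x) \<le> (norm (g n x - G x))\<^sup>2"
        using norm_tangential_le[OF x, of k "\<lambda>x. g n x - G x"] by (simp add: power2_eq_square)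
    qed
    then show "\<forall>\<^sub>F n in sequentially. ip (\<lambda>x. rot_deriv k (f n) x - tangential k G x) (\<lambda>x. rot_deriv k (f n) x - tangential k G x)
        \<le> (\<integral>x. (norm (g n x - G x))\<^sup>2 \<partial>sphere_measure)"
      by (intro always_eventually allI)
    show "\<forall>\<^sub>F n in sequentially. 0 \<le> ip (\<lambda>x. rot_deriv k (f n) x - tangential k G x) (\<lambda>x. rot_deriv k (f n) x - tangential k G x)"
      by (intro always_eventually allI ip_nonneg)
  qed (rule tendsto_const)
  with C1 1 show thesis
    by (rule that)
qed

lemma H1_gradient_harmonic:
  assumes "has_H1_gradient \<phi> G"
  shows "(\<Sum>k\<in>UNIV. ip (tangential k G) (rot_deriv k (harmonic j))) = eigenvalue j * ip \<phi> (harmonic j)"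
proof -
  obtain f where C1: "\<And>n. C1_sphere (f n)" 
    and 1: "(\<lambda>n. ip (\<lambda>x. f n x - \<phi> x) (\<lambda>x. f n x - \<phi> x)) \<longlonglongrightarrow> 0"
    and 2: "\<And>k. (\<lambda>n. ip (\<lambda>x. rot_deriv k (f n) x - tangential k G x) (\<lambda>x. rot_deriv k (f n) x - tangential k G x)) \<longlonglongrightarrow> 0"
    using H1_approximation[OF assms] by blast
  have L2: "G \<in> L2_sphere" "\<phi> \<in> L2_sphere"
    using assms by (simp_all add: has_H1_gradient_def)
  have Y: "rot_deriv k (harmonic j) \<in> L2_sphere" for k
    by (intro continuous_L2_sphere C1_sphereD(2) spoly_C1[OF spoly_harmonic_degree])
  have "(\<lambda>n. \<Sum>k\<in>UNIV. ip (rot_deriv k (f n)) (rot_deriv k (harmonic j)))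
      \<longlonglongrightarrow> (\<Sum>k\<in>UNIV. ip (tangential k G) (rot_deriv k (harmonic j)))"
    by (intro tendsto_sum tendsto_ip_left 2 Y tangential_L2 L2 continuous_L2_sphere C1_sphereD(2) C1)
  also have "(\<lambda>n. \<Sum>k\<in>UNIV. ip (rot_deriv k (f n)) (rot_deriv k (harmonic j)))
      = (\<lambda>n. eigenvalue j * ip (f n) (harmonic j))"
    using ip_rot_deriv_harmonic[OF C1] by simp
  finally have "(\<lambda>n. eigenvalue j * ip (f n) (harmonic j))
      \<longlonglongrightarrow> (\<Sum>k\<in>UNIV. ip (tangential k G) (rot_deriv k (harmonic j)))" .
  moreover have "(\<lambda>n. eigenvalue j * ip (f n) (harmonic j)) \<longlonglongrightarrow> eigenvalue j * ip \<phi> (harmonic j)"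
    by (intro tendsto_mult tendsto_const tendsto_ip_left 1 L2 harmonic_L2 continuous_L2_sphere C1_sphereD(1) C1)
  ultimately show ?thesis
    by (rule LIMSEQ_unique)
qed

lemma H1_bessel:
  assumes "has_H1_gradient \<phi> G"
  shows "(\<Sum>j<N. eigenvalue j * (ip \<phi> (harmonic j))\<^sup>2) \<le> (\<integral>x. (norm (G x))\<^sup>2 \<partial>sphere_measure)"
proof -
  have L2: "G \<in> L2_sphere" "\<phi> \<in> L2_sphere"
    using assms by (simp_all add: has_H1_gradient_def)
  define c where "c j = ip \<phi> (harmonic j)" for j
  define S where "S x = (\<Sum>j<N. c j * harmonic j x)" for x
  have Y: "C1_sphere (harmonic j)" for j
    by (rule spoly_C1[OF spoly_harmonic_degree])
  have S: "C1_sphere S" "\<And>x k. x \<in> S2 \<Longrightarrow> rot_deriv k S x = (\<Sum>j<N. c j * rot_deriv k (harmonic j) x)"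
    unfolding S_def[abs_def] using rot_deriv_sum[of harmonic "{..<N}" c] Y by auto
  have YL2: "rot_deriv k (harmonic j) \<in> L2_sphere" and SL2: "rot_deriv k S \<in> L2_sphere" for k j
    by (intro continuous_L2_sphere C1_sphereD(2) Y S)+
  have exp: "ip u (rot_deriv k S) = (\<Sum>j<N. c j * ip u (rot_deriv k (harmonic j)))" if "u \<in> L2_sphere" for u k
  proof -
    have "ip u (rot_deriv k S) = ip u (\<lambda>x. \<Sum>j<N. c j * rot_deriv k (harmonic j) x)"
      by (rule ip_cong) (use S(2) in auto)
    then show ?thesis
      using ip_L2_sum_right[OF that, of "{..<N}" "\<lambda>j. rot_deriv k (harmonic j)" c] YL2 by simp
  qed
  have GS: "(\<Sum>k\<in>UNIV. ip (tangential k G) (rot_deriv k S)) = (\<Sum>j<N. eigenvalue j * (c j)\<^sup>2)"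
  proof -
    have "(\<Sum>k\<in>UNIV. ip (tangential k G) (rot_deriv k S))
        = (\<Sum>j<N. c j * (\<Sum>k\<in>UNIV. ip (tangential k G) (rot_deriv k (harmonic j))))"
      unfolding exp[OF tangential_L2[OF L2(1)]] sum_distrib_left by (rule sum.swap)
    then show ?thesis
      by (simp add: H1_gradient_harmonic[OF assms] c_def power2_eq_square mult_ac)
  qed
  have SS: "(\<Sum>k\<in>UNIV. ip (rot_deriv k S) (rot_deriv k S)) = (\<Sum>j<N. eigenvalue j * (c j)\<^sup>2)"
  proof -
    have "(\<Sum>k\<in>UNIV. ip (rot_deriv k S) (rot_deriv k S))
        = (\<Sum>j<N. c j * (\<Sum>k\<in>UNIV. ip (rot_deriv k S) (rot_deriv k (harmonic j))))"
      unfolding exp[OF SL2] sum_distrib_left by (rule sum.swap)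
    also have "\<dots> = (\<Sum>j<N. c j * (eigenvalue j * ip S (harmonic j)))"
      by (simp only: ip_rot_deriv_harmonic[OF S(1)])
    also have "\<dots> = (\<Sum>j<N. eigenvalue j * (c j)\<^sup>2)"
    proof (rule sum.cong)
      fix j assume "j \<in> {..<N}"
      then have "ip S (harmonic j) = c j * ip (harmonic j) (harmonic j)"
        unfolding S_def[abs_def] by (subst ip_commute) (rule ip_harmonic_sum, simp_all)
      also have "\<dots> = c j"
        unfolding c_def by (rule harmonic_coefficient[OF L2(2)])
      finally show "c j * (eigenvalue j * ip S (harmonic j)) = eigenvalue j * (c j)\<^sup>2"
        by (simp add: power2_eq_square)
    qed simp
    finally show ?thesis .
  qed
  have "0 \<le> (\<Sum>k\<in>UNIV. ip (\<lambda>x. tangential k G x - rot_deriv k S x) (\<lambda>x. tangential k G x - rot_deriv k S x))"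
    by (intro sum_nonneg ip_nonneg)
  also have "\<dots> = (\<Sum>k\<in>UNIV. ip (tangential k G) (tangential k G)) - (\<Sum>j<N. eigenvalue j * (c j)\<^sup>2)"
    by (simp add: ip_L2_diff_square[OF tangential_L2[OF L2(1)] SL2] sum.distrib sum_subtractf
        sum_distrib_left[symmetric] GS SS)
  also have "(\<Sum>k\<in>UNIV. ip (tangential k G) (tangential k G)) = (\<integral>x. (\<Sum>k\<in>UNIV. tangential k G x * tangential k G x) \<partial>sphere_measure)"
    unfolding ip_def
    by (intro Bochner_Integration.integral_sum[symmetric] integrable_L2_mult tangential_L2 L2)
  also have "\<dots> \<le> (\<integral>x. (norm (G x))\<^sup>2 \<partial>sphere_measure)"
  proof (rule integral_mono)
    show "integrable sphere_measure (\<lambda>x. (norm (G x))\<^sup>2)"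
      using L2(1) by (simp add: L2_sphere_def)
    show "integrable sphere_measure (\<lambda>x. \<Sum>k\<in>UNIV. tangential k G x * tangential k G x)"
      by (intro Bochner_Integration.integrable_sum integrable_L2_mult tangential_L2 L2)
    show "(\<Sum>k\<in>UNIV. tangential k G x * tangential k G x) \<le> (norm (G x))\<^sup>2" if "x \<in> space sphere_measure" for x
      using that sum_inner_cross3[of x "G x"] by (simp add: space_sphere_measure tangential_def power2_eq_square)
  qed
  finally show ?thesis
    by (simp add: c_def)
qed

lemma H1_parseval:
  assumes "has_H1_gradient \<phi> G"
  shows "(\<lambda>j. (ip \<phi> (harmonic j))\<^sup>2) sums ip \<phi> \<phi>"
proof (rule parseval)
  obtain f where C1: "\<And>n. C1_sphere (f n)" 
    and 1: "(\<lambda>n. ip (\<lambda>x. f n x - \<phi> x) (\<lambda>x. f n x - \<phi> x)) \<longlonglongrightarrow> 0"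
    by (rule H1_approximation[OF assms]) (rule that)
  fix e :: real assume "0 < e"
  then have "\<forall>\<^sub>F n in sequentially. ip (\<lambda>x. f n x - \<phi> x) (\<lambda>x. f n x - \<phi> x) < e"
    by (rule order_tendstoD(2)[OF 1])
  then obtain n where "ip (\<lambda>x. f n x - \<phi> x) (\<lambda>x. f n x - \<phi> x) < e"
    using eventually_happens'[OF sequentially_bot] by fastforce
  also have "ip (\<lambda>x. f n x - \<phi> x) (\<lambda>x. f n x - \<phi> x) = ip (\<lambda>x. \<phi> x - f n x) (\<lambda>x. \<phi> x - f n x)"
    unfolding ip_def by (rule Bochner_Integration.integral_cong) (simp_all add: algebra_simps)
  finally have "ip (\<lambda>x. \<phi> x - f n x) (\<lambda>x. \<phi> x - f n x) < e" .
  then show "\<exists>g. continuous_on S2 g \<and> ip (\<lambda>x. \<phi> x - g x) (\<lambda>x. \<phi> x - g x) < e"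
    using C1_sphereD(1)[OF C1] by blast
qed (use assms in \<open>simp add: has_H1_gradient_def\<close>)

lemma split_estimate:
  fixes w y z t :: real
  assumes "0 \<le> w" "0 < t"
  shows "w * t / (w + t) * (y + z)\<^sup>2 \<le> w * y\<^sup>2 + t * z\<^sup>2"
proof -
  have "(w + t) * (w * y\<^sup>2 + t * z\<^sup>2) - w * t * (y + z)\<^sup>2 = (w * y - t * z)\<^sup>2"
    by (simp add: power2_eq_square algebra_simps)
  then have "w * t * (y + z)\<^sup>2 \<le> (w + t) * (w * y\<^sup>2 + t * z\<^sup>2)"
    by (metis diff_ge_0_iff_ge zero_le_power2)
  then show ?thesis
    using assms by (simp add: field_simps)
qed

section \<open>Interpolation between the quadratic forms\<close>

definition powr_kernel :: "real \<Rightarrow> ennreal"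
  where "powr_kernel \<theta> = (\<integral>\<^sup>+t. indicator {0<..} t * ennreal (t / (1 + t) * t powr (\<theta> - 2)) \<partial>lborel)"

lemma powr_kernel_scale:
  assumes "0 \<le> w" "0 < \<theta>"
  shows "(\<integral>\<^sup>+t. indicator {0<..} t * ennreal (w * t / (w + t) * t powr (\<theta> - 2)) \<partial>lborel) = ennreal (w powr \<theta>) * powr_kernel \<theta>"
proof (cases "w = 0")
  case True
  then show ?thesis using assms by simp
next
  case False
  then have w: "0 < w" using assms by simp
  have "(\<integral>\<^sup>+t. indicator {0<..} t * ennreal (w * t / (w + t) * t powr (\<theta> - 2)) \<partial>lborel)
    = ennreal \<bar>w\<bar> * (\<integral>\<^sup>+t. indicator {0<..} (0 + w * t) * ennreal (w * (0 + w * t) / (w + (0 + w * t)) * (0 + w * t) powr (\<theta> - 2)) \<partial>lborel)"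
    using w by (intro nn_integral_real_affine) auto
  also have "\<dots> = ennreal w * (\<integral>\<^sup>+t. ennreal (w powr (\<theta> - 1)) * (indicator {0<..} t * ennreal (t / (1 + t) * t powr (\<theta> - 2))) \<partial>lborel)"
  proof -
    have "indicator {0<..} (0 + w * t) * ennreal (w * (0 + w * t) / (w + (0 + w * t)) * (0 + w * t) powr (\<theta> - 2))
      = ennreal (w powr (\<theta> - 1)) * (indicator {0<..} t * ennreal (t / (1 + t) * t powr (\<theta> - 2)))" for t
    proof (cases "0 < t")
      case True
      have "w * (0 + w * t) / (w + (0 + w * t)) = w * (t / (1 + t))"
      proof -
        have "w + (0 + w * t) = w * (1 + t)" by (simp add: algebra_simps)
        then show ?thesis using w by simp
      qed
      moreover have "w powr (\<theta> - 1) = w * w powr (\<theta> - 2)"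
        using w powr_add[of w 1 "\<theta> - 2"] by simp
      ultimately have "w * (0 + w * t) / (w + (0 + w * t)) * (0 + w * t) powr (\<theta> - 2)
          = w powr (\<theta> - 1) * (t / (1 + t) * t powr (\<theta> - 2))"
        using w True by (simp add: powr_mult)
      then show ?thesis
        using w True by (simp add: ennreal_mult[symmetric] zero_less_mult_iff)
    next
      case False
      then show ?thesis
        using w by (simp add: indicator_def zero_less_mult_iff)
    qed
    then show ?thesis using w by simp
  qed
  also have "\<dots> = ennreal w * (ennreal (w powr (\<theta> - 1)) * powr_kernel \<theta>)"
    unfolding powr_kernel_def by (subst nn_integral_cmult) auto
  also have "\<dots> = ennreal (w powr \<theta>) * powr_kernel \<theta>"
    using w powr_add[of w 1 "\<theta> - 1"] by (simp add: mult.assoc[symmetric] ennreal_mult[symmetric])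
  finally show ?thesis .
qed

lemma powr_kernel_finite:
  assumes "0 < \<theta>" "\<theta> < 1"
  shows "powr_kernel \<theta> \<noteq> \<infinity>"
proof -
  have 1: "((\<lambda>t. t powr (\<theta> - 1)) has_integral (1 powr (\<theta> - 1 + 1) / (\<theta> - 1 + 1))) {0..1}"
    by (rule has_integral_powr_from_0) (use assms in auto)
  have 2: "((\<lambda>t. t powr (\<theta> - 2)) has_integral (- (1 powr (\<theta> - 2 + 1)) / (\<theta> - 2 + 1))) {1..}"
    by (rule has_integral_powr_to_inf) (use assms in auto)
  have "powr_kernel \<theta> \<le> (\<integral>\<^sup>+t. ennreal (indicator {0..1} t * t powr (\<theta> - 1)) + ennreal (indicator {1..} t * t powr (\<theta> - 2)) \<partial>lborel)"
    unfolding powr_kernel_def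
  proof (rule nn_integral_mono)
    fix t :: real
    show "indicator {0<..} t * ennreal (t / (1 + t) * t powr (\<theta> - 2))
        \<le> ennreal (indicator {0..1} t * t powr (\<theta> - 1)) + ennreal (indicator {1..} t * t powr (\<theta> - 2))"
    proof (cases "0 < t")
      case t: True
      have "t / (1 + t) * t powr (\<theta> - 2) \<le> 1 * t powr (\<theta> - 2)"
        using t by (intro mult_right_mono) auto
      moreover have "t / (1 + t) * t powr (\<theta> - 2) \<le> t powr (\<theta> - 1)"
      proof -
        have "t / (1 + t) * t powr (\<theta> - 2) \<le> t * t powr (\<theta> - 2)"
          using t by (intro mult_right_mono) (auto simp: field_simps)
        also have "\<dots> = t powr (\<theta> - 1)"
          using t powr_add[of t 1 "\<theta> - 2"] by simp
        finally show ?thesis .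
      qed
      ultimately show ?thesis
        using t by (cases "t \<le> 1") (auto simp: indicator_def ennreal_plus[symmetric] simp del: ennreal_plus intro!: ennreal_leI)
    qed simp
  qed
  also have "\<dots> = (\<integral>\<^sup>+t. ennreal (indicator {0..1} t * t powr (\<theta> - 1)) \<partial>lborel) + (\<integral>\<^sup>+t. ennreal (indicator {1..} t * t powr (\<theta> - 2)) \<partial>lborel)"
    by (rule nn_integral_add) auto
  also have "\<dots> < \<infinity>"
    using nn_integral_has_integral_lebesgue[OF _ 1] nn_integral_has_integral_lebesgue[OF _ 2]
    by (simp add: ennreal_mult'' less_top[symmetric])
  finally show ?thesis by simp
qed

lemma powr_kernel_pos:
  assumes "0 < \<theta>" "\<theta> < 1"
  shows "powr_kernel \<theta> \<noteq> 0"
proof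
  assume "powr_kernel \<theta> = 0"
  then have "AE t in lborel. indicator {0<..} t * ennreal (t / (1 + t) * t powr (\<theta> - 2)) = 0"
    unfolding powr_kernel_def by (subst (asm) nn_integral_0_iff_AE) auto
  then have "AE t in lborel. t \<notin> {0<..<1::real}"
  proof (rule AE_mp, intro AE_I2 impI notI)
    fix t :: real assume 0: "indicator {0<..} t * ennreal (t / (1 + t) * t powr (\<theta> - 2)) = 0" and t: "t \<in> {0<..<1}"
    have "0 < t / (1 + t) * t powr (\<theta> - 2)"
      using t by simp
    then show False
      using 0 t by (simp add: ennreal_eq_0_iff)
  qed
  then have "emeasure lborel {0<..<1::real} = 0"
    by (subst (asm) AE_iff_measurable[of "{0<..<1}"]) auto
  then show False by simp
qed

lemma nn_integral_sphere_swap: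
  fixes h :: "real \<Rightarrow> real^3 \<Rightarrow> ennreal"
  assumes "(\<lambda>(x, t). h t x) \<in> borel_measurable (sphere_measure \<Otimes>\<^sub>M lborel)"
  shows "(\<integral>\<^sup>+x. (\<integral>\<^sup>+t. h t x \<partial>lborel) \<partial>sphere_measure) = (\<integral>\<^sup>+t. (\<integral>\<^sup>+x. h t x \<partial>sphere_measure) \<partial>lborel)"
proof -
  interpret pair_sigma_finite sphere_measure lborel
    by unfold_locales
  show ?thesis
    using Fubini'[of "\<lambda>x t. h t x"] assms by simp
qed

locale H1_interpolation =
  fixes \<phi> :: "real^3 \<Rightarrow> real" and G :: "real^3 \<Rightarrow> real^3" and W :: "real^3 \<Rightarrow> real" and a s B :: real
  assumes H1: "has_H1_gradient \<phi> G"
    and mean: "(\<integral>x. \<phi> x \<partial>sphere_measure) = 0"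
    and W_measurable [measurable]: "W \<in> borel_measurable sphere_measure"
    and W_bounds: "\<And>x. x \<in> S2 \<Longrightarrow> 0 \<le> W x" "\<And>x. x \<in> S2 \<Longrightarrow> W x \<le> B"
    and s: "1 < s" and a: "0 < a"
begin

definition "D = a powr (1 - s) / (4 * pi * (s - 1))"
definition "X = (\<integral>x. W x \<partial>sphere_measure)"
definition "c j = ip \<phi> (harmonic j)"
definition "A j = a + eigenvalue j"
definition "\<kappa> j = D * X * A j powr s"

lemma L2: "\<phi> \<in> L2_sphere" "G \<in> L2_sphere"
  using H1 by (simp_all add: has_H1_gradient_def)

lemma phi_measurable [measurable]: "\<phi> \<in> borel_measurable sphere_measure"
  using L2 by (simp add: L2_sphere_def)

lemma c_0: "c 0 = 0"
proof -
  obtain b where b: "\<And>x. x \<in> S2 \<Longrightarrow> harmonic 0 x = b"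
    using harmonic_0_const by blast
  have "c 0 = ip (\<lambda>x. b) \<phi>"
    unfolding c_def by (subst ip_commute) (rule ip_cong, use b in auto)
  also have "\<dots> = b * (\<integral>x. \<phi> x \<partial>sphere_measure)"
    by (simp add: ip_def)
  finally show ?thesis by (simp add: mean)
qed

lemma A_pos: "0 < A j"
  using a by (simp add: A_def eigenvalue_def add_pos_nonneg)

lemma D_pos: "0 < D"
  using s a by (simp add: D_def)

lemma X_nonneg: "0 \<le> X"
  unfolding X_def using W_bounds by (intro integral_nonneg_AE AE_I2) (simp add: space_sphere_measure)

lemma kappa_nonneg: "0 \<le> \<kappa> j"
  using D_pos X_nonneg by (simp add: \<kappa>_def)

lemma W_integrable: "integrable sphere_measure W"
  by (rule sphere.integrable_const_bound[where B=B])
    (use W_bounds in \<open>auto simp: space_sphere_measure intro!: AE_I2\<close>)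

lemma harmonic_sum_square_le:
  assumes "x \<in> S2"
  shows "(\<Sum>j\<in>{1..<N}. b j * harmonic j x)\<^sup>2 \<le> D * (\<Sum>j\<in>{1..<N}. A j powr s * (b j)\<^sup>2)"
proof -
  have 1: "(A j powr (s / 2) * b j) * (A j powr (- s / 2) * harmonic j x) = b j * harmonic j x" for j
    using A_pos[of j] powr_add[of "A j" "s / 2" "- s / 2"] by (simp add: mult_ac)
  have 2: "(A j powr (s / 2) * b j)\<^sup>2 = A j powr s * (b j)\<^sup>2" for j
    using A_pos[of j] by (simp add: power_mult_distrib powr_power)
  have 3: "(A j powr (- s / 2) * harmonic j x)\<^sup>2 = (harmonic j x)\<^sup>2 * (a + eigenvalue j) powr (- s)" for j
    using A_pos[of j] by (simp add: power_mult_distrib powr_power A_def)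
  have "(\<Sum>j\<in>{1..<N}. b j * harmonic j x)\<^sup>2
      \<le> (\<Sum>j\<in>{1..<N}. A j powr s * (b j)\<^sup>2) * (\<Sum>j\<in>{1..<N}. (harmonic j x)\<^sup>2 * (a + eigenvalue j) powr (- s))"
    using Cauchy_Schwarz_ineq_sum[of "\<lambda>j. A j powr (s / 2) * b j" "\<lambda>j. A j powr (- s / 2) * harmonic j x" "{1..<N}"]
    by (simp only: 1 2 3)
  also have "\<dots> \<le> (\<Sum>j\<in>{1..<N}. A j powr s * (b j)\<^sup>2) * D"
    unfolding D_def by (intro mult_left_mono sum_harmonic_powr s a assms sum_nonneg) auto
  finally show ?thesis
    by (simp add: mult.commute)
qed

definition "wt t x = W x * t / (W x + t)"

lemma wt_bounds: "x \<in> S2 \<Longrightarrow> 0 < t \<Longrightarrow> 0 \<le> wt t x \<and> wt t x \<le> t"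
  using W_bounds(1)[of x] by (simp add: wt_def field_simps)

lemma wt_measurable [measurable]: "wt t \<in> borel_measurable sphere_measure"
  unfolding wt_def[abs_def] by measurable

lemma phi_square_integrable: "integrable sphere_measure (\<lambda>x. (\<phi> x)\<^sup>2)"
  using L2 by (simp add: L2_sphere_def)

lemma wt_phi_integrable:
  assumes "0 < t"
  shows "integrable sphere_measure (\<lambda>x. wt t x * (\<phi> x)\<^sup>2)"
proof (rule Bochner_Integration.integrable_bound)
  show "integrable sphere_measure (\<lambda>x. t * (\<phi> x)\<^sup>2)"
    using phi_square_integrable by simp
  show "AE x in sphere_measure. norm (wt t x * (\<phi> x)\<^sup>2) \<le> norm (t * (\<phi> x)\<^sup>2)"
    using wt_bounds[OF _ assms] assms
    by (intro AE_I2) (auto simp: space_sphere_measure abs_mult intro!: mult_right_mono)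
qed measurable

text \<open>The split \<open>\<phi> = y + (\<phi> - y)\<close> with \<open>y = \<Sum> t / (\<kappa>\<^sub>j + t) c\<^sub>j Y\<^sub>j\<close> is the minimiser of
  \<open>\<Sum> \<kappa>\<^sub>j \<langle>y, Y\<^sub>j\<rangle>\<^sup>2 + t \<parallel>\<phi> - y\<parallel>\<^sup>2\<close>.\<close>

lemma wt_estimate_finite:
  assumes t: "0 < t"
  shows "(\<integral>x. wt t x * (\<phi> x)\<^sup>2 \<partial>sphere_measure)
    \<le> t * (ip \<phi> \<phi> - (\<Sum>j<N. (c j)\<^sup>2)) + (\<Sum>j<N. \<kappa> j * t / (\<kappa> j + t) * (c j)\<^sup>2)"
proof -
  define \<tau> where "\<tau> j = t / (\<kappa> j + t)" for j
  define b where "b j = \<tau> j * c j" for j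
  define y where "y x = (\<Sum>j\<in>{1..<N}. b j * harmonic j x)" for x
  have y: "continuous_on S2 y"
    unfolding y_def[abs_def] by (rule harmonic_sum_continuous)
  note yL2 = continuous_L2_sphere[OF y]
  have [measurable]: "y \<in> borel_measurable sphere_measure"
    by (rule borel_measurable_sphere_measure[OF y])
  let ?b = "D * (\<Sum>j\<in>{1..<N}. A j powr s * (b j)\<^sup>2)"
  have Wy: "integrable sphere_measure (\<lambda>x. W x * (y x)\<^sup>2)"
  proof (rule Bochner_Integration.integrable_bound)
    show "integrable sphere_measure (\<lambda>x. W x * ?b)"
      using W_integrable by simp
    show "AE x in sphere_measure. norm (W x * (y x)\<^sup>2) \<le> norm (W x * ?b)"
    proof (rule AE_I2)
      fix x assume "x \<in> space sphere_measure"
      then have x: "x \<in> S2" by (simp add: space_sphere_measure)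
      have le: "(y x)\<^sup>2 \<le> ?b"
        unfolding y_def by (rule harmonic_sum_square_le[OF x])
      have "0 \<le> W x * (y x)\<^sup>2" "W x * (y x)\<^sup>2 \<le> W x * ?b"
        using W_bounds(1)[OF x] mult_left_mono[OF le] by simp_all
      then show "norm (W x * (y x)\<^sup>2) \<le> norm (W x * ?b)"
        unfolding real_norm_def by linarith
    qed
  qed measurable
  have "(\<integral>x. wt t x * (\<phi> x)\<^sup>2 \<partial>sphere_measure) \<le> (\<integral>x. W x * (y x)\<^sup>2 + t * ((\<phi> x - y x) * (\<phi> x - y x)) \<partial>sphere_measure)"
  proof (rule integral_mono[OF wt_phi_integrable[OF t]])
    show "integrable sphere_measure (\<lambda>x. W x * (y x)\<^sup>2 + t * ((\<phi> x - y x) * (\<phi> x - y x)))"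
      by (intro Bochner_Integration.integrable_add Wy integrable_mult_right integrable_L2_mult L2_sphere_diff L2 yL2)
    fix x assume "x \<in> space sphere_measure"
    then show "wt t x * (\<phi> x)\<^sup>2 \<le> W x * (y x)\<^sup>2 + t * ((\<phi> x - y x) * (\<phi> x - y x))"
      using split_estimate[OF W_bounds(1) t, of x "y x" "\<phi> x - y x"]
      by (simp add: wt_def space_sphere_measure power2_eq_square)
  qed
  also have "\<dots> = (\<integral>x. W x * (y x)\<^sup>2 \<partial>sphere_measure) + t * ip (\<lambda>x. \<phi> x - y x) (\<lambda>x. \<phi> x - y x)"
    unfolding ip_def using Wy integrable_L2_mult[OF L2_sphere_diff L2_sphere_diff, OF L2(1) yL2 L2(1) yL2] by simp
  also have "(\<integral>x. W x * (y x)\<^sup>2 \<partial>sphere_measure) \<le> (\<integral>x. W x * ?b \<partial>sphere_measure)"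
  proof (rule integral_mono[OF Wy])
    show "integrable sphere_measure (\<lambda>x. W x * ?b)"
      using W_integrable by simp
    show "W x * (y x)\<^sup>2 \<le> W x * ?b" if "x \<in> space sphere_measure" for x
      using that unfolding y_def
      by (intro mult_left_mono harmonic_sum_square_le W_bounds) (simp_all add: space_sphere_measure)
  qed
  also have "(\<integral>x. W x * ?b \<partial>sphere_measure) = (\<Sum>j\<in>{1..<N}. \<kappa> j * (b j)\<^sup>2)"
  proof -
    have "(\<integral>x. W x * ?b \<partial>sphere_measure) = X * ?b"
      unfolding X_def by (rule integral_mult_left_zero)
    then show ?thesis
      by (simp add: \<kappa>_def sum_distrib_left mult_ac)
  qed
  also have "ip (\<lambda>x. \<phi> x - y x) (\<lambda>x. \<phi> x - y x) =
      ip \<phi> \<phi> - 2 * (\<Sum>j\<in>{1..<N}. b j * c j) + (\<Sum>j\<in>{1..<N}. (b j)\<^sup>2)"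
  proof -
    have "(\<Sum>j\<in>{1..<N}. (b j)\<^sup>2 * ip (harmonic j) (harmonic j)) = (\<Sum>j\<in>{1..<N}. (b j)\<^sup>2)"
    proof (intro sum.cong refl)
      show "(b j)\<^sup>2 * ip (harmonic j) (harmonic j) = (b j)\<^sup>2" for j
        using harmonic_coefficient[OF L2(1), of j] by (auto simp: b_def c_def power2_eq_square)
    qed
    then show ?thesis
      unfolding y_def c_def using ip_diff_harmonic_sum[OF L2(1), of "{1..<N}" b] by simp
  qed
  also have "(\<Sum>j\<in>{1..<N}. \<kappa> j * (b j)\<^sup>2) + t * (ip \<phi> \<phi> - 2 * (\<Sum>j\<in>{1..<N}. b j * c j) + (\<Sum>j\<in>{1..<N}. (b j)\<^sup>2))
      = t * ip \<phi> \<phi> + (\<Sum>j\<in>{1..<N}. \<kappa> j * (b j)\<^sup>2 - 2 * t * (b j * c j) + t * (b j)\<^sup>2)"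
    by (simp add: sum.distrib sum_subtractf sum_distrib_left algebra_simps)
  also have "(\<Sum>j\<in>{1..<N}. \<kappa> j * (b j)\<^sup>2 - 2 * t * (b j * c j) + t * (b j)\<^sup>2)
      = (\<Sum>j\<in>{1..<N}. \<kappa> j * t / (\<kappa> j + t) * (c j)\<^sup>2 - t * (c j)\<^sup>2)"
  proof (rule sum.cong)
    fix j
    have pos: "0 < \<kappa> j + t" using kappa_nonneg[of j] t by simp
    then have \<tau>: "\<tau> j * (\<kappa> j + t) = t"
      by (simp add: \<tau>_def)
    have "\<kappa> j * (b j)\<^sup>2 - 2 * t * (b j * c j) + t * (b j)\<^sup>2 = (\<tau> j * (\<tau> j * (\<kappa> j + t)) - 2 * t * \<tau> j) * (c j)\<^sup>2"
      by (simp add: b_def power2_eq_square algebra_simps)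
    also have "\<dots> = (\<kappa> j * t / (\<kappa> j + t) - t) * (c j)\<^sup>2"
    proof -
      have "\<kappa> j * t / (\<kappa> j + t) - t = - (t * \<tau> j)"
        using pos by (simp add: \<tau>_def field_simps)
      then show ?thesis by (simp add: \<tau>)
    qed
    finally show "\<kappa> j * (b j)\<^sup>2 - 2 * t * (b j * c j) + t * (b j)\<^sup>2 = \<kappa> j * t / (\<kappa> j + t) * (c j)\<^sup>2 - t * (c j)\<^sup>2"
      by (simp add: left_diff_distrib)
  qed simp
  also have "\<dots> = (\<Sum>j<N. \<kappa> j * t / (\<kappa> j + t) * (c j)\<^sup>2 - t * (c j)\<^sup>2)"
    by (rule sum.mono_neutral_left) (auto simp: c_0 not_less_eq_eq dest!: le_0_eq[THEN iffD1])
  finally show ?thesis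
    by (simp add: sum_subtractf sum_distrib_left right_diff_distrib)
qed

lemma wt_estimate:
  assumes t: "0 < t"
  shows "summable (\<lambda>j. \<kappa> j * t / (\<kappa> j + t) * (c j)\<^sup>2)"
    and "(\<integral>x. wt t x * (\<phi> x)\<^sup>2 \<partial>sphere_measure) \<le> (\<Sum>j. \<kappa> j * t / (\<kappa> j + t) * (c j)\<^sup>2)"
proof -
  have sums: "(\<lambda>j. (c j)\<^sup>2) sums ip \<phi> \<phi>"
    unfolding c_def by (rule H1_parseval[OF H1])
  show summ: "summable (\<lambda>j. \<kappa> j * t / (\<kappa> j + t) * (c j)\<^sup>2)"
  proof (rule summable_comparison_test')
    show "summable (\<lambda>j. t * (c j)\<^sup>2)"
      using sums by (intro summable_mult sums_summable)
    fix j
    have le: "\<kappa> j * t / (\<kappa> j + t) \<le> t" "0 \<le> \<kappa> j * t / (\<kappa> j + t)"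
      using kappa_nonneg[of j] t by (simp_all add: field_simps)
    show "norm (\<kappa> j * t / (\<kappa> j + t) * (c j)\<^sup>2) \<le> t * (c j)\<^sup>2"
      using mult_nonneg_nonneg[OF le(2) zero_le_power2[of "c j"]] mult_right_mono[OF le(1) zero_le_power2[of "c j"]]
      unfolding real_norm_def by linarith
  qed
  have "(\<lambda>N. t * (ip \<phi> \<phi> - (\<Sum>j<N. (c j)\<^sup>2)) + (\<Sum>j<N. \<kappa> j * t / (\<kappa> j + t) * (c j)\<^sup>2))
      \<longlonglongrightarrow> t * (ip \<phi> \<phi> - ip \<phi> \<phi>) + (\<Sum>j. \<kappa> j * t / (\<kappa> j + t) * (c j)\<^sup>2)"
    using sums summable_LIMSEQ[OF summ] by (intro tendsto_intros) (auto simp: sums_def)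
  from LIMSEQ_le_const[OF this] show
    "(\<integral>x. wt t x * (\<phi> x)\<^sup>2 \<partial>sphere_measure) \<le> (\<Sum>j. \<kappa> j * t / (\<kappa> j + t) * (c j)\<^sup>2)"
    using wt_estimate_finite[OF t] by auto
qed

definition "E = a * ip \<phi> \<phi> + (\<integral>x. (norm (G x))\<^sup>2 \<partial>sphere_measure)"

lemma sum_A_le: "(\<Sum>j<N. A j * (c j)\<^sup>2) \<le> E"
proof -
  have "(\<Sum>j<N. A j * (c j)\<^sup>2) = a * (\<Sum>j<N. (c j)\<^sup>2) + (\<Sum>j<N. eigenvalue j * (c j)\<^sup>2)"
    by (simp add: A_def distrib_right sum.distrib sum_distrib_left)
  also have "\<dots> \<le> E"
    unfolding E_def c_def using a
    by (intro add_mono mult_left_mono bessel L2 H1_bessel[OF H1]) auto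
  finally show ?thesis .
qed

lemma E_nonneg: "0 \<le> E"
  using sum_A_le[of 0] by simp

text \<open>Integrate over \<open>t\<close> against \<open>t powr (1 / s - 2)\<close>, which turns \<open>w t / (w + t)\<close> into a multiple
  of \<open>w powr (1 / s)\<close> on both sides.\<close>

lemma weighted_estimate:
  "(\<integral>x. W x powr (1 / s) * (\<phi> x)\<^sup>2 \<partial>sphere_measure) \<le> (D * X) powr (1 / s) * E"
proof -
  define \<theta> where "\<theta> = 1 / s"
  have \<theta>: "0 < \<theta>" "\<theta> < 1" using s by (auto simp: \<theta>_def)
  define K where "K = powr_kernel \<theta>"
  have K: "K \<noteq> 0" "K \<noteq> \<infinity>"
    unfolding K_def using powr_kernel_pos powr_kernel_finite \<theta> by auto
  define h where "h t x = indicator {0<..} t * ennreal (wt t x * t powr (\<theta> - 2)) * ennreal ((\<phi> x)\<^sup>2)" for t x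
  have h_meas: "(\<lambda>(x, t). h t x) \<in> borel_measurable (sphere_measure \<Otimes>\<^sub>M lborel)"
    unfolding h_def wt_def by measurable
  have Wint: "integrable sphere_measure (\<lambda>x. W x powr \<theta> * (\<phi> x)\<^sup>2)"
  proof (rule Bochner_Integration.integrable_bound)
    show "integrable sphere_measure (\<lambda>x. B powr \<theta> * (\<phi> x)\<^sup>2)"
      using phi_square_integrable by simp
    show "AE x in sphere_measure. norm (W x powr \<theta> * (\<phi> x)\<^sup>2) \<le> norm (B powr \<theta> * (\<phi> x)\<^sup>2)"
      using W_bounds \<theta> by (intro AE_I2) (auto simp: space_sphere_measure abs_mult intro!: mult_right_mono powr_mono2)
  qed measurable
  have "K * ennreal (\<integral>x. W x powr \<theta> * (\<phi> x)\<^sup>2 \<partial>sphere_measure) = K * (\<integral>\<^sup>+x. ennreal (W x powr \<theta> * (\<phi> x)\<^sup>2) \<partial>sphere_measure)"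
    by (subst nn_integral_eq_integral[OF Wint]) auto
  also have "\<dots> = (\<integral>\<^sup>+x. K * ennreal (W x powr \<theta> * (\<phi> x)\<^sup>2) \<partial>sphere_measure)"
    by (rule nn_integral_cmult[symmetric]) measurable
  also have "\<dots> = (\<integral>\<^sup>+x. (\<integral>\<^sup>+t. h t x \<partial>lborel) \<partial>sphere_measure)"
  proof (rule nn_integral_cong)
    fix x assume "x \<in> space sphere_measure"
    then have x: "x \<in> S2" by (simp add: space_sphere_measure)
    have "(\<integral>\<^sup>+t. h t x \<partial>lborel) = (\<integral>\<^sup>+t. indicator {0<..} t * ennreal (W x * t / (W x + t) * t powr (\<theta> - 2)) \<partial>lborel) * ennreal ((\<phi> x)\<^sup>2)"
      unfolding h_def wt_def by (rule nn_integral_multc) measurable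
    also have "\<dots> = ennreal (W x powr \<theta>) * K * ennreal ((\<phi> x)\<^sup>2)"
      by (simp only: powr_kernel_scale[OF W_bounds(1)[OF x] \<theta>(1)] K_def)
    finally show "K * ennreal (W x powr \<theta> * (\<phi> x)\<^sup>2) = (\<integral>\<^sup>+t. h t x \<partial>lborel)"
      by (simp add: ennreal_mult mult_ac)
  qed
  also have "\<dots> = (\<integral>\<^sup>+t. (\<integral>\<^sup>+x. h t x \<partial>sphere_measure) \<partial>lborel)"
    by (rule nn_integral_sphere_swap[OF h_meas])
  also have "\<dots> \<le> (\<integral>\<^sup>+t. (\<Sum>j. indicator {0<..} t * ennreal (\<kappa> j * t / (\<kappa> j + t) * t powr (\<theta> - 2)) * ennreal ((c j)\<^sup>2)) \<partial>lborel)"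
  proof (rule nn_integral_mono)
    fix t :: real
    show "(\<integral>\<^sup>+x. h t x \<partial>sphere_measure)
      \<le> (\<Sum>j. indicator {0<..} t * ennreal (\<kappa> j * t / (\<kappa> j + t) * t powr (\<theta> - 2)) * ennreal ((c j)\<^sup>2))"
    proof (cases "0 < t")
      case t: True
      have "(\<integral>\<^sup>+x. h t x \<partial>sphere_measure) = (\<integral>\<^sup>+x. ennreal (t powr (\<theta> - 2)) * ennreal (wt t x * (\<phi> x)\<^sup>2) \<partial>sphere_measure)"
      proof (rule nn_integral_cong)
        fix x assume "x \<in> space sphere_measure"
        then have "0 \<le> wt t x" using wt_bounds t by (simp add: space_sphere_measure)
        then show "h t x = ennreal (t powr (\<theta> - 2)) * ennreal (wt t x * (\<phi> x)\<^sup>2)"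
          using t by (simp add: h_def ennreal_mult mult_ac)
      qed
      also have "\<dots> = ennreal (t powr (\<theta> - 2)) * (\<integral>\<^sup>+x. ennreal (wt t x * (\<phi> x)\<^sup>2) \<partial>sphere_measure)"
        by (rule nn_integral_cmult) measurable
      also have "(\<integral>\<^sup>+x. ennreal (wt t x * (\<phi> x)\<^sup>2) \<partial>sphere_measure) = ennreal (\<integral>x. wt t x * (\<phi> x)\<^sup>2 \<partial>sphere_measure)"
        using wt_bounds[OF _ t]
        by (intro nn_integral_eq_integral wt_phi_integrable t AE_I2) (simp add: space_sphere_measure)
      also have "\<dots> \<le> ennreal (\<Sum>j. \<kappa> j * t / (\<kappa> j + t) * (c j)\<^sup>2)"
        by (intro ennreal_leI wt_estimate t)
      also have "\<dots> = (\<Sum>j. ennreal (\<kappa> j * t / (\<kappa> j + t) * (c j)\<^sup>2))"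
        using kappa_nonneg t by (intro suminf_ennreal2[symmetric] wt_estimate t) simp
      also have "ennreal (t powr (\<theta> - 2)) * \<dots> = (\<Sum>j. ennreal (t powr (\<theta> - 2)) * ennreal (\<kappa> j * t / (\<kappa> j + t) * (c j)\<^sup>2))"
        by (rule ennreal_suminf_cmult[symmetric])
      also have "\<dots> = (\<Sum>j. indicator {0<..} t * ennreal (\<kappa> j * t / (\<kappa> j + t) * t powr (\<theta> - 2)) * ennreal ((c j)\<^sup>2))"
      proof (rule suminf_cong)
        fix j
        have "0 \<le> \<kappa> j * t / (\<kappa> j + t)" using kappa_nonneg[of j] t by simp
        then show "ennreal (t powr (\<theta> - 2)) * ennreal (\<kappa> j * t / (\<kappa> j + t) * (c j)\<^sup>2)
          = indicator {0<..} t * ennreal (\<kappa> j * t / (\<kappa> j + t) * t powr (\<theta> - 2)) * ennreal ((c j)\<^sup>2)"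
          using t by (simp add: ennreal_mult mult_ac del: times_divide_eq_right times_divide_eq_left)
      qed
      finally show ?thesis
        by (simp add: mult_left_mono)
    qed (simp add: h_def)
  qed
  also have "\<dots> = (\<Sum>j. \<integral>\<^sup>+t. indicator {0<..} t * ennreal (\<kappa> j * t / (\<kappa> j + t) * t powr (\<theta> - 2)) * ennreal ((c j)\<^sup>2) \<partial>lborel)"
    by (rule nn_integral_suminf) measurable
  also have "\<dots> = (\<Sum>j. K * ennreal ((D * X) powr \<theta> * (A j * (c j)\<^sup>2)))"
  proof (rule suminf_cong)
    fix j
    have "(\<integral>\<^sup>+t. indicator {0<..} t * ennreal (\<kappa> j * t / (\<kappa> j + t) * t powr (\<theta> - 2)) * ennreal ((c j)\<^sup>2) \<partial>lborel)
      = (\<integral>\<^sup>+t. indicator {0<..} t * ennreal (\<kappa> j * t / (\<kappa> j + t) * t powr (\<theta> - 2)) \<partial>lborel) * ennreal ((c j)\<^sup>2)"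
      by (rule nn_integral_multc) measurable
    also have "\<dots> = ennreal (\<kappa> j powr \<theta>) * K * ennreal ((c j)\<^sup>2)"
      by (simp only: powr_kernel_scale[OF kappa_nonneg \<theta>(1)] K_def)
    also have "\<kappa> j powr \<theta> = (D * X) powr \<theta> * A j"
      using D_pos X_nonneg A_pos[of j] s by (simp add: \<kappa>_def powr_mult powr_powr \<theta>_def)
    finally show "(\<integral>\<^sup>+t. indicator {0<..} t * ennreal (\<kappa> j * t / (\<kappa> j + t) * t powr (\<theta> - 2)) * ennreal ((c j)\<^sup>2) \<partial>lborel)
      = K * ennreal ((D * X) powr \<theta> * (A j * (c j)\<^sup>2))"
      using A_pos[of j] by (simp add: ennreal_mult mult_ac)
  qed
  also have "\<dots> = K * (\<Sum>j. ennreal ((D * X) powr \<theta> * (A j * (c j)\<^sup>2)))"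
    by (rule ennreal_suminf_cmult)
  also have "\<dots> \<le> K * ennreal ((D * X) powr \<theta> * E)"
  proof (intro mult_left_mono suminf_le_const summableI)
    fix N
    have "(\<Sum>j<N. ennreal ((D * X) powr \<theta> * (A j * (c j)\<^sup>2))) = ennreal ((D * X) powr \<theta> * (\<Sum>j<N. A j * (c j)\<^sup>2))"
      unfolding sum_distrib_left using A_pos by (intro sum_ennreal) (simp add: less_imp_le)
    also have "\<dots> \<le> ennreal ((D * X) powr \<theta> * E)"
      by (intro ennreal_leI mult_left_mono sum_A_le) simp
    finally show "(\<Sum>j<N. ennreal ((D * X) powr \<theta> * (A j * (c j)\<^sup>2))) \<le> ennreal ((D * X) powr \<theta> * E)" .
  qed simp
  finally have "ennreal (\<integral>x. W x powr \<theta> * (\<phi> x)\<^sup>2 \<partial>sphere_measure) \<le> ennreal ((D * X) powr \<theta> * E)"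
    using K by (subst (asm) ennreal_mult_le_mult_iff) auto
  then show ?thesis
    using E_nonneg by (simp add: \<theta>_def)
qed

end

section \<open>The inequality\<close>

lemma truncated_power_bound:
  fixes q a M :: real
  defines "\<theta> \<equiv> (q - 2) / q"
  assumes H1: "has_H1_gradient \<phi> G" and mean: "(\<integral>x. \<phi> x \<partial>sphere_measure) = 0"
    and q: "2 < q" and a: "0 < a" and M: "0 < M"
  shows "(\<integral>x. (min \<bar>\<phi> x\<bar> M) powr q \<partial>sphere_measure) powr (2 / q)
    \<le> (a powr (1 - 1 / \<theta>) / (4 * pi * (1 / \<theta> - 1))) powr \<theta> * (a * ip \<phi> \<phi> + (\<integral>x. (norm (G x))\<^sup>2 \<partial>sphere_measure))"
proof -
  define \<psi> where "\<psi> x = min \<bar>\<phi> x\<bar> M" for x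
  have \<theta>: "0 < \<theta>" "\<theta> < 1" "q * \<theta> = q - 2" "1 - \<theta> = 2 / q"
    using q by (simp_all add: \<theta>_def field_simps)
  have \<phi>: "\<phi> \<in> L2_sphere"
    using H1 by (simp add: has_H1_gradient_def)
  then have [measurable]: "\<phi> \<in> borel_measurable sphere_measure"
    by (simp add: L2_sphere_def)
  have \<psi>: "0 \<le> \<psi> x" "\<psi> x \<le> M" "\<psi> x \<le> \<bar>\<phi> x\<bar>" for x
    using M by (simp_all add: \<psi>_def)
  have [measurable]: "\<psi> \<in> borel_measurable sphere_measure"
    unfolding \<psi>_def[abs_def] by measurable
  interpret H1_interpolation \<phi> G "\<lambda>x. \<psi> x powr q" a "1 / \<theta>" "M powr q"
  proof unfold_locales
    show "1 < 1 / \<theta>" using \<theta> by simp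
    show "\<psi> x powr q \<le> M powr q" for x
      using \<psi> q by (intro powr_mono2) auto
  qed (use H1 mean a in auto)
  have int1: "integrable sphere_measure (\<lambda>x. \<psi> x powr (q - 2) * (\<phi> x)\<^sup>2)"
  proof (rule Bochner_Integration.integrable_bound)
    show "integrable sphere_measure (\<lambda>x. M powr (q - 2) * (\<phi> x)\<^sup>2)"
      using phi_square_integrable by simp
    show "AE x in sphere_measure. norm (\<psi> x powr (q - 2) * (\<phi> x)\<^sup>2) \<le> norm (M powr (q - 2) * (\<phi> x)\<^sup>2)"
      using \<psi> q by (intro AE_I2) (auto simp: abs_mult intro!: mult_right_mono powr_mono2)
  qed measurable
  have "X \<le> (\<integral>x. \<psi> x powr (q - 2) * (\<phi> x)\<^sup>2 \<partial>sphere_measure)"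
    unfolding X_def
  proof (rule integral_mono[OF W_integrable int1])
    fix x
    have "\<psi> x powr q = \<psi> x powr (q - 2) * (\<psi> x)\<^sup>2"
      using \<psi>(1)[of x] powr_add[of "\<psi> x" "q - 2" 2] by (cases "\<psi> x = 0") auto
    also have "\<dots> \<le> \<psi> x powr (q - 2) * (\<phi> x)\<^sup>2"
      using \<psi>[of x] power_mono[of "\<psi> x" "\<bar>\<phi> x\<bar>" 2] by (intro mult_left_mono) auto
    finally show "\<psi> x powr q \<le> \<psi> x powr (q - 2) * (\<phi> x)\<^sup>2" .
  qed
  also have "\<dots> = (\<integral>x. (\<psi> x powr q) powr (1 / (1 / \<theta>)) * (\<phi> x)\<^sup>2 \<partial>sphere_measure)"
    by (simp add: powr_powr \<theta>(3))
  also have "\<dots> \<le> (D * X) powr \<theta> * E"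
    using weighted_estimate by simp
  finally have le: "X \<le> D powr \<theta> * E * X powr \<theta>"
    using D_pos X_nonneg by (simp add: powr_mult mult_ac)
  have "X powr (1 - \<theta>) \<le> D powr \<theta> * E"
  proof (cases "X = 0")
    case True
    then show ?thesis using E_nonneg by simp
  next
    case False
    then have X: "0 < X" using X_nonneg by simp
    have "X powr (1 - \<theta>) * X powr \<theta> = X"
      using X powr_add[of X "1 - \<theta>" \<theta>] by simp
    then have "X powr (1 - \<theta>) * X powr \<theta> \<le> D powr \<theta> * E * X powr \<theta>"
      using le by simp
    then show ?thesis
      using X by (simp add: mult_le_cancel_right)
  qed
  then show ?thesis
    unfolding \<theta>(4) X_def D_def E_def by (simp add: \<psi>_def)
qed

lemma H1_power_bound:
  fixes q a :: real
  defines "\<theta> \<equiv> (q - 2) / q"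
  assumes H1: "has_H1_gradient \<phi> G" and mean: "(\<integral>x. \<phi> x \<partial>sphere_measure) = 0"
    and q: "2 < q" and a: "0 < a"
  shows "integrable sphere_measure (\<lambda>x. \<bar>\<phi> x\<bar> powr q)"
    and "(\<integral>x. \<bar>\<phi> x\<bar> powr q \<partial>sphere_measure) powr (2 / q)
    \<le> (a powr (1 - 1 / \<theta>) / (4 * pi * (1 / \<theta> - 1))) powr \<theta> * (a * ip \<phi> \<phi> + (\<integral>x. (norm (G x))\<^sup>2 \<partial>sphere_measure))"
proof -
  define C where "C = (a powr (1 - 1 / \<theta>) / (4 * pi * (1 / \<theta> - 1))) powr \<theta> * (a * ip \<phi> \<phi> + (\<integral>x. (norm (G x))\<^sup>2 \<partial>sphere_measure))"
  have "\<phi> \<in> L2_sphere"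
    using H1 by (simp add: has_H1_gradient_def)
  then have [measurable]: "\<phi> \<in> borel_measurable sphere_measure"
    by (simp add: L2_sphere_def)
  have C: "0 \<le> C"
    unfolding C_def using a by (intro mult_nonneg_nonneg add_nonneg_nonneg ip_nonneg integral_nonneg_AE) auto
  let ?f = "\<lambda>n x. ennreal ((min \<bar>\<phi> x\<bar> (real (Suc n))) powr q)"
  have bound: "(\<integral>\<^sup>+x. ?f n x \<partial>sphere_measure) \<le> ennreal (C powr (q / 2))" for n
  proof -
    let ?I = "\<integral>x. (min \<bar>\<phi> x\<bar> (real (Suc n))) powr q \<partial>sphere_measure"
    have int: "integrable sphere_measure (\<lambda>x. (min \<bar>\<phi> x\<bar> (real (Suc n))) powr q)"
    proof (rule sphere.integrable_const_bound)
      have "norm ((min \<bar>\<phi> x\<bar> (real (Suc n))) powr q) \<le> real (Suc n) powr q" for x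
        unfolding real_norm_def abs_of_nonneg[OF powr_ge_zero] using q by (intro powr_mono2) auto
      then show "AE x in sphere_measure. norm ((min \<bar>\<phi> x\<bar> (real (Suc n))) powr q) \<le> real (Suc n) powr q"
        by (intro AE_I2)
    qed measurable
    have "?I = (?I powr (2 / q)) powr (q / 2)"
      using q by (simp add: powr_powr integral_nonneg_AE)
    also have "\<dots> \<le> C powr (q / 2)"
      using truncated_power_bound[OF H1 mean q a, of "real (Suc n)"] q
      by (intro powr_mono2) (simp_all add: C_def \<theta>_def)
    finally show ?thesis
      by (subst nn_integral_eq_integral[OF int]) (auto intro: ennreal_leI)
  qed
  have "(\<integral>\<^sup>+x. ennreal (\<bar>\<phi> x\<bar> powr q) \<partial>sphere_measure) = (\<integral>\<^sup>+x. (SUP n. ?f n x) \<partial>sphere_measure)"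
  proof (rule nn_integral_cong)
    fix x
    show "ennreal (\<bar>\<phi> x\<bar> powr q) = (SUP n. ?f n x)"
    proof (rule antisym)
      obtain n where "\<bar>\<phi> x\<bar> \<le> real n" using real_arch_simple by blast
      then have "ennreal (\<bar>\<phi> x\<bar> powr q) = ?f n x" by (simp add: min_def)
      then show "ennreal (\<bar>\<phi> x\<bar> powr q) \<le> (SUP n. ?f n x)"
        by (rule ord_eq_le_trans) (intro SUP_upper UNIV_I)
      show "(SUP n. ?f n x) \<le> ennreal (\<bar>\<phi> x\<bar> powr q)"
        using q by (intro SUP_least ennreal_leI powr_mono2) auto
    qed
  qed
  also have "\<dots> = (SUP n. \<integral>\<^sup>+x. ?f n x \<partial>sphere_measure)"
  proof (rule nn_integral_monotone_convergence_SUP)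
    show "incseq ?f"
      using q by (intro incseq_SucI le_funI ennreal_leI powr_mono2) auto
  qed measurable
  also have "\<dots> \<le> ennreal (C powr (q / 2))"
    by (intro SUP_least bound)
  finally have le: "(\<integral>\<^sup>+x. ennreal (\<bar>\<phi> x\<bar> powr q) \<partial>sphere_measure) \<le> ennreal (C powr (q / 2))" .
  show int: "integrable sphere_measure (\<lambda>x. \<bar>\<phi> x\<bar> powr q)"
    by (rule integrableI_bounded) (use le in \<open>auto simp: le_less_trans[OF _ ennreal_less_top]\<close>)
  have "(\<integral>x. \<bar>\<phi> x\<bar> powr q \<partial>sphere_measure) \<le> C powr (q / 2)"
    using le by (subst (asm) nn_integral_eq_integral[OF int]) auto
  then have "(\<integral>x. \<bar>\<phi> x\<bar> powr q \<partial>sphere_measure) powr (2 / q) \<le> (C powr (q / 2)) powr (2 / q)"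
    using q by (intro powr_mono2 integral_nonneg_AE) auto
  also have "\<dots> = C"
    using q C by (simp add: powr_powr)
  finally show "(\<integral>x. \<bar>\<phi> x\<bar> powr q \<partial>sphere_measure) powr (2 / q)
    \<le> (a powr (1 - 1 / \<theta>) / (4 * pi * (1 / \<theta> - 1))) powr \<theta> * (a * ip \<phi> \<phi> + (\<integral>x. (norm (G x))\<^sup>2 \<partial>sphere_measure))"
    by (simp add: C_def)
qed

lemma sphere_poincare:
  assumes H1: "has_H1_gradient \<phi> G" and mean: "(\<integral>x. \<phi> x \<partial>sphere_measure) = 0"
  shows "2 * ip \<phi> \<phi> \<le> (\<integral>x. (norm (G x))\<^sup>2 \<partial>sphere_measure)"
proof -
  interpret H1_interpolation \<phi> G "\<lambda>_. 0" 1 2 0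
    by unfold_locales (use H1 mean in auto)
  have "(\<lambda>j. 2 * (c j)\<^sup>2) sums (2 * ip \<phi> \<phi>)"
    unfolding c_def by (intro sums_mult H1_parseval[OF H1])
  then have "(\<lambda>N. \<Sum>j<N. 2 * (c j)\<^sup>2) \<longlonglongrightarrow> 2 * ip \<phi> \<phi>"
    by (simp add: sums_def)
  then show ?thesis
  proof (rule LIMSEQ_le_const2, intro exI allI impI)
    fix N :: nat
    have "2 * (c j)\<^sup>2 \<le> eigenvalue j * (c j)\<^sup>2" for j
    proof (cases "j = 0")
      case False
      then have "1 \<le> real (floor_sqrt j)"
        using False floor_sqrt_greater_zero_iff[of j] by linarith
      then have "1 * (1 + 1) \<le> eigenvalue j"
        unfolding eigenvalue_def by (intro mult_mono) auto
      then show ?thesis by (intro mult_right_mono) auto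
    qed (simp add: c_0)
    then have "(\<Sum>j<N. 2 * (c j)\<^sup>2) \<le> (\<Sum>j<N. eigenvalue j * (c j)\<^sup>2)"
      by (rule sum_mono)
    also have "\<dots> \<le> (\<integral>x. (norm (G x))\<^sup>2 \<partial>sphere_measure)"
      unfolding c_def by (rule H1_bessel[OF H1])
    finally show "(\<Sum>j<N. 2 * (c j)\<^sup>2) \<le> (\<integral>x. (norm (G x))\<^sup>2 \<partial>sphere_measure)" .
  qed
qed

lemma optimal_parameter:
  fixes q N E :: real
  defines "\<theta> \<equiv> (q - 2) / q" and "a \<equiv> 2 * E / ((q - 2) * N)"
  assumes q: "2 < q" and N: "0 < N" and E: "0 < E"
  shows "(a powr (1 - 1 / \<theta>) / (4 * pi * (1 / \<theta> - 1))) powr \<theta> * (a * N + E)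
    = (1 / (4 * pi)) powr \<theta> * (q / 2) * N powr (2 / q) * E powr \<theta>"
proof -
  define r where "r = 2 / (q - 2)"
  have r: "0 < r" and a: "a = r * (E / N)" and \<theta>: "0 < \<theta>" "1 / \<theta> - 1 = r" "(1 - 1 / \<theta>) * \<theta> = - (2 / q)" "\<theta> + 2 / q = 1"
    using q N by (simp_all add: r_def a_def \<theta>_def field_simps)
  have apos: "0 < a" using a r E N by simp
  have "(a powr (1 - 1 / \<theta>) / (4 * pi * r)) powr \<theta> = a powr (- (2 / q)) * ((1 / (4 * pi)) powr \<theta> * r powr (- \<theta>))"
    using r apos by (simp add: powr_divide powr_mult powr_powr \<theta>(3) powr_minus_divide)
  also have "a powr (- (2 / q)) = r powr (- (2 / q)) * (E powr (- (2 / q)) * N powr (2 / q))"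
    using r E N by (simp add: a powr_mult powr_divide powr_minus_divide)
  finally have 1: "(a powr (1 - 1 / \<theta>) / (4 * pi * (1 / \<theta> - 1))) powr \<theta>
      = (1 / (4 * pi)) powr \<theta> * (r powr (- \<theta>) * r powr (- (2 / q))) * N powr (2 / q) * E powr (- (2 / q))"
    by (simp add: \<theta>(2) mult_ac)
  have "r powr (- \<theta>) * r powr (- (2 / q)) = r powr (- (\<theta> + 2 / q))"
    by (simp add: powr_add[symmetric])
  also have "\<dots> = (q - 2) / 2"
    using r by (simp only: \<theta>(4)) (simp add: powr_minus_divide r_def)
  finally have 2: "r powr (- \<theta>) * r powr (- (2 / q)) = (q - 2) / 2" .
  have "a * N + E = E * (q / (q - 2))"
    using q N by (simp add: a_def field_simps)
  moreover have "E powr (- (2 / q)) * E = E powr \<theta>"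
  proof -
    have eq: "\<theta> = - (2 / q) + 1" using \<theta>(4) by linarith
    show ?thesis unfolding eq powr_add using E by simp
  qed
  ultimately have 3: "E powr (- (2 / q)) * (a * N + E) = E powr \<theta> * (q / (q - 2))"
    by (simp add: mult.assoc[symmetric])
  have 4: "(q - 2) / 2 * (q / (q - 2)) = q / 2"
    using q by (simp add: field_simps)
  have "(a powr (1 - 1 / \<theta>) / (4 * pi * (1 / \<theta> - 1))) powr \<theta> * (a * N + E)
      = (1 / (4 * pi)) powr \<theta> * ((q - 2) / 2) * N powr (2 / q) * (E powr (- (2 / q)) * (a * N + E))"
    unfolding 1 2 by (simp only: mult.assoc)
  also have "\<dots> = (1 / (4 * pi)) powr \<theta> * ((q - 2) / 2 * (q / (q - 2))) * N powr (2 / q) * E powr \<theta>"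
    unfolding 3 by (simp only: mult_ac)
  finally show ?thesis
    unfolding 4 .
qed

theorem corollary2p1:
  fixes q :: real and \<phi> :: "real^3 \<Rightarrow> real"
  assumes "2 \<le> q" and "\<phi> \<in> H1dot_S2"
  shows "integrable sphere_measure (\<lambda>x. \<bar>\<phi> x\<bar> powr q) \<and>
    Lnorm q \<phi> \<le> (1 / (4 * pi)) powr ((q - 2) / (2 * q)) * (q / 2) powr (1 / 2) *
      Lnorm 2 \<phi> powr (2 / q) *
      (if q = 2 then 1 else Lnorm 2 (grad_S2 \<phi>) powr (1 - 2 / q))"
proof -
  have mean: "(\<integral>x. \<phi> x \<partial>sphere_measure) = 0" and ex: "\<exists>G. has_H1_gradient \<phi> G"
    using assms(2) by (auto simp: H1dot_S2_def H1_S2_def)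
  have H1: "has_H1_gradient \<phi> (grad_S2 \<phi>)"
    unfolding grad_S2_def by (rule someI_ex[OF ex])
  have \<phi>: "\<phi> \<in> L2_sphere"
    using H1 by (simp add: has_H1_gradient_def)
  show ?thesis
  proof (cases "q = 2")
    case True
    then show ?thesis
      using \<phi> by (simp add: L2_sphere_def Lnorm_def)
  next
    case False
    then have q: "2 < q" using assms(1) by simp
    define \<theta> where "\<theta> = (q - 2) / q"
    define N where "N = ip \<phi> \<phi>"
    define E where "E = (\<integral>x. (norm (grad_S2 \<phi> x))\<^sup>2 \<partial>sphere_measure)"
    define I where "I = (\<integral>x. \<bar>\<phi> x\<bar> powr q \<partial>sphere_measure)"
    have nonneg: "0 \<le> N" "0 \<le> E" "0 \<le> I"
      by (simp_all add: N_def E_def I_def ip_nonneg integral_nonneg_AE)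
    have bound: "I powr (2 / q) \<le> (1 / (4 * pi)) powr \<theta> * (q / 2) * N powr (2 / q) * E powr \<theta>"
    proof (cases "N = 0")
      case True
      have "AE x in sphere_measure. \<phi> x * \<phi> x = 0"
        using True integrable_L2_mult[OF \<phi> \<phi>] unfolding N_def ip_def
        by (subst (asm) integral_nonneg_eq_0_iff_AE) auto
      then have "AE x in sphere_measure. \<bar>\<phi> x\<bar> powr q = 0"
        by simp
      then have "I = (\<integral>x. 0 \<partial>sphere_measure)"
        unfolding I_def using \<phi> by (intro integral_cong_AE) (auto simp: L2_sphere_def)
      then show ?thesis using q by simp
    next
      case False
      then have N: "0 < N" using nonneg by simp
      then have E: "0 < E"
        using sphere_poincare[OF H1 mean] unfolding N_def E_def by simp
      have "0 < 2 * E / ((q - 2) * N)"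
        using q N E by simp
      from H1_power_bound(2)[OF H1 mean q this] show ?thesis
        unfolding I_def[symmetric] N_def[symmetric] E_def[symmetric] \<theta>_def optimal_parameter[OF q N E] .
    qed
    have "Lnorm q \<phi> = sqrt (I powr (2 / q))"
      by (simp add: Lnorm_def I_def powr_half_sqrt[symmetric] powr_powr)
    also have "\<dots> \<le> sqrt ((1 / (4 * pi)) powr \<theta> * (q / 2) * N powr (2 / q) * E powr \<theta>)"
      using bound by simp
    also have "\<dots> = (1 / (4 * pi)) powr (\<theta> / 2) * (q / 2) powr (1 / 2) * sqrt N powr (2 / q) * sqrt E powr \<theta>"
    proof -
      have sq: "sqrt (x powr e) = x powr (e / 2)" "sqrt x powr e = x powr (e / 2)" if "0 \<le> x" for x e :: real
        using that by (simp_all add: powr_half_sqrt[symmetric] powr_powr)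
      show ?thesis
        unfolding real_sqrt_mult using nonneg q by (simp add: sq powr_half_sqrt)
    qed
    also have "sqrt N = Lnorm 2 \<phi>"
      by (simp add: N_def Lnorm_2_ip)
    also have "sqrt E = Lnorm 2 (grad_S2 \<phi>)"
      by (simp add: E_def Lnorm_2)
    also have "\<theta> = 1 - 2 / q"
      using q by (simp add: \<theta>_def field_simps)
    also have "(1 - 2 / q) / 2 = (q - 2) / (2 * q)"
      using q by (simp add: field_simps)
    finally show ?thesis
      using H1_power_bound(1)[OF H1 mean q zero_less_one] False by simp
  qed
qed

end
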